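(* Let $\mathcal P=(\{\alpha_i\},\{\beta_j\},\gamma)$ be Thoma parameters satisfying the strict monotonicity condition: $\alpha_i>\alpha_{i+1}$ for every $i$ with $\alpha_i\neq 0$, and $\beta_j>\beta_{j+1}$ for every $j$ with $\beta_j\neq0$. Let $K,L>0$ be integers such that $\alpha_1>\alpha_2>\dots>\alpha_K>0$ and $\beta_1>\beta_2>\dots>\beta_L>0$. Then, as $n\to\infty$, $$\Bigl(\tfrac{\lambda_1^{\mathcal P}(n)-\alpha_1 n}{\sqrt n},\dots,\tfrac{\lambda_K^{\mathcal P}(n)-\alpha_K n}{\sqrt n},\tfrac{\lambda_1'^{\mathcal P}(n)-\beta_1 n}{\sqrt n},\dots,\tfrac{\lambda_L'^{\mathcal P}(n)-\beta_L n}{\sqrt n}\Bigr)$$ converges in law to a Gaussian vector $Z=(Z_1,\dots,Z_K,Z_1',\dots,Z_L')$ with $\mathbf E Z_i=\mathbf E Z_j'=0$, $\mathbf E Z_i^2=\alpha_i-\alpha_i^2$, $\mathbf E Z_j'^2=\beta_j-\beta_j^2$, $\mathbf E Z_iZ_{i'}=-\alpha_i\alpha_{i'}$ ($i\ne i'$), $\mathbf E Z_j'Z_{j'}'=-\beta_j\beta_{j'}$ ($j\neq j'$), and $\mathbf E Z_iZ_j'=-\alpha_i\beta_j$.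
   Context: Thoma parameters: $\mathcal P=(\{\alpha_i\}_{i\ge1},\{\beta_j\}_{j\ge1},\gamma)$ with real $\alpha_1\ge\alpha_2\ge\dots\ge0$, $\beta_1\ge\beta_2\ge\dots\ge0$, $\gamma\ge0$, $\sum_i(\alpha_i+\beta_i)+\gamma=1$. Let $\mathbb Y_n$ be the set of Young diagrams with $n$ boxes and, for $\lambda\in\mathbb Y_n$, let $\dim\lambda$ be the number of standard Young tableaux of shape $\lambda$. Let $\pi^{\mathcal P}$ be the algebra homomorphism from the algebra of symmetric functions to $\mathbb C$ determined by $1+\sum_{n\ge1}\pi^{\mathcal P}(h_n)z^n=e^{\gamma z}\prod_{i\ge1}\frac{1+\beta_i z}{1-\alpha_i z}$ ($h_n$ the complete homogeneous symmetric functions). Then $M_n^{\mathcal P}(\lambda)=\dim\lambda\cdot\pi^{\mathcal P}(s_\lambda)$ ($s_\lambda$ the Schur function) is a probability measure on $\mathbb Y_n$ (the measure associated with the extremal character of the infinite symmetric group with Thoma parameters $\mathcal P$). $\lambda_i^{\mathcal P}(n)$ and $\lambda_j'^{\mathcal P}(n)$ denote the length of the $i$-th row and of the $j$-th column of a random Young diagram distributed according to $M_n^{\mathcal P}$. *)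

theory Defs
  imports "HOL-Probability.Probability" "HOL-Combinatorics.Permutations"
begin

text \<open>Conventions: Thoma parameters are given as sequences alpha beta :: nat => real
  indexed from 0, i.e. alpha i is the paper's alpha_(i+1).\<close>

definition thoma_params :: "(nat \<Rightarrow> real) \<Rightarrow> (nat \<Rightarrow> real) \<Rightarrow> real \<Rightarrow> bool" where
  "thoma_params \<alpha> \<beta> \<gamma> \<longleftrightarrow>
     (\<forall>i. \<alpha> i \<ge> 0 \<and> \<alpha> (Suc i) \<le> \<alpha> i) \<and>
     (\<forall>j. \<beta> j \<ge> 0 \<and> \<beta> (Suc j) \<le> \<beta> j) \<and> \<gamma> \<ge> 0 \<and>
     summable \<alpha> \<and> summable \<beta> \<and> suminf \<alpha> + suminf \<beta> + \<gamma> = 1"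

definition young :: "nat \<Rightarrow> nat list set" where
  "young n = {lam. sorted_wrt (\<ge>) lam \<and> 0 \<notin> set lam \<and> sum_list lam = n}"

text \<open>Length of the i-th row and j-th column (1-based, 0 if absent).\<close>
definition row_len :: "nat list \<Rightarrow> nat \<Rightarrow> nat" where
  "row_len lam i = (if 1 \<le> i \<and> i \<le> length lam then lam ! (i - 1) else 0)"

definition col_len :: "nat list \<Rightarrow> nat \<Rightarrow> nat" where
  "col_len lam j = length (filter (\<lambda>r. j \<le> r) lam)"

definition cells :: "nat list \<Rightarrow> (nat \<times> nat) set" where
  "cells lam = {(i, j). i < length lam \<and> j < lam ! i}"

definition syt :: "nat list \<Rightarrow> ((nat \<times> nat) \<Rightarrow> nat) set" where
  "syt lam = {T. T \<in> cells lam \<rightarrow>\<^sub>E {1..sum_list lam} \<and>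
                 bij_betw T (cells lam) {1..sum_list lam} \<and>
                 (\<forall>i j. (i, Suc j) \<in> cells lam \<longrightarrow> T (i, j) < T (i, Suc j)) \<and>
                 (\<forall>i j. (Suc i, j) \<in> cells lam \<longrightarrow> T (i, j) < T (Suc i, j))}"

definition dimY :: "nat list \<Rightarrow> nat" where
  "dimY lam = card (syt lam)"

text \<open>The generating function e^(gamma z) prod (1 + beta_i z)/(1 - alpha_i z) and
  pi(h_n) = its n-th Taylor coefficient at 0.\<close>
definition thoma_gf :: "(nat \<Rightarrow> real) \<Rightarrow> (nat \<Rightarrow> real) \<Rightarrow> real \<Rightarrow> real \<Rightarrow> real" where
  "thoma_gf \<alpha> \<beta> \<gamma> z = exp (\<gamma> * z) * (\<Prod>i. (1 + \<beta> i * z) / (1 - \<alpha> i * z))"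

definition thoma_h :: "(nat \<Rightarrow> real) \<Rightarrow> (nat \<Rightarrow> real) \<Rightarrow> real \<Rightarrow> int \<Rightarrow> real" where
  "thoma_h \<alpha> \<beta> \<gamma> k = (if k < 0 then 0
      else (deriv ^^ nat k) (thoma_gf \<alpha> \<beta> \<gamma>) 0 / fact (nat k))"

text \<open>pi(s_lambda) via the Jacobi-Trudi identity s_lambda = det [h_(lambda_i - i + j)].\<close>
definition thoma_s :: "(nat \<Rightarrow> real) \<Rightarrow> (nat \<Rightarrow> real) \<Rightarrow> real \<Rightarrow> nat list \<Rightarrow> real" where
  "thoma_s \<alpha> \<beta> \<gamma> lam =
     (\<Sum>p | p permutes {..<length lam}. of_int (sign p) *
        (\<Prod>i<length lam. thoma_h \<alpha> \<beta> \<gamma> (int (lam ! i) - int i + int (p i))))"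

definition thoma_M :: "(nat \<Rightarrow> real) \<Rightarrow> (nat \<Rightarrow> real) \<Rightarrow> real \<Rightarrow> nat list \<Rightarrow> real" where
  "thoma_M \<alpha> \<beta> \<gamma> lam = real (dimY lam) * thoma_s \<alpha> \<beta> \<gamma> lam"

definition real_normal_law :: "real measure \<Rightarrow> bool" where
  "real_normal_law \<mu> \<longleftrightarrow>
     (\<exists>m s. s > 0 \<and> \<mu> = density lborel (normal_density m s)) \<or> (\<exists>c. \<mu> = return lborel c)"

text \<open>Law N on R^m (embedded in nat => real, coordinates >= m vanish) of a Gaussian vector:
  every linear combination of the coordinates is normal.\<close>
definition gaussian_law :: "nat \<Rightarrow> (nat \<Rightarrow> real) measure \<Rightarrow> bool" where
  "gaussian_law m N \<longleftrightarrow> prob_space N \<and> sets N = sets borel \<and>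
     (AE x in N. \<forall>i\<ge>m. x i = 0) \<and>
     (\<forall>t :: nat \<Rightarrow> real. real_normal_law (distr N lborel (\<lambda>x. \<Sum>i<m. t i * x i)))"

definition conv_in_law :: "(nat \<Rightarrow> nat list set) \<Rightarrow> (nat \<Rightarrow> nat list \<Rightarrow> real) \<Rightarrow>
     (nat \<Rightarrow> nat list \<Rightarrow> nat \<Rightarrow> real) \<Rightarrow> (nat \<Rightarrow> real) measure \<Rightarrow> bool" where
  "conv_in_law Y P X N \<longleftrightarrow>
     (\<forall>f :: (nat \<Rightarrow> real) \<Rightarrow> real. continuous_on UNIV f \<and> bounded (range f) \<longrightarrow>
        (\<lambda>n. \<Sum>lam\<in>Y n. P n lam * f (X n lam)) \<longlonglongrightarrow> (\<integral>x. f x \<partial>N))"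

end

theory Submission
  imports Defs
begin

text \<open>
  A specialisation is described by its values \<open>h k\<close> on complete homogeneous functions. Splitting off one
  letter from the generating function expands a Jacobi--Trudi determinant over horizontal (row letter)
  or vertical (column letter) strips, by multilinearity. Splitting off the first \<open>K\<close> row and \<open>L\<close>
  column letters couples the random diagram with counts of letters whose joint generating function is
  \<open>(\<Sum>i. x i * t i + rest) ^ n\<close>, i.e. multinomial counts, and interlacing shows that partial sums of row
  (column) lengths dominate partial sums of the counts.

  That the gap has bounded expectation comes from the third power sum: the expectation of the sum of
  squared contents is \<open>n * (n - 1) / 2 + n * (n - 1) * (n - 2) / 3 * p 3\<close>, while this sum is at least a third
  of the sum of the cubes of rows and columns. Linearising the cubes at \<open>\<alpha> i * n\<close>, \<open>\<beta> j * n\<close> and summing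
  by parts gives \<open>((\<alpha> k)\<^sup>2 - (\<alpha> (k + 1))\<^sup>2) * E (\<Sum>i\<le>k. row i - \<alpha> i * n) \<le> 2\<close>; here strict
  monotonicity enters. So rows and columns have the same \<open>sqrt n\<close> fluctuations as the counts.
\<close>

section \<open>Determinants by the Leibniz formula\<close>

text \<open>The second power sum would not do: it goes with the plain sum of contents, to which rows
  and columns contribute with opposite signs. Squared contents make both contributions non-negative.
  The leading term n^3 / 3 * \<open>p 3\<close> of their mean is matched by the cubes of \<alpha> i
  * n and \<beta> j * n, so only terms of order n^2 remain, and dividing by n^2 leaves a gap of
  order 1.

  Domination of partial sums gives the gap a sign. A bound on its mean, the only thing the content
  identity yields, is therefore a bound on its mean absolute value, and a first moment of order 1 is
  negligible after division by sqrt n.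

  Infinitely many letters and \<gamma> are not expanded. What is left after K + L letters stays one
  specialisation \<open>hrest\<close> and acts as a single further cell of the multinomial law, with
  probability \<open>hrest 1\<close>. The weights of the coupling are non-negative because every
  Thoma specialisation is a limit of finite alphabets, \<gamma> being replaced by N row letters
  \<gamma> / N.\<close>

definition ldet :: "nat \<Rightarrow> (nat \<Rightarrow> nat \<Rightarrow> 'a::field_char_0) \<Rightarrow> 'a" where
  "ldet n M = (\<Sum>p | p permutes {..<n}. of_int (sign p) * (\<Prod>i<n. M i (p i)))"

text \<open>The derivative of det (M + t N) at t = 0: one factor of each Leibniz term is taken from
  N. Expanding it by rows or by columns gives the same number, which is how an operation on rows
  (adding a box) is traded for one on columns (shifting an index).\<close>

definition line_sum :: "nat \<Rightarrow> (nat \<Rightarrow> nat \<Rightarrow> 'a::field_char_0) \<Rightarrow> (nat \<Rightarrow> nat \<Rightarrow> 'a) \<Rightarrow> 'a" where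
  "line_sum n M N = (\<Sum>p | p permutes {..<n}. of_int (sign p) *
     (\<Sum>i<n. N i (p i) * (\<Prod>k\<in>{..<n} - {i}. M k (p k))))"

lemma permutes_less: "p permutes {..<n} \<Longrightarrow> i < n \<Longrightarrow> p i < (n::nat)"
  using permutes_in_image[of p "{..<n}" i] by simp

lemma ldet_cong:
  assumes "\<And>i j. i < n \<Longrightarrow> j < n \<Longrightarrow> M i j = M' i j"
  shows "ldet n M = ldet n M'"
  unfolding ldet_def by (intro sum.cong refl arg_cong2[where f="(*)"] prod.cong) (auto intro: assms permutes_less)

lemma line_sum_cong:
  assumes "\<And>i j. i < n \<Longrightarrow> j < n \<Longrightarrow> N i j = N' i j"
  shows "line_sum n M N = line_sum n M N'"
  unfolding line_sum_def by (intro sum.cong refl arg_cong2[where f="(*)"]) (auto intro: assms permutes_less)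

lemma ldet_swap_rows:
  assumes "a < n" "b < n" "a \<noteq> b"
  shows "ldet n (\<lambda>i. M (Transposition.transpose a b i)) = - ldet n M"
proof -
  let ?t = "Transposition.transpose a b"
  have t: "?t permutes {..<n}" using assms by (simp add: permutes_swap_id)
  have "ldet n (\<lambda>i. M (?t i)) =
      (\<Sum>p | p permutes {..<n}. of_int (sign (p \<circ> ?t)) * (\<Prod>i<n. M (?t i) ((p \<circ> ?t) i)))"
    unfolding ldet_def by (rule sum_permutations_compose_right[OF t])
  also have "\<dots> = (\<Sum>p | p permutes {..<n}. - (of_int (sign p) * (\<Prod>i<n. M i (p i))))"
  proof (intro sum.cong refl)
    fix p assume "p \<in> {p. p permutes {..<n}}"
    then have p: "p permutes {..<n}" by simp
    have pp: "permutation p" using p permutation_permutes by blast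
    have pt: "permutation ?t" using t permutation_permutes by blast
    have "sign (p \<circ> ?t) = - sign p"
      using assms by (simp add: sign_compose[OF pp pt] sign_swap_id)
    moreover have "(\<Prod>i<n. M (?t i) ((p \<circ> ?t) i)) = (\<Prod>i<n. M i (p i))"
      using prod.permute[OF t, of "\<lambda>i. M i (p i)"] by (simp add: o_def)
    ultimately show "of_int (sign (p \<circ> ?t)) * (\<Prod>i<n. M (?t i) ((p \<circ> ?t) i)) =
        - (of_int (sign p) * (\<Prod>i<n. M i (p i)))" by simp
  qed
  finally show ?thesis by (simp add: ldet_def sum_negf)
qed

lemma ldet_swap_cols:
  assumes "a < n" "b < n" "a \<noteq> b"
  shows "ldet n (\<lambda>i j. M i (Transposition.transpose a b j)) = - ldet n M"
proof -
  let ?t = "Transposition.transpose a b"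
  have t: "?t permutes {..<n}" using assms by (simp add: permutes_swap_id)
  have "- ldet n M =
      - (\<Sum>p | p permutes {..<n}. of_int (sign (?t \<circ> p)) * (\<Prod>i<n. M i ((?t \<circ> p) i)))"
    unfolding ldet_def
    by (subst setum_permutations_compose_left[OF t]) simp
  also have "\<dots> = (\<Sum>p | p permutes {..<n}. (of_int (sign p) * (\<Prod>i<n. M i (?t (p i)))))"
    unfolding sum_negf[symmetric]
  proof (intro sum.cong refl)
    fix p assume "p \<in> {p. p permutes {..<n}}"
    then have p: "p permutes {..<n}" by simp
    have pp: "permutation p" using p permutation_permutes by blast
    have pt: "permutation ?t" using t permutation_permutes by blast
    have "sign (?t \<circ> p) = - sign p"
      using assms by (simp add: sign_compose[OF pt pp] sign_swap_id)
    then show "- (of_int (sign (?t \<circ> p)) * (\<Prod>i<n. M i ((?t \<circ> p) i))) =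
        (of_int (sign p) * (\<Prod>i<n. M i (?t (p i))))" by simp
  qed
  finally show ?thesis by (simp add: ldet_def)
qed

lemma ldet_equal_rows:
  assumes "a < n" "b < n" "a \<noteq> b" "\<And>j. j < n \<Longrightarrow> M a j = M b j"
  shows "ldet n M = 0"
proof -
  have "ldet n (\<lambda>i. M (Transposition.transpose a b i)) = ldet n M"
    by (intro ldet_cong) (auto simp: Transposition.transpose_def assms(4))
  then show ?thesis using ldet_swap_rows[OF assms(1-3), of M] by simp
qed

lemma ldet_equal_cols:
  assumes "a < n" "b < n" "a \<noteq> b" "\<And>i. i < n \<Longrightarrow> M i a = M i b"
  shows "ldet n M = 0"
proof -
  have "ldet n (\<lambda>i j. M i (Transposition.transpose a b j)) = ldet n M"
    by (intro ldet_cong) (auto simp: Transposition.transpose_def assms(4))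
  then show ?thesis using ldet_swap_cols[OF assms(1-3), of M] by simp
qed

lemma prod_upd_remove:
  fixes i n :: nat
  assumes "i < n"
  shows "(\<Prod>k<n. (if k = i then x else g k)) = x * (\<Prod>k\<in>{..<n} - {i}. g k :: 'a::comm_monoid_mult)"
  using assms by (subst prod.remove[of "{..<n}" i]) (auto intro!: arg_cong2[where f="(*)"] prod.cong)

lemma ldet_upd:
  assumes "i < n"
  shows "ldet n (M(i := u)) = (\<Sum>p | p permutes {..<n}. of_int (sign p) *
     (u (p i) * (\<Prod>k\<in>{..<n} - {i}. M k (p k))))"
  unfolding ldet_def
proof (intro sum.cong refl arg_cong2[where f="(*)"])
  fix p
  have "(\<Prod>k<n. (M(i := u)) k (p k)) = (\<Prod>k<n. if k = i then u (p i) else M k (p k))"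
    by (intro prod.cong) auto
  then show "(\<Prod>k<n. (M(i := u)) k (p k)) = u (p i) * (\<Prod>k\<in>{..<n} - {i}. M k (p k))"
    using prod_upd_remove[OF assms] by metis
qed

lemma ldet_row_add_mult:
  assumes "i < n"
  shows "ldet n (M(i := \<lambda>j. u j + c * v j)) = ldet n (M(i := u)) + c * ldet n (M(i := v))"
  unfolding ldet_upd[OF assms] by (simp add: sum_distrib_left sum.distrib[symmetric] algebra_simps)

lemma line_sum_row:
  "line_sum n M (\<lambda>i j. w i * N i j) = (\<Sum>i<n. w i * ldet n (M(i := N i)))"
proof -
  have "(\<Sum>i<n. w i * ldet n (M(i := N i))) = (\<Sum>i<n. \<Sum>p | p permutes {..<n}. w i * (of_int (sign p) *
     (N i (p i) * (\<Prod>k\<in>{..<n} - {i}. M k (p k)))))"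
    by (intro sum.cong refl) (simp add: ldet_upd sum_distrib_left)
  also have "\<dots> = line_sum n M (\<lambda>i j. w i * N i j)"
    unfolding line_sum_def by (subst sum.swap) (simp add: sum_distrib_left algebra_simps)
  finally show ?thesis by simp
qed

lemma line_sum_col:
  "line_sum n M (\<lambda>i j. w j * N i j) = (\<Sum>j<n. w j * ldet n (\<lambda>i k. if k = j then N i j else M i k))"
proof -
  have *: "(\<Sum>i<n. w (p i) * N i (p i) * (\<Prod>k\<in>{..<n} - {i}. M k (p k))) =
      (\<Sum>j<n. w j * (\<Prod>k<n. if p k = j then N k j else M k (p k)))" if p: "p permutes {..<n}" for p
  proof -
    have "(\<Sum>j<n. w j * (\<Prod>k<n. if p k = j then N k j else M k (p k))) =
        (\<Sum>i<n. w (p i) * (\<Prod>k<n. if p k = p i then N k (p i) else M k (p k)))"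
      using sum.permute[OF p, of "\<lambda>j. w j * (\<Prod>k<n. if p k = j then N k j else M k (p k))"] by (simp add: o_def)
    also have "\<dots> = (\<Sum>i<n. w (p i) * (N i (p i) * (\<Prod>k\<in>{..<n} - {i}. M k (p k))))"
    proof (intro sum.cong refl arg_cong2[where f="(*)"])
      fix i assume i: "i \<in> {..<n}"
      have "(\<Prod>k<n. if p k = p i then N k (p i) else M k (p k)) = (\<Prod>k<n. if k = i then N i (p i) else M k (p k))"
        using permutes_inj[OF p] by (intro prod.cong) (auto dest: injD)
      then show "(\<Prod>k<n. if p k = p i then N k (p i) else M k (p k)) = N i (p i) * (\<Prod>k\<in>{..<n} - {i}. M k (p k))"
        using prod_upd_remove[of i n "N i (p i)"] i by simp
    qed
    finally show ?thesis by (simp add: mult.assoc)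
  qed
  have "(\<Sum>j<n. w j * ldet n (\<lambda>i k. if k = j then N i j else M i k)) =
     (\<Sum>p | p permutes {..<n}. of_int (sign p) * (\<Sum>j<n. w j * (\<Prod>k<n. if p k = j then N k j else M k (p k))))"
    unfolding ldet_def sum_distrib_left by (subst sum.swap) (simp add: algebra_simps)
  also have "\<dots> = line_sum n M (\<lambda>i j. w j * N i j)"
    unfolding line_sum_def
  proof (intro sum.cong refl, goal_cases)
    case (1 p)
    then show ?case using *[of p] by simp
  qed
  finally show ?thesis by simp
qed

lemma line_sum_add: "line_sum n M (\<lambda>i j. N i j + N' i j) = line_sum n M N + line_sum n M N'"
  unfolding line_sum_def by (simp add: sum.distrib distrib_left distrib_right)

lemma line_sum_scale: "line_sum n M (\<lambda>i j. c * N i j) = c * line_sum n M N"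
  unfolding line_sum_def by (simp add: sum_distrib_left algebra_simps)

lemma line_sum_sum:
  "finite A \<Longrightarrow> line_sum n M (\<lambda>i j. \<Sum>q\<in>A. N q i j) = (\<Sum>q\<in>A. line_sum n M (N q))"
  by (induction A rule: finite_induct) (simp add: line_sum_def, simp add: line_sum_add)

lemma ldet_rows_sum:
  assumes "\<And>i. i < n \<Longrightarrow> finite (A i)"
  shows "ldet n (\<lambda>i j. \<Sum>k\<in>A i. g i k j) = (\<Sum>\<kappa>\<in>PiE {..<n} A. ldet n (\<lambda>i j. g i (\<kappa> i) j))"
proof -
  have "ldet n (\<lambda>i j. \<Sum>k\<in>A i. g i k j) =
     (\<Sum>p | p permutes {..<n}. of_int (sign p) * (\<Sum>\<kappa>\<in>PiE {..<n} A. \<Prod>i<n. g i (\<kappa> i) (p i)))"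
    unfolding ldet_def
    by (intro sum.cong refl arg_cong2[where f="(*)"] prod_sum_PiE) (use assms in auto)
  then show ?thesis unfolding ldet_def sum_distrib_left
    by (subst sum.swap) 
qed

lemma ldet_rows_scale: "ldet n (\<lambda>i j. c i * M i j) = (\<Prod>i<n. c i) * ldet n M"
  unfolding ldet_def by (simp add: prod.distrib sum_distrib_left algebra_simps)

text \<open>Rows are changed from the top down, so row k + 1 is still the original one when it is
  subtracted from row k. The simultaneous operation is thus a product of elementary ones.\<close>

lemma ldet_row_op:
  "ldet n (\<lambda>i j. if i < k \<and> Suc i < n then M i j - c i * M (Suc i) j else M i j) = ldet n M"
proof (induction k)
  case (Suc k)
  let ?M = "\<lambda>k i j. if i < k \<and> Suc i < n then M i j - c i * M (Suc i) j else M i j"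
  show ?case
  proof (cases "Suc k < n")
    case True
    have "?M (Suc k) = (?M k)(k := \<lambda>j. ?M k k j + (- c k) * ?M k (Suc k) j)"
      using True by (auto simp: fun_eq_iff)
    then have "ldet n (?M (Suc k)) = ldet n ((?M k)(k := \<lambda>j. ?M k k j + (- c k) * ?M k (Suc k) j))"
      by (rule arg_cong)
    also have "\<dots> = ldet n ((?M k)(k := ?M k k)) + (- c k) * ldet n ((?M k)(k := ?M k (Suc k)))"
      using True by (subst ldet_row_add_mult) auto
    also have "ldet n ((?M k)(k := ?M k (Suc k))) = 0"
      by (rule ldet_equal_rows[of k _ "Suc k"]) (use True in auto)
    finally show ?thesis using Suc.IH by (simp add: fun_upd_idem)
  next
    case False
    then have "?M (Suc k) = ?M k" by (auto simp: fun_eq_iff less_Suc_eq)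
    then show ?thesis using Suc.IH by simp
  qed
qed simp

text \<open>Only permutations fixing n contribute. In a Jacobi--Trudi determinant the last row has
  this form when the last row of the diagram is empty.\<close>

lemma ldet_last_row:
  assumes "\<And>j. j < n \<Longrightarrow> M n j = 0"
  shows "ldet (Suc n) M = M n n * ldet n M"
proof -
  have "ldet (Suc n) M = (\<Sum>p | p permutes {..<n}. of_int (sign p) * (\<Prod>i<Suc n. M i (p i)))"
    unfolding ldet_def
  proof (intro sum.mono_neutral_right)
    show "finite {p. p permutes {..<Suc n}}" by (simp add: finite_permutations)
    show "{p. p permutes {..<n}} \<subseteq> {p. p permutes {..<Suc n}}"
      by (auto intro: permutes_subset)
    show "\<forall>p\<in>{p. p permutes {..<Suc n}} - {p. p permutes {..<n}}.
       of_int (sign p) * (\<Prod>i<Suc n. M i (p i)) = 0"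
    proof
      fix p assume "p \<in> {p. p permutes {..<Suc n}} - {p. p permutes {..<n}}"
      then have p: "p permutes {..<Suc n}" "\<not> p permutes {..<n}" by auto
      have "p n \<noteq> n"
      proof
        assume "p n = n"
        then have "p permutes {..<n}"
          using p(1) by (intro permutes_superset[OF p(1)]) (auto simp: less_Suc_eq)
        then show False using p by simp
      qed
      moreover have "p n < Suc n" using permutes_less[OF p(1)] by simp
      ultimately have "M n (p n) = 0" using assms by simp
      then show "of_int (sign p) * (\<Prod>i<Suc n. M i (p i)) = 0" by simp
    qed
  qed
  also have "\<dots> = (\<Sum>p | p permutes {..<n}. M n n * (of_int (sign p) * (\<Prod>i<n. M i (p i))))"
  proof (intro sum.cong refl)
    fix p assume "p \<in> {p. p permutes {..<n}}"
    then have "p n = n" by (auto simp: permutes_def)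
    then show "of_int (sign p) * (\<Prod>i<Suc n. M i (p i)) = M n n * (of_int (sign p) * (\<Prod>i<n. M i (p i)))"
      by simp
  qed
  finally show ?thesis by (simp add: ldet_def sum_distrib_left)
qed

section \<open>Jacobi--Trudi determinants and adding a box\<close>

definition hseq :: "(int \<Rightarrow> 'a::field_char_0) \<Rightarrow> bool" where
  "hseq h \<longleftrightarrow> h 0 = 1 \<and> (\<forall>k<0. h k = 0)"

lemma hseq_0: "hseq h \<Longrightarrow> h 0 = 1" and hseq_neg: "hseq h \<Longrightarrow> k < 0 \<Longrightarrow> h k = 0"
  by (auto simp: hseq_def)

definition sch :: "nat \<Rightarrow> (int \<Rightarrow> 'a::field_char_0) \<Rightarrow> (nat \<Rightarrow> nat) \<Rightarrow> 'a" where
  "sch L h f = ldet L (\<lambda>i j. h (int (f i) - int i + int j))"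

text \<open>\<open>m i\<close> stands for the row length minus i, and column j alone has its index
  lowered by r. The value r = -1 raises a column, which is what adding a box amounts to after rows
  are exchanged for columns.\<close>

definition col_shift :: "(int \<Rightarrow> 'a::field_char_0) \<Rightarrow> nat \<Rightarrow> (nat \<Rightarrow> int) \<Rightarrow> int \<Rightarrow> nat \<Rightarrow> 'a" where
  "col_shift h L m r j = ldet L (\<lambda>i k. h (m i + int k - (if k = j then r else 0)))"

lemma sch_pad:
  assumes "hseq h" "f L = 0"
  shows "sch (Suc L) h f = sch L h f"
  unfolding sch_def using assms by (subst ldet_last_row) (auto simp: hseq_0 hseq_neg)

text \<open>Thanks to this stability all diagrams with at most n boxes can be handled by
  determinants of one common size.\<close>

lemma sch_pad_le:
  assumes "hseq h" "\<And>i. L \<le> i \<Longrightarrow> f i = 0" "L \<le> L'"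
  shows "sch L' h f = sch L h f"
  using assms(3) by (induction L' rule: dec_induct) (auto simp: sch_pad assms)

text \<open>Both sides are the derivative of one determinant along the derivation that raises the
  index of every entry by 1, expanded by rows on the left and by columns on the right.\<close>

lemma sum_add_box:
  fixes m c :: "nat \<Rightarrow> int" and h :: "int \<Rightarrow> 'a::field_char_0"
  shows "(\<Sum>i<n. ldet n (\<lambda>i' k. h ((m(i := m i + 1)) i' + c k))) =
   (\<Sum>j<n. ldet n (\<lambda>i k. h (m i + c k + (if k = j then 1 else 0))))"
proof -
  let ?N = "\<lambda>i k. h (m i + 1 + c k)" and ?M = "\<lambda>i k. h (m i + c k)"
  have "(\<Sum>i<n. 1 * ldet n (?M(i := ?N i))) = line_sum n ?M (\<lambda>i j. 1 * ?N i j)"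
    by (rule line_sum_row[symmetric])
  also have "\<dots> = (\<Sum>j<n. 1 * ldet n (\<lambda>i k. if k = j then ?N i j else ?M i k))"
    by (rule line_sum_col)
  finally have "(\<Sum>i<n. ldet n (?M(i := ?N i))) = (\<Sum>j<n. ldet n (\<lambda>i k. if k = j then ?N i j else ?M i k))"
    by simp
  moreover have "(\<Sum>i<n. ldet n (\<lambda>i' k. h ((m(i := m i + 1)) i' + c k))) = (\<Sum>i<n. ldet n (?M(i := ?N i)))"
    by (intro sum.cong refl ldet_cong) auto
  moreover have "(\<Sum>j<n. ldet n (\<lambda>i k. h (m i + c k + (if k = j then 1 else 0)))) =
      (\<Sum>j<n. ldet n (\<lambda>i k. if k = j then ?N i j else ?M i k))"
    by (intro sum.cong refl ldet_cong) (auto simp: algebra_simps)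
  ultimately show ?thesis by simp
qed

text \<open>The last row is empty, so its only entry that can be non-zero stands in column l, and
  lowering that column makes its index negative.\<close>

lemma col_shift_zero:
  assumes "m l = - int l" "hseq h" "r \<ge> 1"
  shows "col_shift h (Suc l) m r l = 0"
proof -
  have "col_shift h (Suc l) m r l = 0 * ldet l (\<lambda>i k. h (m i + int k - (if k = l then r else 0)))"
    unfolding col_shift_def using assms by (subst ldet_last_row) (auto simp: hseq_neg)
  then show ?thesis by simp
qed

text \<open>After \<open>sum_add_box\<close> one column j' is raised while column j is lowered.
  Raising a column usually makes it equal to its right neighbour; only the neighbourhood of j and
  the last column escape.\<close>

lemma col_shift_add_box_col:
  assumes h: "hseq h" and ml: "m l = - int l" and j: "j \<le> l" and r: "r \<ge> 1"
  shows "(\<Sum>i<Suc l. col_shift h (Suc l) (m(i := m i + 1)) r j) =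
    col_shift h (Suc l) m (r - 1) j - (if 0 < j then col_shift h (Suc l) m (r - 1) (j - 1) else 0)
      + (if j < l then h 1 * col_shift h (Suc l) m r j else 0)"
proof -
  let ?c = "\<lambda>k. int k - (if k = j then r else 0)"
  let ?E = "\<lambda>j'. ldet (Suc l) (\<lambda>i k. h (m i + ?c k + (if k = j' then 1 else 0)))"
  have "(\<Sum>i<Suc l. col_shift h (Suc l) (m(i := m i + 1)) r j) = (\<Sum>j'<Suc l. ?E j')"
    using sum_add_box[where n="Suc l" and h=h and m=m and c="?c"] unfolding col_shift_def
    by (simp add: algebra_simps)
  also have "\<dots> = (\<Sum>j'<Suc l. (if j' = j then col_shift h (Suc l) m (r - 1) j else 0)
      - (if Suc j' = j then col_shift h (Suc l) m (r - 1) j' else 0)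
      + (if j' = l \<and> j < l then h 1 * col_shift h (Suc l) m r j else 0))"
  proof (rule sum.cong[OF refl])
    fix j' assume j': "j' \<in> {..<Suc l}"
    consider "j' = j" | "Suc j' = j" | "j' = l" "j < l" | "j' < l" "j' \<noteq> j" "Suc j' \<noteq> j"
      using j j' by fastforce
    then show "?E j' = (if j' = j then col_shift h (Suc l) m (r - 1) j else 0)
      - (if Suc j' = j then col_shift h (Suc l) m (r - 1) j' else 0)
      + (if j' = l \<and> j < l then h 1 * col_shift h (Suc l) m r j else 0)"
    proof cases
      case 1
      have "?E j = col_shift h (Suc l) m (r - 1) j" unfolding col_shift_def
        by (rule ldet_cong) (auto simp: algebra_simps)
      then show ?thesis using 1 by auto
    next
      case 2
      \<comment> \<open>Raised, column j - 1 looks like an unshifted column j, and column j looks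
        like column j - 1 lowered by r - 1. Interchanging them costs the sign.\<close>
      have "col_shift h (Suc l) m (r - 1) j' =
          ldet (Suc l) (\<lambda>i k. (\<lambda>i k. h (m i + ?c k + (if k = j' then 1 else 0))) i (Transposition.transpose j' j k))"
        unfolding col_shift_def by (rule ldet_cong) (use 2 in \<open>auto simp: Transposition.transpose_def algebra_simps\<close>)
      also have "\<dots> = - ?E j'"
        by (rule ldet_swap_cols) (use 2 j j' in auto)
      finally show ?thesis using 2 j by auto
    next
      case 3
      \<comment> \<open>Raising the last column leaves h 1 as the only entry of the last row;
        without raising, that entry is h 0 = 1.\<close>
      have "?E l = h 1 * ldet l (\<lambda>i k. h (m i + ?c k + (if k = l then 1 else 0)))"
        using h ml 3 r by (subst ldet_last_row) (auto simp: hseq_neg)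
      also have "ldet l (\<lambda>i k. h (m i + ?c k + (if k = l then 1 else 0))) =
          ldet l (\<lambda>i k. h (m i + int k - (if k = j then r else 0)))"
        by (rule ldet_cong) (auto simp: algebra_simps)
      also have "\<dots> = col_shift h (Suc l) m r j"
        unfolding col_shift_def using h ml 3 r by (subst ldet_last_row) (auto simp: hseq_neg hseq_0)
      finally show ?thesis using 3 by auto
    next
      case 4
      have "?E j' = 0"
        by (rule ldet_equal_cols[of j' _ "Suc j'"]) (use 4 j in \<open>auto simp: algebra_simps\<close>)
      then show ?thesis using 4 by auto
    qed
  qed
  also have "\<dots> = col_shift h (Suc l) m (r - 1) j - (\<Sum>j'<Suc l. if Suc j' = j then col_shift h (Suc l) m (r - 1) j' else 0)
      + (if j < l then h 1 * col_shift h (Suc l) m r j else 0)"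
    using j by (simp add: sum.distrib sum_subtractf)
  also have "(\<Sum>j'<Suc l. if Suc j' = j then col_shift h (Suc l) m (r - 1) j' else 0) =
      (\<Sum>j'<Suc l. if j' = j - 1 then (if 0 < j then col_shift h (Suc l) m (r - 1) (j - 1) else 0) else 0)"
    by (intro sum.cong) auto
  also have "\<dots> = (if 0 < j then col_shift h (Suc l) m (r - 1) (j - 1) else 0)"
    using j by (subst sum.delta) auto
  finally show ?thesis .
qed

text \<open>The interchanged columns carry the weight of j + 1 over to position j, so the weights
  enter through their differences. Constant weights leave only the boundary term at l.\<close>

lemma col_shift_add_box:
  assumes h: "hseq h" and ml: "m l = - int l" and r: "r \<ge> 1"
  shows "(\<Sum>i<Suc l. \<Sum>j<Suc l. w j * col_shift h (Suc l) (m(i := m i + 1)) r j) =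
    h 1 * (\<Sum>j<Suc l. w j * col_shift h (Suc l) m r j)
      + (\<Sum>j<l. (w j - w (Suc j)) * col_shift h (Suc l) m (r - 1) j) + w l * col_shift h (Suc l) m (r - 1) l"
proof -
  let ?C = "\<lambda>r j. col_shift h (Suc l) m r j"
  have "(\<Sum>i<Suc l. \<Sum>j<Suc l. w j * col_shift h (Suc l) (m(i := m i + 1)) r j) =
      (\<Sum>j<Suc l. w j * (\<Sum>i<Suc l. col_shift h (Suc l) (m(i := m i + 1)) r j))"
    by (subst sum.swap) (simp only: sum_distrib_left)
  also have "\<dots> = (\<Sum>j<Suc l. w j * (?C (r - 1) j - (if 0 < j then ?C (r - 1) (j - 1) else 0)
      + (if j < l then h 1 * ?C r j else 0)))"
    by (intro sum.cong refl arg_cong2[where f="(*)"] col_shift_add_box_col assms) auto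
  also have "\<dots> = (\<Sum>j<Suc l. w j * ?C (r - 1) j) - (\<Sum>j<Suc l. w j * (if 0 < j then ?C (r - 1) (j - 1) else 0))
      + (\<Sum>j<Suc l. w j * (if j < l then h 1 * ?C r j else 0))"
    by (simp only: sum.distrib[symmetric] sum_subtractf[symmetric] algebra_simps)
  also have "(\<Sum>j<Suc l. w j * (if 0 < j then ?C (r - 1) (j - 1) else 0)) = (\<Sum>j<l. w (Suc j) * ?C (r - 1) j)"
    by (subst sum.lessThan_Suc_shift) simp
  also have "(\<Sum>j<Suc l. w j * (if j < l then h 1 * ?C r j else 0)) = h 1 * (\<Sum>j<Suc l. w j * ?C r j)"
    using col_shift_zero[where m=m and l=l, OF ml h r] by (simp add: sum_distrib_left mult.left_commute)
  finally have E: "(\<Sum>i<Suc l. \<Sum>j<Suc l. w j * col_shift h (Suc l) (m(i := m i + 1)) r j) =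
      (\<Sum>j<Suc l. w j * ?C (r - 1) j) - (\<Sum>j<l. w (Suc j) * ?C (r - 1) j) + h 1 * (\<Sum>j<Suc l. w j * ?C r j)" .
  show ?thesis unfolding E by (simp add: sum_subtractf left_diff_distrib)
qed

lemma col_shift_shift_up:
  assumes h: "hseq h" and ml: "m l = - int l" and j: "j \<le> l"
  shows "col_shift h (Suc l) m (-1) j = (if j = l then h 1 * ldet (Suc l) (\<lambda>i k. h (m i + int k)) else 0)"
proof (cases "j = l")
  case True
  have "col_shift h (Suc l) m (-1) j = h 1 * ldet l (\<lambda>i k. h (m i + int k - (if k = l then -1 else 0)))"
    unfolding col_shift_def using h ml True by (subst ldet_last_row) (auto simp: hseq_neg)
  also have "ldet l (\<lambda>i k. h (m i + int k - (if k = l then -1 else 0))) = ldet l (\<lambda>i k. h (m i + int k))"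
    by (rule ldet_cong) auto
  also have "\<dots> = ldet (Suc l) (\<lambda>i k. h (m i + int k))"
    using h ml by (subst ldet_last_row) (auto simp: hseq_neg hseq_0)
  finally show ?thesis using True by simp
next
  case False
  have "col_shift h (Suc l) m (-1) j = 0" unfolding col_shift_def
    by (rule ldet_equal_cols[of j _ "Suc j"]) (use False j in \<open>auto simp: algebra_simps\<close>)
  then show ?thesis using False by simp
qed

text \<open>The sum runs over all rows, not only over those where a box may be added; elsewhere the
  raised row repeats the row above it. On the column side only raising the last column survives,
  which produces h 1.\<close>

lemma pieri:
  assumes h: "hseq h" and ml: "m l = - int l"
  shows "(\<Sum>i<Suc l. ldet (Suc l) (\<lambda>i' k. h ((m(i := m i + 1)) i' + int k))) =
    h 1 * ldet (Suc l) (\<lambda>i k. h (m i + int k))"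
proof -
  have "(\<Sum>i<Suc l. ldet (Suc l) (\<lambda>i' k. h ((m(i := m i + 1)) i' + int k))) =
      (\<Sum>j<Suc l. col_shift h (Suc l) m (-1) j)"
    unfolding sum_add_box col_shift_def by (intro sum.cong ldet_cong refl arg_cong[of _ _ h]) auto
  also have "\<dots> = (\<Sum>j<Suc l. if j = l then h 1 * ldet (Suc l) (\<lambda>i k. h (m i + int k)) else 0)"
    by (intro sum.cong refl col_shift_shift_up h ml) auto
  finally show ?thesis by simp
qed

section \<open>Newton's identities and the squared content of an added box\<close>

definition newton :: "(int \<Rightarrow> 'a::field_char_0) \<Rightarrow> (nat \<Rightarrow> 'a) \<Rightarrow> bool" where
  "newton h p \<longleftrightarrow> (\<forall>n::nat. of_nat n * h (int n) = (\<Sum>k=1..n. p k * h (int n - int k)))"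

text \<open>Surplus terms have a negative index and vanish, so one range 1..Z serves all entries of
  a determinant at once.\<close>

lemma newtonD:
  assumes "newton h p" "hseq h" "a \<le> int Z"
  shows "of_int a * h a = (\<Sum>k=1..Z. p k * h (a - int k))"
proof (cases "a < 0")
  case True
  then show ?thesis using assms(2) by (simp add: hseq_neg)
next
  case False
  then obtain n where a: "a = int n" by (metis nonneg_int_cases not_less)
  have "of_int a * h a = (\<Sum>k=1..n. p k * h (int n - int k))" using assms(1) a by (simp add: newton_def)
  also have "\<dots> = (\<Sum>k=1..Z. p k * h (int n - int k))"
    using assms a by (intro sum.mono_neutral_left) (auto simp: hseq_neg)
  finally show ?thesis using a by simp
qed

lemma newton_1: "newton h p \<Longrightarrow> hseq h \<Longrightarrow> p 1 = h 1"
  using newtonD[of h p 1 1] by (simp add: hseq_0)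

text \<open>The squared content of the new box is a factor attached to a row; it is converted into
  data attached to columns. An entry of the raised row has index a = m i + 1 + j, hence m i = a - (j
  + 1), and Newton's identities express a * h a and a^2 * h a through lower indices, that is through
  shifted columns. X and Y collect these shifts with weights 1 and j + 1.\<close>

lemma content_square_sum:
  fixes h :: "int \<Rightarrow> 'a::field_char_0"
  assumes h: "hseq h" and nw: "newton h p" and ml: "m l = - int l"
    and Z: "\<And>i. i \<le> l \<Longrightarrow> m i + 1 + int l \<le> int Z"
  defines "X \<equiv> \<lambda>r. \<Sum>j<Suc l. col_shift h (Suc l) m r j"
    and "Y \<equiv> \<lambda>r. \<Sum>j<Suc l. of_nat (Suc j) * col_shift h (Suc l) m r j"
  shows "(\<Sum>i<Suc l. (of_int (m i))\<^sup>2 * ldet (Suc l) (\<lambda>i' k. h ((m(i := m i + 1)) i' + int k))) =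
    (\<Sum>k=1..Z. \<Sum>q=1..Z. p k * p q * X (int k + int q - 1)) +
    (\<Sum>k=2..Z. of_nat k * p k * X (int k - 1)) - 2 * (\<Sum>k=2..Z. p k * Y (int k - 1))"
proof -
  let ?L = "Suc l"
  let ?M = "\<lambda>i k. h (m i + int k)"
  let ?th = "line_sum ?L ?M"
  define G where "G = (\<lambda>q i j. h (m i + 1 + int j - q))"
  let ?A = "ldet ?L ?M"
  have thG: "?th (\<lambda>i j. w j * G q i j) = (\<Sum>j<?L. w j * col_shift h ?L m (q - 1) j)" for w q
    unfolding line_sum_col col_shift_def G_def
    by (intro sum.cong refl arg_cong2[where f="(*)"] ldet_cong) (auto simp: algebra_simps)
  have thG1: "?th (G q) = X (q - 1)" for q
    using thG[of "\<lambda>_. 1" q] by (simp add: X_def)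
  have N: "of_int (m i) ^ 2 * h (m i + 1 + int j) =
      (\<Sum>k=1..Z. \<Sum>q=1..Z. (p k * p q) * G (int k + int q) i j) + (\<Sum>k=1..Z. (of_nat k * p k) * G (int k) i j)
      + (\<Sum>k=1..Z. (- 2 * p k) * (of_nat (Suc j) * G (int k) i j)) + (of_nat (Suc j))\<^sup>2 * G 0 i j"
    if ij: "i < ?L" "j < ?L" for i j
  proof -
    let ?a = "m i + 1 + int j"
    have aZ: "?a \<le> int Z" using Z[of i] ij by simp
    have 1: "of_int ?a * h ?a = (\<Sum>k=1..Z. p k * h (?a - int k))"
      by (rule newtonD[OF nw h aZ])
    \<comment> \<open>For the second use of Newton's identity the factor a is written as (a - k) +
      k, so that a - k matches the index already lowered.\<close>
    have "of_int ?a * (of_int ?a * h ?a) =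
        (\<Sum>k=1..Z. p k * (of_int (?a - int k) * h (?a - int k)) + (of_nat k * p k) * h (?a - int k))"
      unfolding 1 sum_distrib_left by (intro sum.cong refl) (simp add: algebra_simps)
    also have "\<dots> = (\<Sum>k=1..Z. p k * (\<Sum>q=1..Z. p q * h (?a - int k - int q)) + (of_nat k * p k) * h (?a - int k))"
      by (intro sum.cong refl arg_cong2[where f="(+)"] arg_cong2[where f="(*)"] newtonD[OF nw h]) (use aZ in auto)
    finally have 2: "of_int ?a * (of_int ?a * h ?a) = (\<Sum>k=1..Z. \<Sum>q=1..Z. (p k * p q) * G (int k + int q) i j)
        + (\<Sum>k=1..Z. (of_nat k * p k) * G (int k) i j)"
      by (simp add: sum.distrib sum_distrib_left G_def algebra_simps)
    have "of_int (m i) ^ 2 * h ?a = of_int ?a * (of_int ?a * h ?a) - 2 * of_nat (Suc j) * (of_int ?a * h ?a)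
        + (of_nat (Suc j))\<^sup>2 * h ?a"
      by (simp add: algebra_simps power2_eq_square)
    also have "2 * of_nat (Suc j) * (of_int ?a * h ?a) = - (\<Sum>k=1..Z. (- 2 * p k) * (of_nat (Suc j) * G (int k) i j))"
      unfolding 1 sum_distrib_left sum_negf[symmetric] by (intro sum.cong refl) (simp add: G_def algebra_simps)
    finally show ?thesis unfolding 2 by (simp add: G_def)
  qed
  have "(\<Sum>i<?L. (of_int (m i))\<^sup>2 * ldet ?L (\<lambda>i' k. h ((m(i := m i + 1)) i' + int k))) =
      ?th (\<lambda>i j. of_int (m i) ^ 2 * h (m i + 1 + int j))"
    unfolding line_sum_row by (intro sum.cong refl arg_cong2[where f="(*)"] ldet_cong) auto
  also have "\<dots> = ?th (\<lambda>i j. (\<Sum>k=1..Z. \<Sum>q=1..Z. (p k * p q) * G (int k + int q) i j) + (\<Sum>k=1..Z. (of_nat k * p k) * G (int k) i j)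
      + (\<Sum>k=1..Z. (- 2 * p k) * (of_nat (Suc j) * G (int k) i j)) + (of_nat (Suc j))\<^sup>2 * G 0 i j)"
    by (rule line_sum_cong) (rule N)
  also have "\<dots> = (\<Sum>k=1..Z. \<Sum>q=1..Z. (p k * p q) * X (int k + int q - 1))
      + (\<Sum>k=1..Z. (of_nat k * p k) * X (int k - 1)) + (\<Sum>k=1..Z. (- 2 * p k) * Y (int k - 1))
      + (\<Sum>j<?L. (of_nat (Suc j))\<^sup>2 * col_shift h ?L m (-1) j)"
    by (simp only: line_sum_add line_sum_sum line_sum_scale thG1 thG finite_atLeastAtMost Y_def X_def diff_0)
  also have "(\<Sum>j<?L. (of_nat (Suc j))\<^sup>2 * col_shift h ?L m (-1) j) = (of_nat ?L)\<^sup>2 * (p 1 * ?A)"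
  proof -
    have "(\<Sum>j<?L. (of_nat (Suc j))\<^sup>2 * col_shift h ?L m (-1) j) = (\<Sum>j<?L. if j = l then (of_nat ?L)\<^sup>2 * (h 1 * ?A) else 0)"
      by (intro sum.cong refl) (use col_shift_shift_up[where m=m and l=l, OF h ml] in auto)
    then show ?thesis using newton_1[OF nw h] by (simp del: of_nat_Suc)
  qed
  also have "(\<Sum>k=1..Z. (- 2 * p k) * Y (int k - 1)) = - 2 * p 1 * Y 0 - 2 * (\<Sum>k=2..Z. p k * Y (int k - 1))"
  proof -
    have "1 \<le> Z" using Z[of l] ml by simp
    then show ?thesis
      by (simp add: sum.atLeast_Suc_atMost numeral_2_eq_2 sum_distrib_left algebra_simps sum_negf)
  qed
  also have "(\<Sum>k=1..Z. (of_nat k * p k) * X (int k - 1)) = p 1 * X 0 + (\<Sum>k=2..Z. (of_nat k * p k) * X (int k - 1))"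
  proof -
    have "1 \<le> Z" using Z[of l] ml by simp
    then show ?thesis
      by (simp add: sum.atLeast_Suc_atMost numeral_2_eq_2)
  qed
  also have "X 0 = of_nat ?L * ?A" unfolding X_def col_shift_def by simp
  also have "Y 0 = (of_nat ?L * of_nat (Suc ?L) / 2) * ?A"
  proof -
    have "(\<Sum>j<n. of_nat (Suc j)) = (of_nat n * of_nat (Suc n) / 2 :: 'a)" for n
      by (induction n) (auto simp: field_simps)
    then show ?thesis unfolding Y_def col_shift_def by (simp add: sum_distrib_right[symmetric] del: of_nat_Suc sum.lessThan_Suc)
  qed
  finally have E: "(\<Sum>i<?L. (of_int (m i))\<^sup>2 * ldet ?L (\<lambda>i' k. h ((m(i := m i + 1)) i' + int k))) =
     (\<Sum>k=1..Z. \<Sum>q=1..Z. (p k * p q) * X (int k + int q - 1))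
     + (p 1 * (of_nat ?L * ?A) + (\<Sum>k=2..Z. (of_nat k * p k) * X (int k - 1)))
     + (- 2 * p 1 * ((of_nat ?L * of_nat (Suc ?L) / 2) * ?A) - 2 * (\<Sum>k=2..Z. p k * Y (int k - 1)))
     + (of_nat ?L)\<^sup>2 * (p 1 * ?A)" .
  \<comment> \<open>The terms with k = 1 cancel. With u = l + 1, X 0 and Y 0 are u and u (u + 1) / 2
    times the determinant, and among the raised columns only the last one counts, with weight
    u^2.\<close>
  have id: "p 1 * (u * ?A) + - 2 * p 1 * ((u * (u + 1) / 2) * ?A) + u\<^sup>2 * (p 1 * ?A) = 0" for u
    by (simp add: field_simps power2_eq_square)
  have cancel: "b1 + c1 + d = 0 \<Longrightarrow> a + (b1 + b2) + (c1 - c2) + d = a + b2 - c2" for a b1 b2 c1 c2 d :: 'a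
    by (simp add: algebra_simps add_eq_0_iff)
  show ?thesis unfolding E by (rule cancel) (use id[of "of_nat ?L"] in \<open>simp add: add.commute\<close>)
qed

section \<open>Standard tableaux\<close>

text \<open>Partitions are functions with a zero tail rather than lists, so that adding or removing
  a box is a function update even when the number of rows changes.\<close>

definition Par :: "nat \<Rightarrow> (nat \<Rightarrow> nat) set" where
  "Par n = {f. (\<forall>i. f (Suc i) \<le> f i) \<and> (\<forall>i\<ge>n. f i = 0) \<and> (\<Sum>i<n. f i) = n}"

definition fcells :: "(nat \<Rightarrow> nat) \<Rightarrow> (nat \<times> nat) set" where
  "fcells f = {(i, j). j < f i}"

definition fsyt :: "nat \<Rightarrow> (nat \<Rightarrow> nat) \<Rightarrow> ((nat \<times> nat) \<Rightarrow> nat) set" where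
  "fsyt n f = {T. T \<in> fcells f \<rightarrow>\<^sub>E {1..n} \<and> bij_betw T (fcells f) {1..n} \<and>
                 (\<forall>i j. (i, Suc j) \<in> fcells f \<longrightarrow> T (i, j) < T (i, Suc j)) \<and>
                 (\<forall>i j. (Suc i, j) \<in> fcells f \<longrightarrow> T (i, j) < T (Suc i, j))}"

definition fdim :: "nat \<Rightarrow> (nat \<Rightarrow> nat) \<Rightarrow> nat" where
  "fdim n f = card (fsyt n f)"

definition removable :: "(nat \<Rightarrow> nat) \<Rightarrow> nat set" where
  "removable f = {i. f (Suc i) < f i}"

definition addable :: "(nat \<Rightarrow> nat) \<Rightarrow> nat set" where
  "addable f = {i. i = 0 \<or> f i < f (i - 1)}"

lemma antimono_nat:
  assumes "\<And>i. f (Suc i) \<le> (f i :: nat)" "i \<le> j"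
  shows "f j \<le> f i"
  using assms(2) by (induction rule: dec_induct) (auto intro: order_trans assms(1))

text \<open>A partition of n has at most n rows, since rows 0 to i are all non-empty if row i is.
  Any bound L on the support therefore yields the bound built into \<open>Par\<close>.\<close>

lemma ParI:
  assumes "\<And>i. f (Suc i) \<le> f i" "\<And>i. i \<ge> L \<Longrightarrow> f i = 0" "(\<Sum>i<L. f i) = n"
  shows "f \<in> Par n"
proof -
  have z: "f i = 0" if "i \<ge> n" for i
  proof (rule ccontr)
    assume "f i \<noteq> 0"
    then have "1 \<le> f k" if "k \<le> i" for k using antimono_nat[of f k i] assms(1) that by (simp add: le_trans Suc_le_eq)
    then have "(\<Sum>k\<le>i. 1) \<le> (\<Sum>k\<le>i. f k)" by (intro sum_mono) auto
    also have "\<dots> \<le> (\<Sum>k<L. f k)"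
      using assms(2) \<open>f i \<noteq> 0\<close> by (intro sum_mono2) (auto, metis antimono_nat assms(1) le_zero_eq linorder_not_less)
    finally show False using assms(3) that by simp
  qed
  have "(\<Sum>i<n. f i) = (\<Sum>i<max n L. f i)" "(\<Sum>i<L. f i) = (\<Sum>i<max n L. f i)"
    using z assms(2) by (auto intro!: sum.mono_neutral_left) (metis leI neq0_conv)+
  then show ?thesis using assms z by (simp add: Par_def)
qed

lemma Par_mono: "f \<in> Par n \<Longrightarrow> f (Suc i) \<le> f i"
  and Par_zero: "f \<in> Par n \<Longrightarrow> n \<le> i \<Longrightarrow> f i = 0"
  by (auto simp: Par_def)

lemma Par_sum:
  assumes "f \<in> Par n" "n \<le> L"
  shows "(\<Sum>i<L. f i) = n"
proof -
  have "(\<Sum>i<n. f i) = (\<Sum>i<L. f i)" using assms by (intro sum.mono_neutral_left) (auto simp: Par_def)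
  then show ?thesis using assms by (simp add: Par_def)
qed

lemma Par_le: "f \<in> Par n \<Longrightarrow> f i \<le> n"
proof -
  assume f: "f \<in> Par n"
  have "f i \<le> (\<Sum>k<max n (Suc i). f k)" by (rule member_le_sum) auto
  then show ?thesis using Par_sum[OF f, of "max n (Suc i)"] by simp
qed

lemma finite_Par: "finite (Par n)"
proof (rule finite_subset)
  show "Par n \<subseteq> (\<lambda>g i. if i < n then g i else 0) ` PiE {..<n} (\<lambda>_. {..n})"
  proof
    fix f assume f: "f \<in> Par n"
    then have "f = (\<lambda>i. if i < n then restrict f {..<n} i else 0)"
      by (auto simp: fun_eq_iff Par_zero)
    moreover have "restrict f {..<n} \<in> PiE {..<n} (\<lambda>_. {..n})" using Par_le[OF f] by auto
    ultimately show "f \<in> (\<lambda>g i. if i < n then g i else 0) ` PiE {..<n} (\<lambda>_. {..n})" by blast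
  qed
  show "finite ((\<lambda>g i. if i < n then g i else (0::nat)) ` PiE {..<n} (\<lambda>_. {..n}))"
    by (intro finite_imageI finite_PiE) auto
qed

lemma Par_0: "Par 0 = {\<lambda>_. 0}"
  by (auto simp: Par_def fun_eq_iff)

lemma fdim_0: "fdim 0 (\<lambda>_. 0) = 1"
  by (simp add: fdim_def fsyt_def fcells_def bij_betw_def)

lemma Par_add_box:
  assumes f: "f \<in> Par n" and i: "i \<in> addable f"
  shows "f(i := Suc (f i)) \<in> Par (Suc n)" "i \<in> removable (f(i := Suc (f i)))" "i \<le> n"
proof -
  show i': "i \<le> n"
  proof (cases i)
    case (Suc k)
    then have "f k > 0" using i by (auto simp: addable_def)
    then have "k < n" using Par_zero[OF f, of k] by (cases "k < n") auto
    then show ?thesis using Suc by simp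
  qed simp
  show "f(i := Suc (f i)) \<in> Par (Suc n)"
  proof (rule ParI[of _ "Suc n"])
    fix k show "(f(i := Suc (f i))) (Suc k) \<le> (f(i := Suc (f i))) k"
      using Par_mono[OF f, of k] i by (auto simp: addable_def)
    show "(f(i := Suc (f i))) k = 0" if "Suc n \<le> k"
      using Par_zero[OF f, of k] that i' by auto
    have "(\<Sum>k<Suc n. (f(i := Suc (f i))) k) = (\<Sum>k<Suc n. f k) + 1"
      using i' by (simp add: sum.remove[of "{..<Suc n}" i] del: sum.lessThan_Suc)
    then show "(\<Sum>k<Suc n. (f(i := Suc (f i))) k) = Suc n" using Par_sum[OF f, of "Suc n"] by simp
  qed
  show "i \<in> removable (f(i := Suc (f i)))" using Par_mono[OF f, of i] by (simp add: removable_def)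
qed

lemma Par_remove_box:
  assumes f: "f \<in> Par (Suc n)" and i: "i \<in> removable f"
  shows "f(i := f i - 1) \<in> Par n" "i \<in> addable (f(i := f i - 1))" "i < Suc n"
proof -
  have fi: "f i > 0" using i by (auto simp: removable_def)
  then show i': "i < Suc n" using Par_zero[OF f, of i] by (cases "i < Suc n") auto
  show "f(i := f i - 1) \<in> Par n"
  proof (rule ParI[of _ "Suc n"])
    fix k show "(f(i := f i - 1)) (Suc k) \<le> (f(i := f i - 1)) k"
      using Par_mono[OF f, of k] i by (auto simp: removable_def)
    show "(f(i := f i - 1)) k = 0" if "Suc n \<le> k"
      using Par_zero[OF f, of k] that i' by auto
    have "(\<Sum>k<Suc n. (f(i := f i - 1)) k) + 1 = (\<Sum>k<Suc n. f k)"
      using i' fi by (simp add: sum.remove[of "{..<Suc n}" i] del: sum.lessThan_Suc)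
    then show "(\<Sum>k<Suc n. (f(i := f i - 1)) k) = n" using Par_sum[OF f, of "Suc n"] by simp
  qed
  show "i \<in> addable (f(i := f i - 1))"
    using Par_mono[OF f, of "i - 1"] fi by (cases i) (auto simp: addable_def)
qed

lemma finite_fcells: "f \<in> Par n \<Longrightarrow> finite (fcells f)"
proof (rule finite_subset)
  assume f: "f \<in> Par n"
  show "fcells f \<subseteq> {..<n} \<times> {..<n}"
    using Par_le[OF f] Par_zero[OF f] unfolding fcells_def
    by (auto simp: less_le_trans) (metis leI not_less_zero)
qed simp

lemma finite_fsyt: "f \<in> Par n \<Longrightarrow> finite (fsyt n f)"
  by (rule finite_subset[OF _ finite_PiE[of "fcells f" "\<lambda>_. {1..n}"]])
    (auto simp: fsyt_def finite_fcells)

text \<open>Nothing can stand to the right of or below the largest entry, so its cell is the end of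
  a row that is longer than the next one.\<close>

lemma fsyt_corner:
  assumes f: "f \<in> Par (Suc n)" and T: "T \<in> fsyt (Suc n) f"
  shows "\<exists>i\<in>removable f. T (i, f i - 1) = Suc n"
proof -
  have "Suc n \<in> T ` fcells f" using T by (auto simp: fsyt_def bij_betw_def)
  then obtain i j where ij: "j < f i" "T (i, j) = Suc n" by (auto simp: fcells_def)
  have le: "T (a, b) \<le> Suc n" if "b < f a" for a b
    using T that by (auto simp: fsyt_def fcells_def PiE_iff)
  have "\<not> Suc j < f i"
  proof
    assume "Suc j < f i"
    then have "T (i, j) < T (i, Suc j)" using T by (auto simp: fsyt_def fcells_def)
    then show False using le[of "Suc j" i] ij \<open>Suc j < f i\<close> by simp
  qed
  then have j: "j = f i - 1" using ij by simp
  have "\<not> j < f (Suc i)"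
  proof
    assume "j < f (Suc i)"
    then have "T (i, j) < T (Suc i, j)" using T by (auto simp: fsyt_def fcells_def)
    then show False using le[of j "Suc i"] ij \<open>j < f (Suc i)\<close> by simp
  qed
  then have "i \<in> removable f" using j ij by (auto simp: removable_def)
  then show ?thesis using j ij by auto
qed

lemma card_fsyt_corner:
  assumes f: "f \<in> Par (Suc n)" and i: "i \<in> removable f"
  shows "card {T \<in> fsyt (Suc n) f. T (i, f i - 1) = Suc n} = fdim n (f(i := f i - 1))"
proof -
  let ?g = "f(i := f i - 1)" and ?c = "(i, f i - 1)"
  have fi: "f i > 0" using i by (auto simp: removable_def)
  have cells: "fcells f = insert ?c (fcells ?g)" "?c \<notin> fcells ?g"
    using fi by (auto simp: fcells_def split: if_splits)
  have right: "(i, Suc (f i - 1)) \<notin> fcells f" and below: "(Suc i, f i - 1) \<notin> fcells f"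
    using fi i by (auto simp: fcells_def removable_def)
  have down: "(a, b) \<in> fcells ?g" if "(a, Suc b) \<in> fcells ?g" for a b
    using that by (auto simp: fcells_def split: if_splits)
  have down': "(a, b) \<in> fcells ?g" if "(Suc a, b) \<in> fcells ?g" for a b
    using that Par_mono[OF f, of a] i by (auto simp: fcells_def removable_def split: if_splits)
  have "bij_betw (\<lambda>T. restrict T (fcells ?g)) {T \<in> fsyt (Suc n) f. T ?c = Suc n} (fsyt n ?g)"
  proof (rule bij_betwI[where g="\<lambda>T. T(?c := Suc n)"])
    show "(\<lambda>T. restrict T (fcells ?g)) \<in> {T \<in> fsyt (Suc n) f. T ?c = Suc n} \<rightarrow> fsyt n ?g"
    proof
      fix T assume "T \<in> {T \<in> fsyt (Suc n) f. T ?c = Suc n}"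
      then have T: "T \<in> fsyt (Suc n) f" "T ?c = Suc n" by auto
      have bij: "bij_betw T (fcells f) {1..Suc n}" using T by (auto simp: fsyt_def)
      have "bij_betw T (fcells f - {?c}) ({1..Suc n} - {T ?c})"
        using bij cells by (intro bij_betw_DiffI) (auto simp: bij_betw_def)
      moreover have "fcells f - {?c} = fcells ?g" "{1..Suc n} - {T ?c} = {1..n}"
        using cells T(2) by auto
      ultimately have b: "bij_betw T (fcells ?g) {1..n}" by simp
      then have b': "bij_betw (restrict T (fcells ?g)) (fcells ?g) {1..n}"
        by (subst bij_betw_cong[of _ _ T]) auto
      have "restrict T (fcells ?g) \<in> fcells ?g \<rightarrow>\<^sub>E {1..n}"
        using b by (auto simp: bij_betw_def)
      moreover have "\<forall>a b. (a, Suc b) \<in> fcells ?g \<longrightarrow> restrict T (fcells ?g) (a, b) < restrict T (fcells ?g) (a, Suc b)"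
        using T(1) cells down by (auto simp: fsyt_def)
      moreover have "\<forall>a b. (Suc a, b) \<in> fcells ?g \<longrightarrow> restrict T (fcells ?g) (a, b) < restrict T (fcells ?g) (Suc a, b)"
        using T(1) cells down' by (auto simp: fsyt_def)
      ultimately show "restrict T (fcells ?g) \<in> fsyt n ?g" using b' by (auto simp: fsyt_def)
    qed
    show "(\<lambda>T. T(?c := Suc n)) \<in> fsyt n ?g \<rightarrow> {T \<in> fsyt (Suc n) f. T ?c = Suc n}"
    proof
      fix T assume T: "T \<in> fsyt n ?g"
      let ?T = "T(?c := Suc n)"
      have "bij_betw ?T (fcells ?g) {1..n}"
        using T cells(2) by (subst bij_betw_cong[of _ _ T]) (auto simp: fsyt_def)
      then have "bij_betw ?T (fcells ?g \<union> {?c}) ({1..n} \<union> {?T ?c})"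
        using cells(2) by (intro bij_betw_combine) (auto simp: bij_betw_def)
      moreover have "{1..n} \<union> {?T ?c} = {1..Suc n}" by auto
      ultimately have b: "bij_betw ?T (fcells f) {1..Suc n}" using cells by simp
      have le: "T x \<le> n" if "x \<in> fcells ?g" for x using T that by (auto simp: fsyt_def)
      have "?T \<in> fcells f \<rightarrow>\<^sub>E {1..Suc n}"
        using b T cells by (auto simp: bij_betw_def fsyt_def PiE_iff extensional_def)
      moreover have "?T (a, b) < ?T (a, Suc b)" if ab: "(a, Suc b) \<in> fcells f" for a b
      proof -
        have 1: "(a, b) \<noteq> ?c" using right ab by auto
        have "(a, b) \<in> fcells f" using ab by (auto simp: fcells_def)
        then have 2: "(a, b) \<in> fcells ?g" using 1 cells by auto
        show ?thesis
        proof (cases "(a, Suc b) = ?c")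
          case True then show ?thesis using 1 le[OF 2] by simp
        next
          case False
          then have "(a, Suc b) \<in> fcells ?g" using ab cells by auto
          then have "T (a, b) < T (a, Suc b)" using T by (auto simp: fsyt_def)
          then show ?thesis unfolding fun_upd_other[OF False] fun_upd_other[OF 1] .
        qed
      qed
      moreover have "?T (a, b) < ?T (Suc a, b)" if ab: "(Suc a, b) \<in> fcells f" for a b
      proof -
        have 1: "(a, b) \<noteq> ?c" using below ab by auto
        have "(a, b) \<in> fcells f" using ab Par_mono[OF f, of a] by (auto simp: fcells_def)
        then have 2: "(a, b) \<in> fcells ?g" using 1 cells by auto
        show ?thesis
        proof (cases "(Suc a, b) = ?c")
          case True then show ?thesis using 1 le[OF 2] by simp
        next
          case False
          then have "(Suc a, b) \<in> fcells ?g" using ab cells by auto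
          then have "T (a, b) < T (Suc a, b)" using T by (auto simp: fsyt_def)
          then show ?thesis unfolding fun_upd_other[OF False] fun_upd_other[OF 1] .
        qed
      qed
      ultimately show "?T \<in> {T \<in> fsyt (Suc n) f. T ?c = Suc n}" using b by (auto simp: fsyt_def)
    qed
    show "(restrict T (fcells ?g))(?c := Suc n) = T" if "T \<in> {T \<in> fsyt (Suc n) f. T ?c = Suc n}" for T
      using that cells by (auto simp: fun_eq_iff fsyt_def PiE_iff extensional_def)
    show "restrict (T(?c := Suc n)) (fcells ?g) = T" if "T \<in> fsyt n ?g" for T
      using that cells(2) by (auto simp: fun_eq_iff fsyt_def PiE_iff extensional_def)
  qed
  then show ?thesis unfolding fdim_def by (rule bij_betw_same_card)
qed

text \<open>The branching rule: standard tableaux are sorted by the corner that holds the largest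
  entry.\<close>

lemma fdim_Suc:
  assumes f: "f \<in> Par (Suc n)"
  shows "fdim (Suc n) f = (\<Sum>i\<in>removable f. fdim n (f(i := f i - 1)))"
proof -
  let ?S = "\<lambda>i. {T \<in> fsyt (Suc n) f. T (i, f i - 1) = Suc n}"
  have fin: "finite (removable f)"
    by (rule finite_subset[of _ "{..<Suc n}"]) (use Par_remove_box(3)[OF f] in auto)
  have "fsyt (Suc n) f = (\<Union>i\<in>removable f. ?S i)" using fsyt_corner[OF f] by blast
  also have "card \<dots> = (\<Sum>i\<in>removable f. card (?S i))"
  proof (rule card_UN_disjoint[OF fin])
    show "\<forall>i\<in>removable f. finite (?S i)" using finite_fsyt[OF f] by auto
    show "\<forall>i\<in>removable f. \<forall>k\<in>removable f. i \<noteq> k \<longrightarrow> ?S i \<inter> ?S k = {}"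
    proof (intro ballI impI equals0I)
      fix i k T assume ik: "i \<in> removable f" "k \<in> removable f" "i \<noteq> k" and T: "T \<in> ?S i \<inter> ?S k"
      have "inj_on T (fcells f)" using T by (auto simp: fsyt_def bij_betw_def)
      moreover have "(i, f i - 1) \<in> fcells f" "(k, f k - 1) \<in> fcells f"
        using ik by (auto simp: fcells_def removable_def)
      ultimately have "(i, f i - 1) = (k, f k - 1)" using T by (intro inj_onD[of T "fcells f"]) auto
      then show False using ik by simp
    qed
  qed
  also have "\<dots> = (\<Sum>i\<in>removable f. fdim n (f(i := f i - 1)))"
    by (intro sum.cong refl card_fsyt_corner f)
  finally show ?thesis by (simp add: fdim_def)
qed

text \<open>The branching rule read upwards. A partition of n + 1 with a removable corner and a
  partition of n with an addable one describe the same edge of Young's graph.\<close>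

lemma sum_Par_Suc:
  fixes G :: "(nat \<Rightarrow> nat) \<Rightarrow> 'a::field_char_0"
  shows "(\<Sum>g\<in>Par (Suc n). of_nat (fdim (Suc n) g) * G g) =
    (\<Sum>f\<in>Par n. \<Sum>i\<in>addable f. of_nat (fdim n f) * G (f(i := Suc (f i))))"
proof -
  have fr: "finite (removable g)" if "g \<in> Par (Suc n)" for g
    by (rule finite_subset[of _ "{..<Suc n}"]) (use Par_remove_box(3)[OF that] in auto)
  have fa: "finite (addable f)" if "f \<in> Par n" for f
    by (rule finite_subset[of _ "{..n}"]) (use Par_add_box(3)[OF that] in auto)
  have "(\<Sum>g\<in>Par (Suc n). of_nat (fdim (Suc n) g) * G g) =
      (\<Sum>g\<in>Par (Suc n). \<Sum>i\<in>removable g. of_nat (fdim n (g(i := g i - 1))) * G g)"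
    by (intro sum.cong refl) (simp add: fdim_Suc sum_distrib_right)
  also have "\<dots> = (\<Sum>(g, i)\<in>Sigma (Par (Suc n)) removable. of_nat (fdim n (g(i := g i - 1))) * G g)"
    by (rule sum.Sigma) (use finite_Par fr in auto)
  also have "\<dots> = (\<Sum>(f, i)\<in>Sigma (Par n) addable. of_nat (fdim n f) * G (f(i := Suc (f i))))"
    by (rule sum.reindex_bij_witness[where i="\<lambda>(f, i). (f(i := Suc (f i)), i)" and j="\<lambda>(g, i). (g(i := g i - 1), i)"])
      (use Par_remove_box Par_add_box in \<open>auto simp: removable_def\<close>)
  also have "\<dots> = (\<Sum>f\<in>Par n. \<Sum>i\<in>addable f. of_nat (fdim n f) * G (f(i := Suc (f i))))"
    by (rule sum.Sigma[symmetric]) (use finite_Par fa in auto)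
  finally show ?thesis .
qed

section \<open>Sums over partitions weighted by dimension\<close>

definition ycontent :: "(nat \<Rightarrow> nat) \<Rightarrow> nat \<Rightarrow> int" where
  "ycontent f i = int (f i) - int i"

lemma sch_content: "sch L h f = ldet L (\<lambda>i k. h (ycontent f i + int k))"
  by (simp add: sch_def ycontent_def)

lemma content_add_box: "ycontent (f(i := Suc (f i))) = (ycontent f)(i := ycontent f i + 1)"
  by (auto simp: ycontent_def fun_eq_iff)

lemma content_last: "f \<in> Par n \<Longrightarrow> n \<le> l \<Longrightarrow> ycontent f l = - int l"
  by (simp add: ycontent_def Par_zero)

definition dim_sum :: "nat \<Rightarrow> ((nat \<Rightarrow> nat) \<Rightarrow> 'a::field_char_0) \<Rightarrow> 'a" where
  "dim_sum n G = (\<Sum>f\<in>Par n. of_nat (fdim n f) * G f)"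

lemma dim_sum_cong: "(\<And>f. f \<in> Par n \<Longrightarrow> G f = G' f) \<Longrightarrow> dim_sum n G = dim_sum n G'"
  unfolding dim_sum_def by (intro sum.cong) auto

lemma dim_sum_add: "dim_sum n (\<lambda>f. G f + G' f) = dim_sum n G + dim_sum n G'"
  by (simp add: dim_sum_def sum.distrib distrib_left)

lemma dim_sum_diff: "dim_sum n (\<lambda>f. G f - G' f) = dim_sum n G - dim_sum n G'"
  by (simp add: dim_sum_def sum_subtractf right_diff_distrib)

lemma dim_sum_scale: "dim_sum n (\<lambda>f. c * G f) = c * dim_sum n G"
  by (simp add: dim_sum_def sum_distrib_left mult.left_commute)

lemma dim_sum_sum: "dim_sum n (\<lambda>f. \<Sum>k\<in>A. G k f) = (\<Sum>k\<in>A. dim_sum n (G k))"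
  unfolding dim_sum_def by (subst sum.swap) (simp add: sum_distrib_left)

lemma dim_sum_0: "dim_sum 0 G = G (\<lambda>_. 0)"
  by (simp add: dim_sum_def Par_0 fdim_0)

text \<open>The inner sum may run over all rows: if row i is not addable, it is as long as row i -
  1, and after raising it the determinant has two equal rows. The shift c of the columns is
  arbitrary because the same step is applied to Schur values and to shifted columns.\<close>

lemma dim_sum_Suc:
  assumes "n \<le> l"
  shows "dim_sum (Suc n) (\<lambda>f. K f * ldet (Suc l) (\<lambda>i k. h (ycontent f i + c k))) =
    dim_sum n (\<lambda>f. \<Sum>i<Suc l. K (f(i := Suc (f i))) *
        ldet (Suc l) (\<lambda>i' k. h (((ycontent f)(i := ycontent f i + 1)) i' + c k)))"
  unfolding dim_sum_def sum_Par_Suc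
proof (rule sum.cong[OF refl])
  fix f assume f: "f \<in> Par n"
  have "(\<Sum>i\<in>addable f. of_nat (fdim n f) * (K (f(i := Suc (f i))) * ldet (Suc l) (\<lambda>i' k. h (ycontent (f(i := Suc (f i))) i' + c k))))
     = (\<Sum>i<Suc l. of_nat (fdim n f) * (K (f(i := Suc (f i))) * ldet (Suc l) (\<lambda>i' k. h (ycontent (f(i := Suc (f i))) i' + c k))))"
  proof (rule sum.mono_neutral_left)
    show "addable f \<subseteq> {..<Suc l}" using Par_add_box(3)[OF f] assms by fastforce
    show "\<forall>i\<in>{..<Suc l} - addable f. of_nat (fdim n f) *
        (K (f(i := Suc (f i))) * ldet (Suc l) (\<lambda>i' k. h (ycontent (f(i := Suc (f i))) i' + c k))) = 0"
    proof
      fix i assume i: "i \<in> {..<Suc l} - addable f"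
      then have "f (i - 1) = f i" "0 < i" using Par_mono[OF f, of "i - 1"] by (auto simp: addable_def)
      then have "ldet (Suc l) (\<lambda>i' k. h (ycontent (f(i := Suc (f i))) i' + c k)) = 0"
        using i by (intro ldet_equal_rows[of "i - 1" _ i]) (auto simp: ycontent_def of_nat_diff algebra_simps intro!: arg_cong[of _ _ h])
      then show "of_nat (fdim n f) *
        (K (f(i := Suc (f i))) * ldet (Suc l) (\<lambda>i' k. h (ycontent (f(i := Suc (f i))) i' + c k))) = 0" by simp
    qed
  qed simp
  then show "(\<Sum>i\<in>addable f. of_nat (fdim n f) * (K (f(i := Suc (f i))) * ldet (Suc l) (\<lambda>i' k. h (ycontent (f(i := Suc (f i))) i' + c k))))
     = of_nat (fdim n f) * (\<Sum>i<Suc l. K (f(i := Suc (f i))) *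
        ldet (Suc l) (\<lambda>i' k. h (((ycontent f)(i := ycontent f i + 1)) i' + c k)))"
    by (simp add: content_add_box sum_distrib_left del: sum.lessThan_Suc)
qed

lemma sch_zero: "hseq h \<Longrightarrow> sch L h (\<lambda>_. 0) = 1"
  by (subst sch_pad_le[of h 0]) (auto simp: sch_def ldet_def)

text \<open>The expansion of the n-th power of p 1 into Schur functions, by induction from
  \<open>pieri\<close>. It gives the total mass and, with the letters multiplied by variables, the
  joint generating function of the letter counts.\<close>

lemma dim_sum_sch:
  assumes h: "hseq h" and n: "n \<le> l"
  shows "dim_sum n (sch (Suc l) h) = h 1 ^ n"
  using n
proof (induction n)
  case 0
  then show ?case by (simp add: dim_sum_0 sch_zero[OF h])
next
  case (Suc n)
  have "dim_sum (Suc n) (sch (Suc l) h) = dim_sum (Suc n) (\<lambda>f. 1 * ldet (Suc l) (\<lambda>i k. h (ycontent f i + int k)))"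
    by (intro dim_sum_cong) (simp add: sch_content)
  also have "\<dots> = dim_sum n (\<lambda>f. h 1 * sch (Suc l) h f)"
    using Suc.prems by (subst dim_sum_Suc) (auto intro!: dim_sum_cong pieri h simp: content_last sch_content simp del: sum.lessThan_Suc fun_upd_apply)
  also have "\<dots> = h 1 * h 1 ^ n" using Suc by (simp add: dim_sum_scale)
  finally show ?case by simp
qed

section \<open>Weighted sums of column shifts and the mean of the squared contents\<close>

definition shift_sum :: "(int \<Rightarrow> 'a::field_char_0) \<Rightarrow> nat \<Rightarrow> (nat \<Rightarrow> 'a) \<Rightarrow> int \<Rightarrow> (nat \<Rightarrow> nat) \<Rightarrow> 'a" where
  "shift_sum h l w r f = (\<Sum>j<Suc l. w j * col_shift h (Suc l) (ycontent f) r j)"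

text \<open>For the empty diagram a column j lowered by r coincides with column j - r if r is at
  most j, and otherwise has only negative indices.\<close>

lemma shift_sum_zero:
  assumes h: "hseq h" and r: "r \<ge> (1::nat)"
  shows "shift_sum h l w (int r) (\<lambda>_. 0) = 0"
  unfolding shift_sum_def
proof (intro sum.neutral ballI)
  fix j assume j: "j \<in> {..<Suc l}"
  let ?M = "\<lambda>i k. h (ycontent (\<lambda>_. 0) i + int k - (if k = j then int r else 0))"
  show "w j * col_shift h (Suc l) (ycontent (\<lambda>_. 0)) (int r) j = 0"
  proof (cases "r \<le> j")
    case True
    have "ldet (Suc l) ?M = 0"
      by (rule ldet_equal_cols[of j _ "j - r"]) (use True j r in \<open>auto simp: of_nat_diff add_diff_eq\<close>)
    then show ?thesis by (simp add: col_shift_def)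
  next
    case False
    have "ldet (Suc l) ?M = 0"
    proof -
      have "ldet (Suc l) ?M = ldet (Suc l) (\<lambda>i k. (if k = j then 0 else ?M i k))"
        by (rule ldet_cong) (use False h in \<open>auto simp: ycontent_def hseq_neg\<close>)
      also have "\<dots> = 0" unfolding ldet_def
      proof (intro sum.neutral ballI)
        fix p assume "p \<in> {p. p permutes {..<Suc l}}"
        then have "p (inv p j) = j" "inv p j < Suc l"
          using j permutes_less[OF permutes_inv[of p "{..<Suc l}"]] by (auto simp: permutes_inverses)
        then have "(\<Prod>i<Suc l. if p i = j then 0 else ?M i (p i)) = 0"
          by (intro prod_zero) (auto intro!: bexI[of _ "inv p j"])
        then show "of_int (sign p) * (\<Prod>i<Suc l. if p i = j then 0 else ?M i (p i)) = 0" by simp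
      qed
      finally show ?thesis .
    qed
    then show ?thesis by (simp add: col_shift_def)
  qed
qed

lemma dim_sum_shift_sum_Suc:
  assumes h: "hseq h" and n: "n \<le> l" and r: "r \<ge> (1::nat)"
  shows "dim_sum (Suc n) (shift_sum h l w (int r)) = h 1 * dim_sum n (shift_sum h l w (int r)) +
    dim_sum n (\<lambda>f. (\<Sum>j<l. (w j - w (Suc j)) * col_shift h (Suc l) (ycontent f) (int r - 1) j)
       + w l * col_shift h (Suc l) (ycontent f) (int r - 1) l)"
proof -
  have e: "dim_sum (Suc n) (\<lambda>f. w j * col_shift h (Suc l) (ycontent f) (int r) j) =
      dim_sum n (\<lambda>f. \<Sum>i<Suc l. w j * col_shift h (Suc l) ((ycontent f)(i := ycontent f i + 1)) (int r) j)" for j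
    using dim_sum_Suc[OF n, of "\<lambda>_. w j" h "\<lambda>k. int k - (if k = j then int r else 0)"]
    by (simp add: col_shift_def algebra_simps del: sum.lessThan_Suc fun_upd_apply)
  have "dim_sum (Suc n) (shift_sum h l w (int r)) =
      dim_sum n (\<lambda>f. \<Sum>j<Suc l. \<Sum>i<Suc l. w j * col_shift h (Suc l) ((ycontent f)(i := ycontent f i + 1)) (int r) j)"
    unfolding shift_sum_def dim_sum_sum e by (rule refl)
  also have "\<dots> = dim_sum n (\<lambda>f. h 1 * shift_sum h l w (int r) f + ((\<Sum>j<l. (w j - w (Suc j)) * col_shift h (Suc l) (ycontent f) (int r - 1) j)
       + w l * col_shift h (Suc l) (ycontent f) (int r - 1) l))"
  proof (rule dim_sum_cong, subst sum.swap, goal_cases)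
    case (1 f)
    then show ?case using col_shift_add_box[where m="ycontent f" and l=l, OF h content_last[OF 1 n], of "int r" w] r
      by (simp add: shift_sum_def add.assoc del: sum.lessThan_Suc fun_upd_apply)
  qed
  finally show ?thesis by (simp add: dim_sum_add dim_sum_scale)
qed

text \<open>Summing column shifts by \<open>r\<close> skews the Schur function by the power sum \<open>p r\<close>; with weights
  \<open>Suc j\<close> it skews by \<open>\<Sum>j. (- 1) ^ j * (j + 1) * s (r - j, 1 ^ j)\<close>. Against the weights \<open>fdim\<close>, i.e. applied
  to \<open>(p 1) ^ n\<close>, only \<open>r = 1\<close>, respectively \<open>r \<le> 2\<close>, survives.\<close>

lemma dim_sum_X:
  assumes h: "hseq h" "h 1 = 1" and n: "n \<le> l" and r: "r \<ge> 1"
  shows "dim_sum n (shift_sum h l (\<lambda>_. 1) (int r)) = (if r = 1 then of_nat n else 0)"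
  using n
proof (induction n)
  case 0
  then show ?case using shift_sum_zero[OF h(1) r] by (simp add: dim_sum_0)
next
  case (Suc n)
  have "dim_sum n (\<lambda>f. col_shift h (Suc l) (ycontent f) (int r - 1) l) = (if r = 1 then 1 else 0)"
  proof (cases "r = 1")
    case True
    then show ?thesis using dim_sum_sch[OF h(1), of n l] Suc.prems h(2)
      by (simp add: col_shift_def sch_content[abs_def])
  next
    case False
    have "dim_sum n (\<lambda>f. col_shift h (Suc l) (ycontent f) (int r - 1) l) = dim_sum n (\<lambda>_. 0)"
      using False r Suc.prems h
      by (intro dim_sum_cong col_shift_zero[where m="ycontent f" and l=l for f, OF content_last[where n=n]]) auto
    then show ?thesis using False by (simp add: dim_sum_def)
  qed
  then show ?case using Suc dim_sum_shift_sum_Suc[OF h(1) _ r, of n l "\<lambda>_. 1"] h(2) by simp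
qed

lemma dim_sum_Y:
  assumes h: "hseq h" "h 1 = 1" and n: "n \<le> l" and r: "r \<ge> 1"
  shows "dim_sum n (shift_sum h l (\<lambda>j. of_nat (Suc j)) (int r)) =
    (if r = 1 then of_nat n else if r = 2 then - (of_nat n * (of_nat n - 1) / 2) else 0)"
  using n
proof (induction n)
  case 0
  then show ?case using shift_sum_zero[OF h(1) r] by (simp add: dim_sum_0)
next
  case (Suc n)
  let ?w = "\<lambda>j. of_nat (Suc j) :: 'a"
  have "dim_sum n (\<lambda>f. (\<Sum>j<l. (?w j - ?w (Suc j)) * col_shift h (Suc l) (ycontent f) (int r - 1) j)
       + ?w l * col_shift h (Suc l) (ycontent f) (int r - 1) l) =
       (if r = 1 then 1 else if r = 2 then - of_nat n else 0)"
  proof (cases "r = 1")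
    case True
    have "(\<Sum>j<l. (?w j - ?w (Suc j)) * col_shift h (Suc l) (ycontent f) (int r - 1) j)
       + ?w l * col_shift h (Suc l) (ycontent f) (int r - 1) l = sch (Suc l) h f" for f
      using True by (simp add: col_shift_def sch_content algebra_simps)
    then show ?thesis using True dim_sum_sch[OF h(1), of n l] Suc.prems h(2) by simp
  next
    case False
    \<comment> \<open>Consecutive weights differ by 1, so summation by parts leaves minus the
      unweighted sum for the shift r - 1; the boundary term at l vanishes because r - 1 is still
      positive.\<close>
    have "dim_sum n (\<lambda>f. (\<Sum>j<l. (?w j - ?w (Suc j)) * col_shift h (Suc l) (ycontent f) (int r - 1) j)
       + ?w l * col_shift h (Suc l) (ycontent f) (int r - 1) l) = dim_sum n (\<lambda>f. - 1 * shift_sum h l (\<lambda>_. 1) (int (r - 1)) f)"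
    proof (rule dim_sum_cong)
      fix f assume f: "f \<in> Par n"
      have "col_shift h (Suc l) (ycontent f) (int r - 1) l = 0"
        using False r Suc.prems h by (intro col_shift_zero[where m="ycontent f" and l=l, OF content_last[OF f]]) auto
      then show "(\<Sum>j<l. (?w j - ?w (Suc j)) * col_shift h (Suc l) (ycontent f) (int r - 1) j)
       + ?w l * col_shift h (Suc l) (ycontent f) (int r - 1) l = - 1 * shift_sum h l (\<lambda>_. 1) (int (r - 1)) f"
        using r by (simp add: shift_sum_def of_nat_diff sum_negf)
    qed
    then show ?thesis using False r dim_sum_X[OF h, of n l "r - 1"] Suc.prems unfolding dim_sum_scale by auto
  qed
  then show ?case using Suc dim_sum_shift_sum_Suc[OF h(1) _ r, of n l ?w] h(2) by (simp add: field_simps)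
qed

definition ycontent_sq :: "nat \<Rightarrow> (nat \<Rightarrow> nat) \<Rightarrow> int" where
  "ycontent_sq L f = (\<Sum>i<L. \<Sum>j<f i. (int j - int i)\<^sup>2)"

lemma ycontent_sq_add_box:
  "i < L \<Longrightarrow> ycontent_sq L (f(i := Suc (f i))) = ycontent_sq L f + (ycontent f i)\<^sup>2"
  by (simp add: ycontent_sq_def ycontent_def sum.remove[of "{..<L}" i])

text \<open>Passing from n to n + 1 increases the mean by n + n (n - 1) * \<open>p 3\<close>, and
  these increments add up to the closed form. \<open>pieri\<close> accounts for the old boxes,
  \<open>content_square_sum\<close> for the new one.\<close>

lemma dim_sum_ycontent_sq:
  fixes h :: "int \<Rightarrow> 'a::field_char_0"
  assumes h: "hseq h" "h 1 = 1" and nw: "newton h p" and n: "n \<le> l"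
  shows "dim_sum n (\<lambda>f. of_int (ycontent_sq (Suc l) f) * sch (Suc l) h f) =
    of_nat n * (of_nat n - 1) / 2 + of_nat n * (of_nat n - 1) * (of_nat n - 2) / 3 * p 3"
  using n
proof (induction n)
  case 0
  then show ?case by (simp add: dim_sum_0 ycontent_sq_def)
next
  case (Suc n)
  have nl: "n \<le> l" using Suc.prems by simp
  \<comment> \<open>Z has to dominate n + 1 + l, the largest index of an entry, and the ranges must
    contain k = 2 and k = 3.\<close>
  define Z where "Z = Suc n + l + 3"
  have p1: "p 1 = 1" using newton_1[OF nw h(1)] h(2) by simp
  let ?X = "shift_sum h l (\<lambda>_. 1)" and ?Y = "shift_sum h l (\<lambda>j. of_nat (Suc j))"
  have X: "dim_sum n (?X r) = (if r = 1 then of_nat n else 0)" if "r \<ge> 1" for r :: int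
    using dim_sum_X[OF h nl, of "nat r"] that by (auto split: if_splits)
  have Y: "dim_sum n (?Y r) = (if r = 1 then of_nat n else if r = 2 then - (of_nat n * (of_nat n - 1) / 2) else 0)"
    if "r \<ge> 1" for r :: int
    using dim_sum_Y[OF h nl, of "nat r"] that by (auto split: if_splits)
  have T: "(\<Sum>i<Suc l. (of_int (ycontent f i))\<^sup>2 * ldet (Suc l) (\<lambda>i' k. h (((ycontent f)(i := ycontent f i + 1)) i' + int k))) =
      (\<Sum>k=1..Z. \<Sum>q=1..Z. p k * p q * ?X (int k + int q - 1) f) +
    (\<Sum>k=2..Z. of_nat k * p k * ?X (int k - 1) f) - 2 * (\<Sum>k=2..Z. p k * ?Y (int k - 1) f)" if f: "f \<in> Par n" for f
  proof -
    have Zb: "ycontent f i + 1 + int l \<le> int Z" for i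
      using Par_le[OF f, of i] by (simp add: ycontent_def Z_def)
    show ?thesis unfolding shift_sum_def
      using content_square_sum[where m="ycontent f" and l=l, OF h(1) nw content_last[OF f nl] Zb] by simp
  qed
  have "dim_sum (Suc n) (\<lambda>f. of_int (ycontent_sq (Suc l) f) * sch (Suc l) h f) =
      dim_sum n (\<lambda>f. \<Sum>i<Suc l. of_int (ycontent_sq (Suc l) (f(i := Suc (f i)))) *
        ldet (Suc l) (\<lambda>i' k. h (((ycontent f)(i := ycontent f i + 1)) i' + int k)))"
    unfolding sch_content by (rule dim_sum_Suc[OF nl])
  also have "\<dots> = dim_sum n (\<lambda>f. of_int (ycontent_sq (Suc l) f) * sch (Suc l) h f +
     (\<Sum>i<Suc l. (of_int (ycontent f i))\<^sup>2 * ldet (Suc l) (\<lambda>i' k. h (((ycontent f)(i := ycontent f i + 1)) i' + int k))))"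
  proof (rule dim_sum_cong)
    fix f assume f: "f \<in> Par n"
    have "(\<Sum>i<Suc l. of_int (ycontent_sq (Suc l) (f(i := Suc (f i)))) *
        ldet (Suc l) (\<lambda>i' k. h (((ycontent f)(i := ycontent f i + 1)) i' + int k))) =
      of_int (ycontent_sq (Suc l) f) * (\<Sum>i<Suc l. ldet (Suc l) (\<lambda>i' k. h (((ycontent f)(i := ycontent f i + 1)) i' + int k))) +
      (\<Sum>i<Suc l. (of_int (ycontent f i))\<^sup>2 * ldet (Suc l) (\<lambda>i' k. h (((ycontent f)(i := ycontent f i + 1)) i' + int k)))"
      unfolding sum_distrib_left sum.distrib[symmetric]
      by (intro sum.cong refl) (simp add: ycontent_sq_add_box distrib_right)
    also have "(\<Sum>i<Suc l. ldet (Suc l) (\<lambda>i' k. h (((ycontent f)(i := ycontent f i + 1)) i' + int k))) = sch (Suc l) h f"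
      using pieri[where m="ycontent f" and l=l, OF h(1) content_last[OF f nl]] h(2) by (simp add: sch_content)
    finally show "(\<Sum>i<Suc l. of_int (ycontent_sq (Suc l) (f(i := Suc (f i)))) *
        ldet (Suc l) (\<lambda>i' k. h (((ycontent f)(i := ycontent f i + 1)) i' + int k))) =
      of_int (ycontent_sq (Suc l) f) * sch (Suc l) h f +
      (\<Sum>i<Suc l. (of_int (ycontent f i))\<^sup>2 * ldet (Suc l) (\<lambda>i' k. h (((ycontent f)(i := ycontent f i + 1)) i' + int k)))" .
  qed
  also have "\<dots> = dim_sum n (\<lambda>f. of_int (ycontent_sq (Suc l) f) * sch (Suc l) h f +
      ((\<Sum>k=1..Z. \<Sum>q=1..Z. p k * p q * ?X (int k + int q - 1) f) +
    (\<Sum>k=2..Z. of_nat k * p k * ?X (int k - 1) f) - 2 * (\<Sum>k=2..Z. p k * ?Y (int k - 1) f)))"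
    by (rule dim_sum_cong) (simp only: T)
  also have "\<dots> = dim_sum n (\<lambda>f. of_int (ycontent_sq (Suc l) f) * sch (Suc l) h f) +
      ((\<Sum>k=1..Z. \<Sum>q=1..Z. p k * p q * dim_sum n (?X (int k + int q - 1))) +
    (\<Sum>k=2..Z. of_nat k * p k * dim_sum n (?X (int k - 1))) - 2 * (\<Sum>k=2..Z. p k * dim_sum n (?Y (int k - 1))))"
    by (simp only: dim_sum_add dim_sum_diff dim_sum_scale dim_sum_sum)
  \<comment> \<open>In the double sum only k = q = 1 gives shift 1. The contributions of
    \<open>p 2\<close> to the X and the Y sum cancel, and the value of Y at shift 2 brings in
    \<open>p 3\<close>.\<close>
  also have "(\<Sum>k=1..Z. \<Sum>q=1..Z. p k * p q * dim_sum n (?X (int k + int q - 1))) =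
      (\<Sum>k=1..Z. \<Sum>q=1..Z. if k = 1 then if q = 1 then of_nat n else 0 else 0)"
    by (intro sum.cong refl) (use p1 in \<open>auto simp: X\<close>)
  also have "\<dots> = (\<Sum>k=1..Z. if k = 1 then (\<Sum>q=1..Z. if q = 1 then of_nat n else 0) else 0)"
    by (intro sum.cong refl) auto
  also have "\<dots> = of_nat n" by (simp add: Z_def)
  also have "(\<Sum>k=2..Z. of_nat k * p k * dim_sum n (?X (int k - 1))) = (\<Sum>k=2..Z. if k = 2 then 2 * p 2 * of_nat n else 0)"
    by (intro sum.cong refl) (auto simp: X)
  also have "\<dots> = 2 * p 2 * of_nat n" by (simp add: Z_def)
  also have "(\<Sum>k=2..Z. p k * dim_sum n (?Y (int k - 1))) =
     (\<Sum>k=2..Z. (if k = 2 then p 2 * of_nat n else 0) + (if k = 3 then - p 3 * (of_nat n * (of_nat n - 1) / 2) else 0))"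
    by (intro sum.cong refl) (auto simp: Y simp del: of_nat_Suc)
  also have "\<dots> = p 2 * of_nat n - p 3 * (of_nat n * (of_nat n - 1) / 2)" by (simp add: Z_def sum.distrib)
  finally have E: "dim_sum (Suc n) (\<lambda>f. of_int (ycontent_sq (Suc l) f) * sch (Suc l) h f) =
      dim_sum n (\<lambda>f. of_int (ycontent_sq (Suc l) f) * sch (Suc l) h f) +
      (of_nat n + 2 * p 2 * of_nat n - 2 * (p 2 * of_nat n - p 3 * (of_nat n * (of_nat n - 1) / 2)))" .
  show ?case unfolding E Suc.IH[OF nl] by (simp add: field_simps)
qed

section \<open>Adding a letter to a specialisation\<close>

text \<open>The coefficients of the generating function divided by 1 - x z; \<open>addcol\<close>
  multiplies it by 1 + x z instead. The cut-off at \<open>nat k\<close> drops only terms with a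
  negative index.\<close>

definition addrow :: "'a::field_char_0 \<Rightarrow> (int \<Rightarrow> 'a) \<Rightarrow> int \<Rightarrow> 'a" where
  "addrow x h k = (\<Sum>r\<le>nat k. x ^ r * h (k - int r))"

definition addcol :: "'a::field_char_0 \<Rightarrow> (int \<Rightarrow> 'a) \<Rightarrow> int \<Rightarrow> 'a" where
  "addcol x h k = h k + x * h (k - 1)"

text \<open>The shapes left after removing a horizontal strip from f, in the form of interlacing
  inequalities; \<open>vstrip\<close> is the analogue for vertical strips.\<close>

definition hstrip :: "(nat \<Rightarrow> nat) \<Rightarrow> (nat \<Rightarrow> nat) set" where
  "hstrip f = {g. \<forall>i. f (Suc i) \<le> g i \<and> g i \<le> f i}"

definition vstrip :: "(nat \<Rightarrow> nat) \<Rightarrow> (nat \<Rightarrow> nat) set" where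
  "vstrip f = {g. (\<forall>i. g (Suc i) \<le> g i) \<and> (\<forall>i. g i \<le> f i \<and> f i \<le> Suc (g i))}"

definition strip :: "bool \<Rightarrow> (nat \<Rightarrow> nat) \<Rightarrow> (nat \<Rightarrow> nat) set" where
  "strip k f = (if k then hstrip f else vstrip f)"

definition addletter :: "bool \<Rightarrow> 'a::field_char_0 \<Rightarrow> (int \<Rightarrow> 'a) \<Rightarrow> int \<Rightarrow> 'a" where
  "addletter k x h = (if k then addrow x h else addcol x h)"

definition psize :: "(nat \<Rightarrow> nat) \<Rightarrow> nat" where
  "psize f = (\<Sum>i | f i \<noteq> 0. f i)"

lemma hseq_addletter: "hseq h \<Longrightarrow> hseq (addletter k x h)"
  by (auto simp: addletter_def hseq_def addrow_def addcol_def)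

lemma addletter_1: "hseq h \<Longrightarrow> addletter k x h 1 = h 1 + x"
  by (auto simp: addletter_def hseq_def addrow_def addcol_def)

lemma psize_eq: "(\<And>i. L \<le> i \<Longrightarrow> f i = 0) \<Longrightarrow> psize f = (\<Sum>i<L. f i)"
  unfolding psize_def by (rule sum.mono_neutral_left) (simp, metis (mono_tags) lessThan_iff linorder_not_less mem_Collect_eq subsetI, simp)

lemma psize_Par: "f \<in> Par n \<Longrightarrow> psize f = n"
  using psize_eq[of n f] Par_sum[of f n n] by (simp add: Par_zero)

text \<open>Two geometric tails cancel; what remains is a finite sum whose range will be the
  interlacing condition on one row.\<close>

lemma addrow_diff:
  assumes h: "hseq h"
  shows "addrow x h M - x ^ d * addrow x h (M - int d) = (\<Sum>r<d. x ^ r * h (M - int r))"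
proof -
  have e: "addrow x h M = (\<Sum>r<Z. x ^ r * h (M - int r))" if "nat M < Z" for M Z
  proof -
    have "h (M - int r) = 0" if "\<not> r \<le> nat M" for r by (rule hseq_neg[OF h]) (use that in linarith)
    then show ?thesis unfolding addrow_def using that by (intro sum.mono_neutral_left) auto
  qed
  define Z where "Z = Suc (nat \<bar>M\<bar>)"
  have s: "(\<Sum>r<d + Z. F r) = (\<Sum>r<d. F r) + (\<Sum>r<Z. F (d + r))" for F :: "nat \<Rightarrow> 'a"
    by (induction Z) (auto simp: add.assoc)
  have "addrow x h M = (\<Sum>r<d. x ^ r * h (M - int r)) + (\<Sum>r<Z. x ^ (d + r) * h (M - int (d + r)))"
  proof -
    have "nat M < d + Z" by (simp add: Z_def)
    show ?thesis unfolding e[OF \<open>nat M < d + Z\<close>] by (rule s)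
  qed
  also have "(\<Sum>r<Z. x ^ (d + r) * h (M - int (d + r))) = x ^ d * addrow x h (M - int d)"
  proof -
    have "nat (M - int d) < Z" by (simp add: Z_def)
    show ?thesis unfolding e[OF \<open>nat (M - int d) < Z\<close>]
      by (simp add: power_add sum_distrib_left mult.assoc diff_diff_eq)
  qed
  finally show ?thesis by simp
qed

lemma strip_Par:
  assumes f: "f \<in> Par n" and g: "g \<in> strip k f"
  shows "g \<in> Par (psize g)" "psize g \<le> n" "g i \<le> f i" "g (Suc i) \<le> g i" "n \<le> i \<Longrightarrow> g i = 0"
proof -
  have le: "g i \<le> f i" for i using g by (auto simp: strip_def hstrip_def vstrip_def split: if_splits)
  then show "g i \<le> f i" .
  have z: "g i = 0" if "n \<le> i" for i using le[of i] Par_zero[OF f that] by simp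
  then show "n \<le> i \<Longrightarrow> g i = 0" .
  have mono: "g (Suc i) \<le> g i" for i
    using g by (auto simp: strip_def hstrip_def vstrip_def intro: order_trans split: if_splits)
  then show "g (Suc i) \<le> g i" .
  show "g \<in> Par (psize g)" using mono z by (intro ParI[of _ n]) (auto simp: psize_eq[of n])
  have "psize g = (\<Sum>i<n. g i)" using z by (rule psize_eq)
  also have "\<dots> \<le> (\<Sum>i<n. f i)" by (rule sum_mono) (rule le)
  finally show "psize g \<le> n" using Par_sum[OF f] by simp
qed

text \<open>Subtracting x to the power f i - f (i + 1) + 1 times the next row from row i truncates
  its expansion to lengths k between f (i + 1) and f i. Multilinearity then yields exactly the
  horizontal strips, with no cancelling terms left.\<close>

lemma sch_addrow:
  assumes h: "hseq h" and f: "f \<in> Par n" and n: "n \<le> l"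
  shows "sch (Suc l) (addrow x h) f = (\<Sum>g\<in>hstrip f. x ^ (n - psize g) * sch (Suc l) h g)"
proof -
  let ?L = "Suc l"
  let ?R = "addrow x h"
  have fl: "f i = 0" if "l \<le> i" for i using Par_zero[OF f] n that by simp
  have "sch ?L ?R f = ldet ?L (\<lambda>i j. if i < ?L \<and> Suc i < ?L then ?R (int (f i) - int i + int j)
      - x ^ (f i - f (Suc i) + 1) * ?R (int (f (Suc i)) - int (Suc i) + int j) else ?R (int (f i) - int i + int j))"
    unfolding sch_def by (rule ldet_row_op[symmetric])
  also have "\<dots> = ldet ?L (\<lambda>i j. \<Sum>k\<in>{f (Suc i)..f i}. x ^ (f i - k) * h (int k - int i + int j))"
  proof (rule ldet_cong)
    fix i j assume ij: "i < ?L" "j < ?L"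
    show "(if i < ?L \<and> Suc i < ?L then ?R (int (f i) - int i + int j)
      - x ^ (f i - f (Suc i) + 1) * ?R (int (f (Suc i)) - int (Suc i) + int j) else ?R (int (f i) - int i + int j)) =
      (\<Sum>k\<in>{f (Suc i)..f i}. x ^ (f i - k) * h (int k - int i + int j))"
    proof (cases "Suc i < ?L")
      case True
      let ?d = "f i - f (Suc i) + 1" and ?M = "int (f i) - int i + int j"
      have M: "int (f (Suc i)) - int (Suc i) + int j = ?M - int ?d"
        using Par_mono[OF f, of i] by simp
      have "?R ?M - x ^ ?d * ?R (?M - int ?d) = (\<Sum>r<?d. x ^ r * h (?M - int r))"
        by (rule addrow_diff[OF h])
      also have "\<dots> = (\<Sum>k\<in>{f (Suc i)..f i}. x ^ (f i - k) * h (int k - int i + int j))"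
        using Par_mono[OF f, of i]
        by (intro sum.reindex_bij_witness[of _ "\<lambda>k. f i - k" "\<lambda>r. f i - r"]) (auto simp: algebra_simps of_nat_diff)
      finally show ?thesis unfolding M using True ij by simp
    next
      case False
      then have "i = l" using ij by simp
      then show ?thesis using ij fl[of l] fl[of "Suc l"] h by (auto simp: addrow_def nat_eq_iff)
    qed
  qed
  also have "\<dots> = (\<Sum>\<kappa>\<in>PiE {..<?L} (\<lambda>i. {f (Suc i)..f i}).
      ldet ?L (\<lambda>i j. x ^ (f i - \<kappa> i) * h (int (\<kappa> i) - int i + int j)))"
    by (rule ldet_rows_sum) simp
  also have "\<dots> = (\<Sum>\<kappa>\<in>PiE {..<?L} (\<lambda>i. {f (Suc i)..f i}).
      (\<Prod>i<?L. x ^ (f i - \<kappa> i)) * sch ?L h \<kappa>)"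
    unfolding sch_def by (intro sum.cong refl ldet_rows_scale)
  also have "\<dots> = (\<Sum>g\<in>hstrip f. x ^ (n - psize g) * sch ?L h g)"
  proof (rule sum.reindex_bij_witness[of _ "\<lambda>g. restrict g {..<?L}" "\<lambda>\<kappa> i. if i < ?L then \<kappa> i else 0"])
    fix \<kappa> assume k: "\<kappa> \<in> PiE {..<?L} (\<lambda>i. {f (Suc i)..f i})"
    let ?g = "\<lambda>i. if i < ?L then \<kappa> i else 0"
    show "restrict ?g {..<?L} = \<kappa>" using k by (auto simp: fun_eq_iff PiE_def extensional_def)
    show g: "?g \<in> hstrip f" using k fl by (auto simp: hstrip_def PiE_def Pi_def)
    then have gs: "?g \<in> strip True f" by (simp add: strip_def)
    have "psize ?g = (\<Sum>i<?L. \<kappa> i)" by (subst psize_eq[of ?L]) auto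
    moreover have "(\<Sum>i<?L. f i - \<kappa> i) = (\<Sum>i<?L. f i) - (\<Sum>i<?L. \<kappa> i)"
      using k by (intro sum_subtractf_nat) (auto simp: PiE_def Pi_def)
    ultimately have "(\<Prod>i<?L. x ^ (f i - \<kappa> i)) = x ^ (n - psize ?g)"
      using Par_sum[OF f, of ?L] n by (simp only: power_sum[symmetric])
    moreover have "sch ?L h ?g = sch ?L h \<kappa>" unfolding sch_def by (rule ldet_cong) auto
    ultimately show "x ^ (n - psize ?g) * sch ?L h ?g = (\<Prod>i<?L. x ^ (f i - \<kappa> i)) * sch ?L h \<kappa>" by simp
  next
    fix g assume g: "g \<in> hstrip f"
    show "restrict g {..<?L} \<in> PiE {..<?L} (\<lambda>i. {f (Suc i)..f i})" using g by (auto simp: hstrip_def)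
    show "(\<lambda>i. if i < ?L then restrict g {..<?L} i else 0) = g"
    proof
      fix i show "(if i < ?L then restrict g {..<?L} i else 0) = g i"
        using g fl[of i] by (auto simp: hstrip_def) (metis Suc_leI bot_nat_0.extremum_uniqueI not_less le_SucI less_Suc_eq_le)
    qed
  qed
  finally show ?thesis .
qed

text \<open>Every row is shortened by 0 or 1. A choice that does not leave a partition shortens row
  i but not the equally long row i + 1, which makes two rows equal, or shortens the empty last row,
  which makes that row zero.\<close>

lemma sch_addcol:
  assumes h: "hseq h" and f: "f \<in> Par n" and n: "n \<le> l"
  shows "sch (Suc l) (addcol x h) f = (\<Sum>g\<in>vstrip f. x ^ (n - psize g) * sch (Suc l) h g)"
proof -
  let ?L = "Suc l"
  have fl: "f i = 0" if "l \<le> i" for i using Par_zero[OF f] n that by simp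
  let ?P = "PiE {..<?L} (\<lambda>_. {0..1::nat})"
  let ?T = "\<lambda>\<kappa>. ldet ?L (\<lambda>i j. h (int (f i) - int (\<kappa> i) - int i + int j))"
  let ?V = "{\<kappa> \<in> ?P. \<kappa> l = 0 \<and> (\<forall>i<l. int (f (Suc i)) - int (\<kappa> (Suc i)) \<le> int (f i) - int (\<kappa> i))}"
  have "sch ?L (addcol x h) f = ldet ?L (\<lambda>i j. \<Sum>k\<in>{0..1}. x ^ k * h (int (f i) - int k - int i + int j))"
    unfolding sch_def addcol_def
    by (rule ldet_cong) (simp add: algebra_simps)
  also have "\<dots> = (\<Sum>\<kappa>\<in>?P. ldet ?L (\<lambda>i j. x ^ \<kappa> i * h (int (f i) - int (\<kappa> i) - int i + int j)))"
    by (rule ldet_rows_sum) simp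
  also have "\<dots> = (\<Sum>\<kappa>\<in>?P. (\<Prod>i<?L. x ^ \<kappa> i) * ?T \<kappa>)"
    by (intro sum.cong refl ldet_rows_scale)
  also have "\<dots> = (\<Sum>\<kappa>\<in>?V. (\<Prod>i<?L. x ^ \<kappa> i) * ?T \<kappa>)"
  proof (rule sum.mono_neutral_right)
    show "\<forall>\<kappa>\<in>?P - ?V. (\<Prod>i<?L. x ^ \<kappa> i) * ?T \<kappa> = 0"
    proof
      fix \<kappa> assume k: "\<kappa> \<in> ?P - ?V"
      have k01: "\<kappa> i = 0 \<or> \<kappa> i = 1" if "i < ?L" for i
        using k that by (auto simp: PiE_def Pi_def le_Suc_eq)
      have "?T \<kappa> = 0"
      proof (cases "\<kappa> l = 0")
        case False
        then have "\<kappa> l = 1" using k01[of l] by simp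
        then have "?T \<kappa> = 0 * ldet l (\<lambda>i j. h (int (f i) - int (\<kappa> i) - int i + int j))"
          using fl[of l] h by (subst ldet_last_row) (auto simp: hseq_neg)
        then show ?thesis by simp
      next
        case True
        then obtain i where i: "i < l" "int (f i) - int (\<kappa> i) < int (f (Suc i)) - int (\<kappa> (Suc i))"
          using k by (auto simp: not_le)
        then have "\<kappa> i = 1" "\<kappa> (Suc i) = 0" "f i = f (Suc i)"
          using k01[of i] k01[of "Suc i"] Par_mono[OF f, of i] by auto
        then show ?thesis
          using i by (intro ldet_equal_rows[of i _ "Suc i"]) (auto intro!: arg_cong[of _ _ h])
      qed
      then show "(\<Prod>i<?L. x ^ \<kappa> i) * ?T \<kappa> = 0" by simp
    qed
  qed (auto intro!: finite_PiE)
  also have "\<dots> = (\<Sum>g\<in>vstrip f. x ^ (n - psize g) * sch ?L h g)"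
  proof (rule sum.reindex_bij_witness[of _ "\<lambda>g. restrict (\<lambda>i. f i - g i) {..<?L}" "\<lambda>\<kappa> i. if i < ?L then f i - \<kappa> i else 0"])
    fix \<kappa> assume k: "\<kappa> \<in> ?V"
    let ?g = "\<lambda>i. if i < ?L then f i - \<kappa> i else 0"
    have k1: "\<kappa> i \<le> 1" if "i < ?L" for i using k that by (auto simp: PiE_def Pi_def)
    \<comment> \<open>Upward from the last row, which is not shortened: this shows that the
      truncated subtractions below are exact.\<close>
    have nn: "\<kappa> i \<le> f i" if "i \<le> l" for i
      using that
    proof (induction rule: inc_induct)
      case base then show ?case using k by simp
    next
      case (step i)
      then have "int (f (Suc i)) - int (\<kappa> (Suc i)) \<le> int (f i) - int (\<kappa> i)" using k by auto
      then show ?case using step by simp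
    qed
    show "restrict (\<lambda>i. f i - ?g i) {..<?L} = \<kappa>"
      using k nn by (auto simp: fun_eq_iff PiE_def extensional_def)
    show g: "?g \<in> vstrip f"
      unfolding vstrip_def
    proof (intro CollectI conjI allI)
      fix i
      show "?g (Suc i) \<le> ?g i"
      proof (cases "i < l")
        case True
        then have "int (f (Suc i)) - int (\<kappa> (Suc i)) \<le> int (f i) - int (\<kappa> i)" using k by auto
        then show ?thesis using nn[of i] nn[of "Suc i"] True by simp
      qed auto
      show "?g i \<le> f i" by auto
      show "f i \<le> Suc (?g i)" using k1[of i] fl[of i] by (cases "i < ?L") auto
    qed
    have "psize ?g = (\<Sum>i<?L. f i - \<kappa> i)" by (subst psize_eq[of ?L]) auto
    moreover have "(\<Sum>i<?L. f i - \<kappa> i) = (\<Sum>i<?L. f i) - (\<Sum>i<?L. \<kappa> i)"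
      using nn by (intro sum_subtractf_nat) auto
    moreover have "(\<Sum>i<?L. \<kappa> i) \<le> (\<Sum>i<?L. f i)" using nn by (intro sum_mono) auto
    ultimately have "n - psize ?g = (\<Sum>i<?L. \<kappa> i)" using Par_sum[OF f, of ?L] n by linarith
    then have "(\<Prod>i<?L. x ^ \<kappa> i) = x ^ (n - psize ?g)" by (simp only: power_sum)
    moreover have "sch ?L h ?g = ?T \<kappa>" unfolding sch_def
      by (rule ldet_cong) (use nn in \<open>auto simp: of_nat_diff\<close>)
    ultimately show "x ^ (n - psize ?g) * sch ?L h ?g = (\<Prod>i<?L. x ^ \<kappa> i) * ?T \<kappa>" by simp
  next
    fix g assume g: "g \<in> vstrip f"
    have le: "g i \<le> f i" "f i \<le> Suc (g i)" "g (Suc i) \<le> g i" for i using g by (auto simp: vstrip_def)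
    have d: "f i - g i \<le> 1" for i using le(2)[of i] by simp
    show "restrict (\<lambda>i. f i - g i) {..<?L} \<in> ?V"
      using d le fl[of l] by (auto simp: of_nat_diff)
    show "(\<lambda>i. if i < ?L then f i - restrict (\<lambda>i. f i - g i) {..<?L} i else 0) = g"
    proof
      fix i show "(if i < ?L then f i - restrict (\<lambda>i. f i - g i) {..<?L} i else 0) = g i"
        using le(1)[of i] fl[of i] by auto
    qed
  qed
  finally show ?thesis .
qed

lemma sch_addletter:
  assumes "hseq h" "f \<in> Par n" "n \<le> l"
  shows "sch (Suc l) (addletter k x h) f = (\<Sum>g\<in>strip k f. x ^ (n - psize g) * sch (Suc l) h g)"
  using sch_addrow[OF assms] sch_addcol[OF assms] by (simp add: addletter_def strip_def)

lemma finite_strip: "f \<in> Par n \<Longrightarrow> finite (strip k f)"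
proof (rule finite_subset)
  assume f: "f \<in> Par n"
  show "strip k f \<subseteq> (\<Union>m\<le>n. Par m)" using strip_Par[OF f] by blast
qed (simp add: finite_Par)

section \<open>Removing several letters: chains of strips\<close>

fun schains :: "bool list \<Rightarrow> (nat \<Rightarrow> nat) \<Rightarrow> (nat \<Rightarrow> nat) list set" where
  "schains [] f = {[]}"
| "schains (k # ks) f = (\<Union>g\<in>strip k f. (#) g ` schains ks g)"

fun counts :: "(nat \<Rightarrow> nat) \<Rightarrow> (nat \<Rightarrow> nat) list \<Rightarrow> nat list" where
  "counts f [] = []"
| "counts f (g # c) = (psize f - psize g) # counts g c"

text \<open>The head of the list is the outermost letter, hence the first whose strip is removed, in
  the same order as in \<open>schains\<close>.\<close>

fun build :: "bool list \<Rightarrow> 'a::field_char_0 list \<Rightarrow> (int \<Rightarrow> 'a) \<Rightarrow> int \<Rightarrow> 'a" where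
  "build (k # ks) (x # xs) h = addletter k x (build ks xs h)"
| "build _ _ h = h"

lemma hseq_build: "hseq h \<Longrightarrow> hseq (build ks xs h)"
  by (induction ks xs h rule: build.induct) (auto intro: hseq_addletter)

lemma build_1: "hseq h \<Longrightarrow> length ks = length xs \<Longrightarrow> build ks xs h 1 = sum_list xs + h 1"
  by (induction ks xs rule: list_induct2') (auto simp: addletter_1 hseq_build)

lemma finite_schains: "f \<in> Par n \<Longrightarrow> finite (schains ks f)"
  by (induction ks arbitrary: f n) (auto intro!: finite_UN_I finite_strip dest: strip_Par(1))

lemma counts_length: "length (counts f c) = length c"
  by (induction c arbitrary: f) auto

lemma schains_length: "c \<in> schains ks f \<Longrightarrow> length c = length ks"
  by (induction ks arbitrary: c f) auto

lemma schains_last: "c \<in> schains ks f \<Longrightarrow> f \<in> Par n \<Longrightarrow> \<exists>m\<le>n. last (f # c) \<in> Par m"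
proof (induction ks arbitrary: c f n)
  case (Cons k ks)
  then obtain g c' where c: "c = g # c'" "g \<in> strip k f" "c' \<in> schains ks g" by auto
  then obtain m where "m \<le> psize g" "last (g # c') \<in> Par m"
    using Cons.IH[of c' g "psize g"] strip_Par(1)[OF Cons.prems(2)] by blast
  then show ?case using c strip_Par(2)[OF Cons.prems(2) c(2)] by (intro exI[of _ m]) auto
qed auto

text \<open>The one-letter expansion iterated: a chain records the strips of the letters, and its
  last shape is left to the specialisation h.\<close>

lemma sch_build:
  assumes h: "hseq h" and "length ks = length xs" "f \<in> Par n" "n \<le> l"
  shows "sch (Suc l) (build ks xs h) f =
    (\<Sum>c\<in>schains ks f. (\<Prod>i<length xs. (xs ! i) ^ (counts f c ! i)) * sch (Suc l) h (last (f # c)))"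
  using assms(2-)
proof (induction ks xs arbitrary: f n rule: list_induct2)
  case (Cons k ks x xs)
  let ?F = "\<lambda>xs f c. (\<Prod>i<length xs. (xs ! i) ^ (counts f c ! i)) * sch (Suc l) h (last (f # c))"
  note f = Cons.prems(1)
  have "sch (Suc l) (build (k # ks) (x # xs) h) f =
      (\<Sum>g\<in>strip k f. x ^ (n - psize g) * sch (Suc l) (build ks xs h) g)"
    using Cons.prems by (simp add: sch_addletter hseq_build[OF h])
  also have "\<dots> = (\<Sum>g\<in>strip k f. x ^ (n - psize g) * (\<Sum>c\<in>schains ks g. ?F xs g c))"
    using strip_Par(2)[OF f] Cons.prems by (intro sum.cong refl arg_cong2[where f="(*)"] Cons.IH[OF strip_Par(1)[OF f]]) (auto intro: order_trans)
  also have "\<dots> = (\<Sum>g\<in>strip k f. \<Sum>c\<in>schains ks g. ?F (x # xs) f (g # c))"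
    unfolding sum_distrib_left
    by (intro sum.cong refl) (simp add: prod.lessThan_Suc_shift psize_Par[OF f] mult.assoc del: prod.lessThan_Suc)
  also have "\<dots> = (\<Sum>g\<in>strip k f. \<Sum>c\<in>(#) g ` schains ks g. ?F (x # xs) f c)"
  proof (rule sum.cong[OF refl])
    fix g
    show "(\<Sum>c\<in>schains ks g. ?F (x # xs) f (g # c)) = (\<Sum>c\<in>(#) g ` schains ks g. ?F (x # xs) f c)"
      using sum.reindex[of "(#) g" "schains ks g" "?F (x # xs) f"] by (simp add: o_def inj_on_def)
  qed
  also have "\<dots> = (\<Sum>c\<in>schains (k # ks) f. ?F (x # xs) f c)"
    unfolding schains.simps
    by (rule sum.UNION_disjoint[symmetric])
      (use finite_strip[OF f] finite_schains[OF strip_Par(1)[OF f]] in \<open>auto intro!: finite_imageI\<close>)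
  finally show ?case .
qed simp

section \<open>Letter counts are dominated by row and column lengths\<close>

definition row_counts :: "bool list \<Rightarrow> nat list \<Rightarrow> nat list" where
  "row_counts ks \<nu> = map snd (filter fst (zip ks \<nu>))"

definition col_counts :: "bool list \<Rightarrow> nat list \<Rightarrow> nat list" where
  "col_counts ks \<nu> = map snd (filter (\<lambda>p. \<not> fst p) (zip ks \<nu>))"

text \<open>Column letters only shrink the shape. For a row letter, f (i + 1) is at most g i, so the
  rows of f from k on fit into the rows of g from k - 1 on. Comparing sizes, the strip together with
  the first k - 1 rows of g is no larger than the first k rows of f.\<close>

lemma chain_rows:
  assumes "c \<in> schains ks f" "f \<in> Par n"
  shows "sum_list (take k (row_counts ks (counts f c))) \<le> (\<Sum>i<k. f i)"
  using assms
proof (induction ks arbitrary: c f n k)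
  case (Cons b ks)
  then obtain g c' where c: "c = g # c'" "g \<in> strip b f" "c' \<in> schains ks g" by auto
  note g = strip_Par[OF Cons.prems(2) c(2)]
  have IH: "sum_list (take k (row_counts ks (counts g c'))) \<le> (\<Sum>i<k. g i)" for k
    using Cons.IH[OF c(3) g(1)] .
  show ?case
  proof (cases b)
    case False
    then have "sum_list (take k (row_counts (b # ks) (counts f c))) \<le> (\<Sum>i<k. g i)"
      using IH[of k] c by (simp add: row_counts_def)
    also have "\<dots> \<le> (\<Sum>i<k. f i)" by (intro sum_mono g)
    finally show ?thesis .
  next
    case True
    show ?thesis
    proof (cases k)
      case (Suc k')
      define N where "N = max n k'"
      have gi: "f (Suc i) \<le> g i" for i using c(2) True by (auto simp: strip_def hstrip_def)
      have "psize g = (\<Sum>i<N. g i)" using g(5) by (intro psize_eq) (simp add: N_def)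
      also have "\<dots> = (\<Sum>i<k'. g i) + (\<Sum>i\<in>{k'..<N}. g i)"
        by (subst sum.atLeastLessThan_concat[of 0 k' N, unfolded atLeast0LessThan, symmetric]) (auto simp: N_def)
      finally have wg: "psize g = (\<Sum>i<k'. g i) + (\<Sum>i\<in>{k'..<N}. g i)" .
      have "psize f = (\<Sum>i<Suc N. f i)" using Par_zero[OF Cons.prems(2)] by (intro psize_eq) (simp add: N_def)
      also have "\<dots> = (\<Sum>i<k. f i) + (\<Sum>i\<in>{k..<Suc N}. f i)"
        by (subst sum.atLeastLessThan_concat[of 0 k "Suc N", unfolded atLeast0LessThan, symmetric]) (auto simp: N_def Suc)
      also have "(\<Sum>i\<in>{k..<Suc N}. f i) = (\<Sum>i\<in>{k'..<N}. f (Suc i))"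
        unfolding Suc by (rule sum.shift_bounds_Suc_ivl)
      also have "\<dots> \<le> (\<Sum>i\<in>{k'..<N}. g i)" by (intro sum_mono gi)
      finally have "psize f - psize g + (\<Sum>i<k'. g i) \<le> (\<Sum>i<k. f i)"
        using wg g(2) psize_Par[OF Cons.prems(2)] by linarith
      then show ?thesis using IH[of k'] c True Suc by (simp add: row_counts_def)
    qed simp
  qed
qed (simp add: row_counts_def)

text \<open>The right-hand side counts the boxes in the first k columns. A vertical strip takes at
  most one box from a row, so in each row the removed box together with the boxes of g in the first
  k - 1 columns fits into the first k columns of f.\<close>

lemma chain_cols:
  assumes "c \<in> schains ks f" "f \<in> Par n" "n \<le> L"
  shows "sum_list (take k (col_counts ks (counts f c))) \<le> (\<Sum>i<L. min (f i) k)"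
  using assms
proof (induction ks arbitrary: c f n k)
  case (Cons b ks)
  then obtain g c' where c: "c = g # c'" "g \<in> strip b f" "c' \<in> schains ks g" by auto
  note g = strip_Par[OF Cons.prems(2) c(2)]
  have IH: "sum_list (take k (col_counts ks (counts g c'))) \<le> (\<Sum>i<L. min (g i) k)" for k
    using Cons.IH[OF c(3) g(1)] g(2) Cons.prems(3) by simp
  show ?case
  proof (cases b)
    case True
    then have "sum_list (take k (col_counts (b # ks) (counts f c))) \<le> (\<Sum>i<L. min (g i) k)"
      using IH[of k] c by (simp add: col_counts_def)
    also have "\<dots> \<le> (\<Sum>i<L. min (f i) k)" by (intro sum_mono min.mono g order_refl)
    finally show ?thesis .
  next
    case False
    show ?thesis
    proof (cases k)
      case (Suc k')
      have gi: "f i \<le> Suc (g i)" for i using c(2) False by (auto simp: strip_def vstrip_def)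
      have wg: "psize g = (\<Sum>i<L. g i)" using g(5) Cons.prems(3) by (intro psize_eq) simp
      have wf: "psize f = (\<Sum>i<L. f i)" using Par_zero[OF Cons.prems(2)] Cons.prems(3) by (intro psize_eq) simp
      have "psize f - psize g + (\<Sum>i<L. min (g i) k') = (\<Sum>i<L. f i - g i) + (\<Sum>i<L. min (g i) k')"
        unfolding wf wg using g(3) by (subst sum_subtractf_nat) auto
      also have "\<dots> \<le> (\<Sum>i<L. min (f i) k)"
        unfolding sum.distrib[symmetric]
      proof (intro sum_mono)
        fix i show "f i - g i + min (g i) k' \<le> min (f i) k"
          using gi[of i] g(3)[of i] Suc by (auto simp: min_def)
      qed
      finally show ?thesis using IH[of k'] c False Suc by (simp add: col_counts_def)
    qed simp
  qed
qed (simp add: col_counts_def)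

section \<open>Specialisations determined by power sums\<close>

definition h_fps :: "(int \<Rightarrow> 'a::field_char_0) \<Rightarrow> 'a fps" where
  "h_fps h = Abs_fps (\<lambda>n. h (int n))"

definition p_fps :: "(nat \<Rightarrow> 'a::field_char_0) \<Rightarrow> 'a fps" where
  "p_fps p = Abs_fps (\<lambda>n. p (Suc n))"

text \<open>Newton's identities say that the power sums are the coefficients of the logarithmic
  derivative of the generating function of h; this makes products of generating functions correspond
  to sums of power sums.\<close>

lemma newton_fps: "newton h p \<longleftrightarrow> fps_deriv (h_fps h) = p_fps p * h_fps h"
proof -
  have e: "(\<Sum>k=1..Suc n. p k * h (int (Suc n) - int k)) = (\<Sum>i\<le>n. p (Suc i) * h (int (n - i)))" for n
    by (rule sum.reindex_bij_witness[of _ Suc "\<lambda>k. k - 1"]) (auto simp: of_nat_diff)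
  have "fps_deriv (h_fps h) = p_fps p * h_fps h \<longleftrightarrow>
      (\<forall>n. of_nat (Suc n) * h (int (Suc n)) = (\<Sum>k=1..Suc n. p k * h (int (Suc n) - int k)))"
    unfolding e by (simp add: fps_eq_iff h_fps_def p_fps_def fps_mult_nth atLeast0AtMost del: of_nat_Suc)
  also have "\<dots> \<longleftrightarrow> newton h p"
    unfolding newton_def
  proof (intro iffI allI)
    fix n assume *: "\<forall>n. of_nat (Suc n) * h (int (Suc n)) = (\<Sum>k=1..Suc n. p k * h (int (Suc n) - int k))"
    show "of_nat n * h (int n) = (\<Sum>k=1..n. p k * h (int n - int k))"
      by (cases n) (simp, use * in blast)
  qed blast
  finally show ?thesis by simp
qed

lemma newton_unique:
  assumes "newton h p" "newton h' p" "hseq h" "hseq h'"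
  shows "h = h'"
proof
  have n: "h (int n) = h' (int n)" for n
  proof (induction n rule: less_induct)
    case (less n)
    show ?case
    proof (cases "n = 0")
      case True then show ?thesis using assms by (simp add: hseq_0)
    next
      case False
      have "of_nat n * h (int n) = (\<Sum>k=1..n. p k * h (int n - int k))" using assms(1) by (simp add: newton_def)
      also have "\<dots> = (\<Sum>k=1..n. p k * h' (int n - int k))"
        using less by (intro sum.cong refl) (auto simp: of_nat_diff[symmetric] simp del: of_nat_diff)
      also have "\<dots> = of_nat n * h' (int n)" using assms(2) by (simp add: newton_def)
      finally show ?thesis using False by simp
    qed
  qed
  fix k show "h k = h' k"
    using n[of "nat k"] assms by (cases "k < 0") (auto simp: hseq_neg)
qed

lemma fps_mult_linear_nth:
  "fps_nth (A * (1 + fps_const c * fps_X)) n =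
    fps_nth A n + c * (if n = 0 then 0 else fps_nth (A :: 'a::field_char_0 fps) (n - 1))"
proof -
  have "A * (1 + fps_const c * fps_X) = A + fps_const c * (A * fps_X)"
    by (simp only: distrib_left mult_1_right mult.left_commute)
  then show ?thesis by (cases n) simp_all
qed

lemma h_fps_addrow:
  assumes "hseq h"
  shows "h_fps (addrow x h) * (1 + fps_const (- x) * fps_X) = h_fps h"
proof (rule fps_ext)
  fix n
  have e: "(if n = 0 then 0 else fps_nth (h_fps (addrow x h)) (n - 1)) = addrow x h (int n - 1)"
    using hseq_neg[OF assms] by (cases n) (auto simp: h_fps_def addrow_def)
  show "fps_nth (h_fps (addrow x h) * (1 + fps_const (- x) * fps_X)) n = fps_nth (h_fps h) n"
    unfolding fps_mult_linear_nth e using addrow_diff[OF assms, of x "int n" 1] by (simp add: h_fps_def)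
qed

lemma h_fps_addcol:
  assumes "hseq h"
  shows "h_fps (addcol x h) = h_fps h * (1 + fps_const x * fps_X)"
proof (rule fps_ext)
  fix n
  have e: "(if n = 0 then 0 else fps_nth (h_fps h) (n - 1)) = h (int n - 1)"
    using hseq_neg[OF assms] by (auto simp: h_fps_def of_nat_diff)
  show "fps_nth (h_fps (addcol x h)) n = fps_nth (h_fps h * (1 + fps_const x * fps_X)) n"
    unfolding fps_mult_linear_nth e by (simp add: h_fps_def addcol_def)
qed

text \<open>The power sums of one letter: x^j for a row letter, and x^j with the sign of (-1)^(j -
  1) for a column letter.\<close>

definition letter_power :: "bool \<Rightarrow> 'a::field_char_0 \<Rightarrow> nat \<Rightarrow> 'a" where
  "letter_power k x j = (if k then x ^ j else - ((- x) ^ j))"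

lemma p_fps_letter:
  "p_fps (\<lambda>j. p j + s * c ^ j) * (1 + fps_const (- c) * fps_X) = p_fps p * (1 + fps_const (- c) * fps_X) + fps_const (s * c)"
proof (rule fps_ext)
  fix n show "fps_nth (p_fps (\<lambda>j. p j + s * c ^ j) * (1 + fps_const (- c) * fps_X)) n =
      fps_nth (p_fps p * (1 + fps_const (- c) * fps_X) + fps_const (s * c)) n"
    unfolding fps_add_nth fps_mult_linear_nth by (cases n) (simp_all add: p_fps_def algebra_simps)
qed

lemma newton_addletter:
  assumes nw: "newton h p" and h: "hseq h"
  shows "newton (addletter k x h) (\<lambda>j. p j + letter_power k x j)"
proof (cases k)
  case True
  let ?q = "\<lambda>j. p j + 1 * x ^ j"
  \<comment> \<open>The logarithmic derivative of F = G / u, written without division: everything is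
    multiplied by u = 1 - x z, which is cancelled at the end.\<close>
  have ring: "dF = q * F" if "F * u = G" "F * du + dF * u = dG" "dG = P * G" "q * u = P * u + c" "du = - c" "u \<noteq> 0"
    for dF F G dG P q u c du :: "'a fps"
  proof -
    have "dF * u = dG - F * du" unfolding that(2)[symmetric] by simp
    also have "\<dots> = F * (P * u + c)" unfolding that(3,5) that(1)[symmetric] by (simp add: algebra_simps)
    also have "\<dots> = q * F * u" unfolding that(4)[symmetric] by (simp add: algebra_simps)
    finally have "dF * u = q * F * u" .
    then show ?thesis using that(6) by simp
  qed
  have "fps_deriv (h_fps (addrow x h)) = p_fps ?q * h_fps (addrow x h)"
  proof (rule ring)
    show "h_fps (addrow x h) * (1 + fps_const (- x) * fps_X) = h_fps h" by (rule h_fps_addrow[OF h])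
    show "h_fps (addrow x h) * fps_deriv (1 + fps_const (- x) * fps_X) + fps_deriv (h_fps (addrow x h)) * (1 + fps_const (- x) * fps_X)
        = fps_deriv (h_fps h)"
      unfolding h_fps_addrow[OF h, of x, symmetric] by (rule fps_deriv_mult[symmetric])
    show "fps_deriv (h_fps h) = p_fps p * h_fps h" using nw by (simp add: newton_fps)
    show "p_fps ?q * (1 + fps_const (- x) * fps_X) = p_fps p * (1 + fps_const (- x) * fps_X) + fps_const (1 * x)"
      by (rule p_fps_letter)
    show "fps_deriv (1 + fps_const (- x) * fps_X) = - fps_const (1 * x)" by simp
    show "1 + fps_const (- x) * fps_X \<noteq> 0"
    proof
      assume "1 + fps_const (- x) * fps_X = 0"
      then have "fps_nth (1 + fps_const (- x) * fps_X) 0 = 0" by (simp only: fps_zero_nth)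
      then show False by simp
    qed
  qed
  then show ?thesis using True by (simp add: newton_fps addletter_def letter_power_def)
next
  case False
  let ?q = "\<lambda>j. p j + (- 1) * (- x) ^ j"
  have ring: "dF = q * F" if "F = G * u" "dF = G * du + dG * u" "dG = P * G" "q * u = P * u + c" "du = c"
    for dF F G dG P q u c du :: "'a fps"
  proof -
    have "dF = G * (P * u + c)" unfolding that(2,3,5) by (simp add: algebra_simps)
    then show ?thesis unfolding that(1) that(4)[symmetric] by (simp add: algebra_simps)
  qed
  have "fps_deriv (h_fps (addcol x h)) = p_fps ?q * h_fps (addcol x h)"
  proof (rule ring)
    show "h_fps (addcol x h) = h_fps h * (1 + fps_const x * fps_X)" by (rule h_fps_addcol[OF h])
    show "fps_deriv (h_fps (addcol x h)) = h_fps h * fps_deriv (1 + fps_const x * fps_X) + fps_deriv (h_fps h) * (1 + fps_const x * fps_X)"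
      unfolding h_fps_addcol[OF h] by (rule fps_deriv_mult)
    show "fps_deriv (h_fps h) = p_fps p * h_fps h" using nw by (simp add: newton_fps)
    show "p_fps ?q * (1 + fps_const x * fps_X) = p_fps p * (1 + fps_const x * fps_X) + fps_const x"
      using p_fps_letter[of p "-1" "- x"] by simp
    show "fps_deriv (1 + fps_const x * fps_X) = fps_const x" by simp
  qed
  then show ?thesis using False by (simp add: newton_fps addletter_def letter_power_def)
qed

section \<open>The specialisation with prescribed power sums, and its continuity\<close>

fun h_rec :: "(nat \<Rightarrow> real) \<Rightarrow> nat \<Rightarrow> real" where
  "h_rec p n = (if n = 0 then 1 else (\<Sum>k\<in>{1..n}. p k * h_rec p (n - k)) / real n)"

declare h_rec.simps [simp del]

lemma h_rec_0 [simp]: "h_rec p 0 = 1"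
  by (subst h_rec.simps) simp

lemma h_rec_step: "n \<noteq> 0 \<Longrightarrow> h_rec p n = (\<Sum>k\<in>{1..n}. p k * h_rec p (n - k)) / real n"
  by (subst h_rec.simps) simp

definition h_of :: "(nat \<Rightarrow> real) \<Rightarrow> int \<Rightarrow> real" where
  "h_of p k = (if k < 0 then 0 else h_rec p (nat k))"

lemma hseq_h_of: "hseq (h_of p)"
  by (simp add: hseq_def h_of_def)

lemma newton_h_of: "newton (h_of p) p"
  unfolding newton_def
proof
  fix n show "of_nat n * h_of p (int n) = (\<Sum>k=1..n. p k * h_of p (int n - int k))"
  proof (cases "n = 0")
    case False
    then have "of_nat n * h_of p (int n) = (\<Sum>k=1..n. p k * h_rec p (n - k))"
      by (simp add: h_of_def h_rec_step[of n p])
    also have "\<dots> = (\<Sum>k=1..n. p k * h_of p (int n - int k))"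
      by (intro sum.cong refl) (auto simp: h_of_def nat_diff_distrib)
    finally show ?thesis .
  qed simp
qed

lemma h_of_eqI: "newton h p \<Longrightarrow> hseq h \<Longrightarrow> h = h_of p"
  by (rule newton_unique[OF _ newton_h_of _ hseq_h_of])

lemma h_of_addletter: "addletter k x (h_of p) = h_of (\<lambda>j. p j + letter_power k x j)"
  by (intro h_of_eqI newton_addletter newton_h_of hseq_addletter hseq_h_of)

lemma h_of_cong:
  assumes "\<And>k. k \<ge> 1 \<Longrightarrow> p k = q k"
  shows "h_of p = h_of q"
proof (rule h_of_eqI[OF _ hseq_h_of])
  have "(\<Sum>k=1..n. p k * h_of p (int n - int k)) = (\<Sum>k=1..n. q k * h_of p (int n - int k))" for n
    by (intro sum.cong refl) (simp add: assms)
  then show "newton (h_of p) q" using newton_h_of[of p] unfolding newton_def by simp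
qed

text \<open>By induction each of the n summands is at most c^n, and the division by n compensates
  their number. The resulting disc of convergence depends on c alone, hence is common to all
  approximations used later.\<close>

lemma h_rec_bound:
  assumes "\<And>k. k \<ge> 1 \<Longrightarrow> \<bar>p k\<bar> \<le> c ^ k"
  shows "\<bar>h_rec p n\<bar> \<le> c ^ n"
proof (induction n rule: less_induct)
  case (less n)
  show ?case
  proof (cases "n = 0")
    case False
    have "\<bar>\<Sum>k\<in>{1..n}. p k * h_rec p (n - k)\<bar> \<le> (\<Sum>k\<in>{1..n}. c ^ n)"
    proof (rule order_trans[OF sum_abs sum_mono])
      fix k assume k: "k \<in> {1..n}"
      have "\<bar>p k * h_rec p (n - k)\<bar> \<le> c ^ k * c ^ (n - k)"
        unfolding abs_mult using k assms[of k] less[of "n - k"]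
        by (intro mult_mono) (auto intro: order_trans[OF abs_ge_zero])
      then show "\<bar>p k * h_rec p (n - k)\<bar> \<le> c ^ n" using k by (simp add: power_add[symmetric])
    qed
    then show ?thesis using False by (simp add: h_rec_step[of n p] field_simps)
  qed simp
qed

lemma tendsto_h_rec:
  assumes "\<And>k. k \<ge> 1 \<Longrightarrow> (\<lambda>N. P N k) \<longlonglongrightarrow> p k"
  shows "(\<lambda>N. h_rec (P N) n) \<longlonglongrightarrow> h_rec p n"
proof (induction n rule: less_induct)
  case (less n)
  show ?case
  proof (cases "n = 0")
    case False
    then show ?thesis unfolding h_rec_step[OF False]
      by (auto intro!: tendsto_divide tendsto_sum tendsto_mult assms less)
  qed simp
qed

lemma tendsto_sch:
  assumes "\<And>k. (\<lambda>N. H N k) \<longlonglongrightarrow> (h k :: real)"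
  shows "(\<lambda>N. sch L (H N) f) \<longlonglongrightarrow> sch L h f"
  unfolding sch_def ldet_def by (intro tendsto_sum tendsto_mult tendsto_const tendsto_prod assms)

text \<open>Only the values at \<open>k \<ge> 1\<close> matter; at \<open>k = 0\<close> the series may diverge.\<close>

definition thoma_psum :: "(nat \<Rightarrow> real) \<Rightarrow> (nat \<Rightarrow> real) \<Rightarrow> real \<Rightarrow> nat \<Rightarrow> real" where
  "thoma_psum \<alpha> \<beta> \<gamma> k = (\<Sum>i. \<alpha> i ^ k) - (\<Sum>i. (- \<beta> i) ^ k) + (if k = 1 then \<gamma> else 0)"

text \<open>Thoma parameters without ordering and normalisation. Unlike the latter, this condition
  passes to the tails that remain when letters are split off.\<close>

definition thoma_like :: "(nat \<Rightarrow> real) \<Rightarrow> (nat \<Rightarrow> real) \<Rightarrow> real \<Rightarrow> bool" where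
  "thoma_like \<alpha> \<beta> \<gamma> \<longleftrightarrow> (\<forall>i. 0 \<le> \<alpha> i) \<and> (\<forall>i. 0 \<le> \<beta> i) \<and> 0 \<le> \<gamma> \<and> summable \<alpha> \<and> summable \<beta>"

lemma summable_power_nonneg:
  fixes a :: "nat \<Rightarrow> real"
  assumes "\<And>i. 0 \<le> a i" "summable a" "k \<ge> 1"
  shows "summable (\<lambda>i. a i ^ k)" "(\<Sum>i\<in>I. a i ^ k) \<le> (\<Sum>i\<in>I. a i) * suminf a ^ (k - 1)"
proof -
  have le: "a i \<le> suminf a" for i using sum_le_suminf[OF assms(2), of "{i}"] assms(1) by simp
  have b: "a i ^ k \<le> a i * suminf a ^ (k - 1)" for i
  proof -
    have "a i ^ k = a i * a i ^ (k - 1)" using assms(3) by (cases k) auto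
    also have "\<dots> \<le> a i * suminf a ^ (k - 1)"
      using assms(1) le by (intro mult_left_mono power_mono) auto
    finally show ?thesis .
  qed
  show "summable (\<lambda>i. a i ^ k)"
    by (rule summable_comparison_test'[OF summable_mult2[OF assms(2), of "suminf a ^ (k - 1)"]])
      (use b assms(1) in auto)
  show "(\<Sum>i\<in>I. a i ^ k) \<le> (\<Sum>i\<in>I. a i) * suminf a ^ (k - 1)"
    unfolding sum_distrib_right by (rule sum_mono) (rule b)
qed

lemma power_sum_parts:
  assumes "thoma_like \<alpha> \<beta> \<gamma>" "k \<ge> 1"
  shows "(\<lambda>N. (\<Sum>i<N. letter_power True (\<alpha> i) k) + (\<Sum>i<N. letter_power False (\<beta> i) k) + (if k = 1 then \<gamma> else 0))
     \<longlonglongrightarrow> thoma_psum \<alpha> \<beta> \<gamma> k"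
proof -
  have "summable (\<lambda>i. \<alpha> i ^ k)" using assms by (intro summable_power_nonneg) (auto simp: thoma_like_def)
  moreover have "summable (\<lambda>i. (- \<beta> i) ^ k)"
  proof (rule summable_norm_cancel)
    have "norm ((- \<beta> i) ^ k) = \<beta> i ^ k" for i
      using assms by (simp add: norm_power thoma_like_def)
    then show "summable (\<lambda>i. norm ((- \<beta> i) ^ k))"
      using assms summable_power_nonneg(1)[of \<beta> k] by (auto simp: thoma_like_def)
  qed
  ultimately show ?thesis unfolding thoma_psum_def letter_power_def if_True if_False sum_negf diff_conv_add_uminus
    by (intro tendsto_add tendsto_minus tendsto_const summable_LIMSEQ)
qed

section \<open>Positivity of the Schur values\<close>

lemma sch_build_nonneg:
  fixes h :: "int \<Rightarrow> real"
  assumes h: "hseq h" and "length ks = length xs" "f \<in> Par n" "n \<le> l"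
    and "\<And>i. i < length xs \<Longrightarrow> 0 \<le> xs ! i"
    and pos: "\<And>m g. m \<le> n \<Longrightarrow> g \<in> Par m \<Longrightarrow> 0 \<le> sch (Suc l) h g"
  shows "0 \<le> sch (Suc l) (build ks xs h) f"
  unfolding sch_build[OF assms(1-4)]
proof (intro sum_nonneg mult_nonneg_nonneg prod_nonneg)
  fix c assume "c \<in> schains ks f"
  from schains_last[OF this assms(3)] show "0 \<le> sch (Suc l) h (last (f # c))" using pos by blast
qed (use assms(5) in auto)

text \<open>In the empty alphabet a non-empty diagram has value 0, because all entries in the top
  row of its determinant have positive index.\<close>

lemma sch_h_of_0_nonneg:
  assumes f: "f \<in> Par n"
  shows "0 \<le> sch (Suc l) (h_of (\<lambda>_. 0)) f"
proof (cases "n = 0")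
  case True
  then show ?thesis using f sch_zero[OF hseq_h_of] by (simp add: Par_0)
next
  case False
  have h: "h_of (\<lambda>_. 0) k = (if k = 0 then 1 else 0)" for k
    by (cases "k = 0") (simp_all add: h_of_def h_rec_step)
  have "f 0 > 0"
  proof (rule ccontr)
    assume "\<not> 0 < f 0"
    then have "f i = 0" for i using antimono_nat[of f 0 i] Par_mono[OF f] by simp
    then show False using Par_sum[OF f, of n] False by simp
  qed
  then have "sch (Suc l) (h_of (\<lambda>_. 0)) f = 0"
    unfolding sch_def ldet_def
    by (intro sum.neutral ballI mult_eq_0_iff[THEN iffD2] disjI2 prod_zero bexI[of _ 0]) (auto simp: h)
  then show ?thesis by simp
qed

lemma h_of_build:
  assumes "length ks = length xs"
  shows "build ks xs (h_of p) = h_of (\<lambda>j. p j + (\<Sum>(k, x)\<leftarrow>zip ks xs. letter_power k x j))"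
  using assms
proof (induction ks xs rule: list_induct2)
  case Nil
  then show ?case by simp
next
  case (Cons k ks x xs)
  then show ?case by (simp add: h_of_addletter algebra_simps)
qed

lemma zip_replicate_sum:
  "(\<Sum>(k, x)\<leftarrow>zip (replicate (length xs) b) xs. letter_power k x j) = (\<Sum>x\<leftarrow>xs. letter_power b x j)"
  by (induction xs) auto

text \<open>For a finite alphabet the value is a sum over chains with non-negative terms. The power
  sums of such alphabets converge to the given ones, and each Schur value is a polynomial in
  finitely many power sums.\<close>

lemma sch_thoma_nonneg:
  assumes t: "thoma_like \<alpha> \<beta> \<gamma>" and f: "f \<in> Par n" "n \<le> l"
  shows "0 \<le> sch (Suc l) (h_of (thoma_psum \<alpha> \<beta> \<gamma>)) f"
proof -
  \<comment> \<open>The last N row letters \<gamma> / N imitate the exponential factor: their first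
    power sum is \<gamma>, the higher ones tend to 0.\<close>
  define P where "P = (\<lambda>N j. (\<Sum>i<N. letter_power True (\<alpha> i) j) + (\<Sum>i<N. letter_power False (\<beta> i) j)
     + real N * (\<gamma> / real N) ^ j)"
  define ks where "ks = (\<lambda>N. replicate N True @ replicate N False @ replicate N True)"
  define xs where "xs = (\<lambda>N. map \<alpha> [0..<N] @ map \<beta> [0..<N] @ replicate N (\<gamma> / real N))"
  have z: "(\<Sum>(k, x)\<leftarrow>zip (ks N) (xs N). letter_power k x j) = P N j" for N j
    using zip_replicate_sum[where xs="map \<alpha> [0..<N]" and b=True and j=j]
      zip_replicate_sum[where xs="map \<beta> [0..<N]" and b=False and j=j]
      zip_replicate_sum[where xs="replicate N (\<gamma> / real N)" and b=True and j=j]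
    by (simp add: ks_def xs_def P_def sum_list_replicate o_def
        interv_sum_list_conv_sum_set_nat atLeast0LessThan letter_power_def[of True "\<gamma> / real N"])
  have lim: "(\<lambda>N. P N k) \<longlonglongrightarrow> thoma_psum \<alpha> \<beta> \<gamma> k" if k: "k \<ge> 1" for k
  proof -
    have "(\<lambda>N. real N * (\<gamma> / real N) ^ k) \<longlonglongrightarrow> (if k = 1 then \<gamma> else 0)"
    proof (cases "k = 1")
      case True
      have "\<forall>\<^sub>F N in sequentially. \<gamma> = real N * (\<gamma> / real N) ^ k"
        using eventually_gt_at_top[of 0] by eventually_elim (use True in auto)
      then show ?thesis using True by (auto intro: Lim_transform_eventually[OF tendsto_const])
    next
      case False
      then obtain j where j: "k = Suc (Suc j)" using k by (metis One_nat_def Suc_le_D le_antisym not_less_eq_eq)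
      have "(\<lambda>N. \<gamma> * (\<gamma> / real N) ^ Suc j) \<longlonglongrightarrow> \<gamma> * 0 ^ Suc j"
        by (intro tendsto_mult tendsto_const tendsto_power lim_const_over_n)
      moreover have "\<forall>\<^sub>F N in sequentially. \<gamma> * (\<gamma> / real N) ^ Suc j = real N * (\<gamma> / real N) ^ k"
        using eventually_gt_at_top[of 0] by eventually_elim (simp add: j)
      ultimately show ?thesis using False by (auto intro: Lim_transform_eventually)
    qed
    then have "(\<lambda>N. ((\<Sum>i<N. letter_power True (\<alpha> i) k) + (\<Sum>i<N. letter_power False (\<beta> i) k)
        + (if k = 1 then \<gamma> else 0)) - (if k = 1 then \<gamma> else 0) + real N * (\<gamma> / real N) ^ k)
        \<longlonglongrightarrow> thoma_psum \<alpha> \<beta> \<gamma> k - (if k = 1 then \<gamma> else 0) + (if k = 1 then \<gamma> else 0)"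
      by (intro tendsto_add tendsto_diff tendsto_const power_sum_parts[OF t k])
    then show ?thesis unfolding P_def by (simp only: add_diff_cancel_right' diff_add_cancel)
  qed
  have "(\<lambda>N. sch (Suc l) (h_of (P N)) f) \<longlonglongrightarrow> sch (Suc l) (h_of (thoma_psum \<alpha> \<beta> \<gamma>)) f"
    by (rule tendsto_sch) (auto simp: h_of_def intro: tendsto_h_rec lim)
  moreover have "0 \<le> sch (Suc l) (h_of (P N)) f" for N
  proof -
    have len: "length (ks N) = length (xs N)" by (simp add: ks_def xs_def)
    have "h_of (P N) = build (ks N) (xs N) (h_of (\<lambda>_. 0))"
      unfolding h_of_build[OF len] z by simp
    moreover have "0 \<le> x" if "x \<in> set (xs N)" for x
      using that t by (auto simp: xs_def thoma_like_def)
    ultimately show ?thesis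
      using sch_build_nonneg[OF hseq_h_of len f, of "\<lambda>_. 0"] sch_h_of_0_nonneg by simp
  qed
  ultimately show ?thesis using LIMSEQ_le_const by blast
qed

section \<open>The generating function\<close>

lemma has_fps_expansion_higher_deriv:
  fixes f :: "real \<Rightarrow> real"
  assumes "f has_fps_expansion F"
  shows "(deriv ^^ n) f 0 = fact n * fps_nth F n"
  using assms
proof (induction n arbitrary: f F)
  case 0
  then have "eval_fps F 0 = f 0"
    by (auto simp: has_fps_expansion_def dest: eventually_nhds_x_imp_x)
  then show ?case by (simp add: eval_fps_at_0)
next
  case (Suc n)
  have "(deriv ^^ Suc n) f 0 = (deriv ^^ n) (deriv f) 0" by (simp add: funpow_swap1)
  also have "\<dots> = fact n * fps_nth (fps_deriv F) n"
    by (rule Suc.IH) (rule has_fps_expansion_deriv[OF Suc.prems])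
  finally show ?case by simp
qed

lemma h_fps_h_of_nth: "fps_nth (h_fps (h_of p)) n = h_rec p n"
  by (simp add: h_fps_def h_of_def)

lemma h_fps_h_of_summable:
  assumes "\<And>k. k \<ge> 1 \<Longrightarrow> \<bar>p k\<bar> \<le> c ^ k" "c > 0" "c * \<bar>z\<bar> < 1"
  shows "norm (h_rec p n * z ^ n) \<le> (c * \<bar>z\<bar>) ^ n" "ereal (norm z) < fps_conv_radius (h_fps (h_of p))"
proof -
  have b: "norm (h_rec p n * z ^ n) \<le> (c * \<bar>z\<bar>) ^ n" if "c * \<bar>z\<bar> < 1" for n z
    using h_rec_bound[OF assms(1), of n] by (simp add: norm_mult norm_power abs_mult power_abs power_mult_distrib mult_right_mono)
  then show "norm (h_rec p n * z ^ n) \<le> (c * \<bar>z\<bar>) ^ n" using assms(3) by simp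
  obtain w where w: "\<bar>z\<bar> < w" "w < 1 / c" using dense[of "\<bar>z\<bar>" "1 / c"] assms by (auto simp: field_simps)
  then have cweight: "c * \<bar>w\<bar> < 1" using assms(2) by (simp add: field_simps)
  have "summable (\<lambda>n. h_rec p n * w ^ n)"
  proof (rule summable_comparison_test')
    show "summable (\<lambda>n. (c * \<bar>w\<bar>) ^ n)" by (rule summable_geometric) (use assms(2) cweight in simp)
    show "norm (h_rec p n * w ^ n) \<le> (c * \<bar>w\<bar>) ^ n" if "n \<ge> 0" for n by (rule b[OF cweight])
  qed
  then have "ereal (norm w) \<le> fps_conv_radius (h_fps (h_of p))"
    unfolding fps_conv_radius_def by (intro conv_radius_geI) (simp add: h_fps_h_of_nth)
  moreover have "ereal (norm z) < ereal (norm w)" using w by simp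
  ultimately show "ereal (norm z) < fps_conv_radius (h_fps (h_of p))" by (rule less_le_trans[rotated])
qed

lemma h_rec_exp: "h_rec (\<lambda>k. if k = 1 then c else 0) n = c ^ n / fact n"
proof (induction n)
  case (Suc n)
  have "(\<Sum>k\<in>{1..Suc n}. (if k = 1 then c else 0) * h_rec (\<lambda>k. if k = 1 then c else 0) (Suc n - k)) =
     (\<Sum>k\<in>{1..Suc n}. if k = 1 then c * h_rec (\<lambda>k. if k = 1 then c else 0) n else 0)"
    by (intro sum.cong refl) auto
  then show ?case using Suc by (simp add: h_rec_step[of "Suc n"])
qed simp

text \<open>For finitely many letters the generating function is a product obtained letter by
  letter, with the exponential as the starting point. The limit is taken under the series sign by
  dominated convergence, which identifies the series with the infinite product near 0.\<close>

lemma thoma_gf_expansion: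
  assumes t: "thoma_like \<alpha> \<beta> \<gamma>"
  shows "thoma_gf \<alpha> \<beta> \<gamma> has_fps_expansion h_fps (h_of (thoma_psum \<alpha> \<beta> \<gamma>))"
proof -
  \<comment> \<open>The added 1 keeps c positive even if all parameters vanish. For c * |z| < 1 the
    series converge and no factor 1 - \<alpha> i * z is 0.\<close>
  define c where "c = suminf \<alpha> + suminf \<beta> + \<gamma> + 1"
  define P where "P = (\<lambda>N k. (\<Sum>i<N. letter_power True (\<alpha> i) k) + (\<Sum>i<N. letter_power False (\<beta> i) k) + (if k = 1 then \<gamma> else 0))"
  define Y where "Y = (\<lambda>N z. eval_fps (h_fps (h_of (P N))) z)"
  define y where "y = eval_fps (h_fps (h_of (thoma_psum \<alpha> \<beta> \<gamma>)))"
  have nn: "0 \<le> \<alpha> i" "0 \<le> \<beta> i" "0 \<le> \<gamma>" "summable \<alpha>" "summable \<beta>" for i using t by (auto simp: thoma_like_def)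
  have sa: "0 \<le> suminf \<alpha>" "0 \<le> suminf \<beta>" using nn by (auto intro: suminf_nonneg)
  have c1: "c \<ge> 1" using sa nn(3) by (simp add: c_def)
  have ac: "\<alpha> i \<le> c" "\<beta> i \<le> c" for i
    using sum_le_suminf[OF nn(4), of "{i}"] sum_le_suminf[OF nn(5), of "{i}"] nn sa by (auto simp: c_def)
  have bound: "\<bar>P N k\<bar> \<le> c ^ k" if k: "k \<ge> 1" for N k
  proof -
    have part: "(\<Sum>i<N. a i ^ k) \<le> suminf a * c ^ (k - 1)"
      if a: "\<And>i. 0 \<le> a i" "summable a" "suminf a \<le> c" for a
    proof -
      have s0: "0 \<le> suminf a" using a by (intro suminf_nonneg) auto
      have "(\<Sum>i<N. a i ^ k) \<le> (\<Sum>i<N. a i) * suminf a ^ (k - 1)"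
        using a k by (intro summable_power_nonneg) auto
      also have "\<dots> \<le> suminf a * c ^ (k - 1)"
        using a s0 sum_le_suminf[OF a(2), of "{..<N}"] by (intro mult_mono power_mono sum_nonneg) auto
      finally show ?thesis .
    qed
    have "\<bar>P N k\<bar> \<le> (\<Sum>i<N. \<alpha> i ^ k) + (\<Sum>i<N. \<beta> i ^ k) + (if k = 1 then \<gamma> else 0)"
    proof -
      have "\<bar>\<Sum>i<N. letter_power True (\<alpha> i) k\<bar> \<le> (\<Sum>i<N. \<alpha> i ^ k)"
        by (rule order_trans[OF sum_abs]) (simp add: letter_power_def power_abs nn)
      moreover have "\<bar>\<Sum>i<N. letter_power False (\<beta> i) k\<bar> \<le> (\<Sum>i<N. \<beta> i ^ k)"
        by (rule order_trans[OF sum_abs]) (simp add: letter_power_def power_abs nn)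
      ultimately show ?thesis using nn(3) unfolding P_def by (smt (verit))
    qed
    also have "\<dots> \<le> suminf \<alpha> * c ^ (k - 1) + suminf \<beta> * c ^ (k - 1) + \<gamma> * c ^ (k - 1)"
      using nn sa by (intro add_mono part) (auto simp: c_def c1 intro: order_trans[OF _ c1])
    also have "\<dots> \<le> c * c ^ (k - 1)"
      unfolding distrib_right[symmetric] using c1 by (intro mult_right_mono) (auto simp: c_def)
    finally show ?thesis using k by (cases k) auto
  qed
  have lim: "(\<lambda>N. P N k) \<longlonglongrightarrow> thoma_psum \<alpha> \<beta> \<gamma> k" if "k \<ge> 1" for k
    unfolding P_def using power_sum_parts[OF t that] .
  have bound': "\<bar>thoma_psum \<alpha> \<beta> \<gamma> k\<bar> \<le> c ^ k" if "k \<ge> 1" for k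
    using tendsto_rabs[OF lim[OF that]] bound[OF that] by (intro LIMSEQ_le_const2) auto
  have c0: "c > 0" using c1 by simp
  have Ylim: "(\<lambda>N. Y N z) \<longlonglongrightarrow> y z" if z: "c * \<bar>z\<bar> < 1" for z
  proof -
    have "(\<lambda>N. \<Sum>n. h_rec (P N) n * z ^ n) \<longlonglongrightarrow> (\<Sum>n. h_rec (thoma_psum \<alpha> \<beta> \<gamma>) n * z ^ n)"
    proof (rule tannerys_theorem[THEN conjunct2, THEN conjunct2])
      show "(\<lambda>N. h_rec (P N) k * z ^ k) \<longlonglongrightarrow> h_rec (thoma_psum \<alpha> \<beta> \<gamma>) k * z ^ k" for k
        by (intro tendsto_mult tendsto_const tendsto_h_rec lim)
      show "\<forall>\<^sub>F (k, N) in sequentially \<times>\<^sub>F sequentially. norm (h_rec (P N) k * z ^ k) \<le> (c * \<bar>z\<bar>) ^ k"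
        using h_fps_h_of_summable(1)[OF bound c0 z] by (intro always_eventually) auto
      show "summable (\<lambda>k. (c * \<bar>z\<bar>) ^ k)" by (rule summable_geometric) (use c0 z in simp)
    qed simp
    then show ?thesis by (simp add: Y_def y_def eval_fps_def h_fps_h_of_nth)
  qed
  have Yprod: "Y N z = exp (\<gamma> * z) * (\<Prod>i<N. (1 + \<beta> i * z) / (1 - \<alpha> i * z))" if z: "c * \<bar>z\<bar> < 1" for N z
  proof (induction N)
    case 0
    have "h_fps (h_of (P 0)) = fps_exp \<gamma>"
      by (rule fps_ext) (simp add: h_fps_h_of_nth P_def h_rec_exp[unfolded One_nat_def])
    then show ?case by (simp add: Y_def)
  next
    case (Suc N)
    let ?F = "h_fps (h_of (P (Suc N)))" and ?G = "h_fps (h_of (P N))"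
    have "h_of (P (Suc N)) = addrow (\<alpha> N) (addcol (\<beta> N) (h_of (P N)))"
    proof -
      have "addletter True (\<alpha> N) (addletter False (\<beta> N) (h_of (P N))) = h_of (P (Suc N))"
        unfolding h_of_addletter by (rule arg_cong[of _ _ h_of]) (auto simp: P_def fun_eq_iff)
      then show ?thesis by (simp add: addletter_def)
    qed
    then have F: "?F * (1 + fps_const (- \<alpha> N) * fps_X) = ?G * (1 + fps_const (\<beta> N) * fps_X)"
      using h_fps_addrow[of "addcol (\<beta> N) (h_of (P N))" "\<alpha> N"] h_fps_addcol[OF hseq_h_of, of "\<beta> N" "P N"]
        hseq_addletter[OF hseq_h_of, of False "\<beta> N" "P N"] by (simp add: addletter_def)
    have lin: "fps_conv_radius (1 + fps_const a * fps_X :: real fps) = \<infinity>" "eval_fps (1 + fps_const a * fps_X) z = 1 + a * z" for a :: real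
    proof -
      have e: "1 + fps_const a * fps_X = fps_of_poly [:1, a:]" by (simp add: fps_of_poly_linear mult.commute)
      show "fps_conv_radius (1 + fps_const a * fps_X :: real fps) = \<infinity>" unfolding e by simp
      show "eval_fps (1 + fps_const a * fps_X) z = 1 + a * z" unfolding e by simp
    qed
    have "Y (Suc N) z * (1 - \<alpha> N * z) = eval_fps (?F * (1 + fps_const (- \<alpha> N) * fps_X)) z"
      using h_fps_h_of_summable(2)[OF bound c0 z] by (subst eval_fps_mult) (simp_all add: lin Y_def)
    also have "\<dots> = Y N z * (1 + \<beta> N * z)"
      unfolding F using h_fps_h_of_summable(2)[OF bound c0 z] by (subst eval_fps_mult) (simp_all add: lin Y_def)
    finally have 1: "Y (Suc N) z * (1 - \<alpha> N * z) = Y N z * (1 + \<beta> N * z)" .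
    have "\<bar>\<alpha> N * z\<bar> \<le> c * \<bar>z\<bar>" unfolding abs_mult using ac nn by (intro mult_right_mono) auto
    then have "1 - \<alpha> N * z \<noteq> 0" using z by (auto simp: abs_if split: if_splits)
    then have "Y (Suc N) z = Y N z * ((1 + \<beta> N * z) / (1 - \<alpha> N * z))" using 1 by (simp add: field_simps)
    then show ?case using Suc by (simp add: mult.assoc)
  qed
  have rad: "fps_conv_radius (h_fps (h_of (thoma_psum \<alpha> \<beta> \<gamma>))) > 0"
    using h_fps_h_of_summable(2)[OF bound' c0, of 0] by (simp add: zero_ereal_def)
  have y0: "y 0 = 1" by (simp add: y_def eval_fps_at_0 h_fps_h_of_nth)
  \<comment> \<open>The value of the infinite product is read off from its partial products only
    where their limit is non-zero, so a neighbourhood with y z > 0 is needed.\<close>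
  have "isCont y 0"
    using has_fps_expansion_imp_continuous[OF eval_fps_has_fps_expansion[OF rad], of UNIV] by (simp add: y_def)
  then have "(y \<longlongrightarrow> 1) (nhds 0)" using y0 by (simp add: isCont_def tendsto_nhds_iff)
  then have ev0: "\<forall>\<^sub>F z in nhds 0. y z > 0" by (rule order_tendstoD) simp
  have "((\<lambda>z. c * \<bar>z\<bar>) \<longlongrightarrow> c * \<bar>0\<bar>) (nhds (0::real))" by (intro tendsto_intros filterlim_ident)
  then have ev1: "\<forall>\<^sub>F z in nhds 0. c * \<bar>z\<bar> < (1::real)" by (rule order_tendstoD) simp
  have "\<forall>\<^sub>F z in nhds 0. eval_fps (h_fps (h_of (thoma_psum \<alpha> \<beta> \<gamma>))) z = thoma_gf \<alpha> \<beta> \<gamma> z"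
    using ev0 ev1
  proof eventually_elim
    case (elim z)
    have lim1: "(\<lambda>N. exp (- \<gamma> * z) * Y N z) \<longlonglongrightarrow> exp (- \<gamma> * z) * y z"
      by (intro tendsto_mult tendsto_const Ylim elim)
    have e1: "exp (- \<gamma> * z) * Y N z = (\<Prod>i<N. (1 + \<beta> i * z) / (1 - \<alpha> i * z))" for N
      unfolding Yprod[OF elim(2)] by (simp add: exp_minus field_simps)
    from lim1[unfolded e1] have "(\<Prod>i. (1 + \<beta> i * z) / (1 - \<alpha> i * z)) = exp (- \<gamma> * z) * y z"
      by (rule prodinf_eq_prod_lim') (use elim in simp)
    then show ?case by (simp add: thoma_gf_def y_def exp_minus field_simps)
  qed
  then show ?thesis using rad by (simp add: has_fps_expansion_def)
qed

lemma thoma_h_eq: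
  assumes "thoma_like \<alpha> \<beta> \<gamma>"
  shows "thoma_h \<alpha> \<beta> \<gamma> = h_of (thoma_psum \<alpha> \<beta> \<gamma>)"
proof
  fix k show "thoma_h \<alpha> \<beta> \<gamma> k = h_of (thoma_psum \<alpha> \<beta> \<gamma>) k"
    using has_fps_expansion_higher_deriv[OF thoma_gf_expansion[OF assms], of "nat k"]
    by (simp add: thoma_h_def h_of_def h_fps_h_of_nth)
qed

section \<open>Young diagrams as functions\<close>

definition shape :: "nat list \<Rightarrow> nat \<Rightarrow> nat" where
  "shape lam i = (if i < length lam then lam ! i else 0)"

definition colen :: "(nat \<Rightarrow> nat) \<Rightarrow> nat \<Rightarrow> nat" where
  "colen f j = card {i. j < f i}"

lemma young_length: "lam \<in> young n \<Longrightarrow> length lam \<le> n"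
proof -
  assume lam: "lam \<in> young n"
  have "0 \<notin> set xs \<Longrightarrow> length xs \<le> sum_list xs" for xs :: "nat list"
    by (induction xs) auto
  then show ?thesis using lam by (auto simp: young_def)
qed

lemma shape_Par:
  assumes "lam \<in> young n"
  shows "shape lam \<in> Par n"
proof (rule ParI[of _ "length lam"])
  have s: "sorted_wrt (\<ge>) lam" using assms by (simp add: young_def)
  show "shape lam (Suc i) \<le> shape lam i" for i
    using sorted_wrt_nth_less[OF s, of i "Suc i"] by (auto simp: shape_def)
  show "(\<Sum>i<length lam. shape lam i) = n"
    using assms by (simp add: shape_def young_def sum_list_sum_nth atLeast0LessThan)
qed (simp add: shape_def)

lemma shape_neq_0_iff:
  assumes "xs \<in> young n"
  shows "shape xs i \<noteq> 0 \<longleftrightarrow> i < length xs"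
proof (cases "i < length xs")
  case True
  then have m: "xs ! i \<in> set xs" by simp
  have "0 \<notin> set xs" using assms unfolding young_def by blast
  then have "xs ! i \<noteq> 0" using m by metis
  then show ?thesis using True by (simp add: shape_def)
qed (simp add: shape_def)

lemma shape_inj: "inj_on shape (young n)"
proof (rule inj_onI)
  fix lam mu assume lm: "lam \<in> young n" "mu \<in> young n" "shape lam = shape mu"
  have "i < length lam \<longleftrightarrow> i < length mu" for i
    using shape_neq_0_iff[OF lm(1), of i] shape_neq_0_iff[OF lm(2), of i] unfolding lm(3) by blast
  then have l: "length lam = length mu" by (metis nat_neq_iff)
  show "lam = mu"
  proof (rule nth_equalityI[OF l])
    fix i assume i: "i < length lam"
    have "shape lam i = shape mu i" unfolding lm(3) ..
    then show "lam ! i = mu ! i" using i l by (simp add: shape_def)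
  qed
qed

text \<open>This is conjugation of partitions: i is below the length of column j exactly when j is
  below the length of row i.\<close>

lemma Par_init_segment:
  assumes f: "f \<in> Par n"
  shows "{i. j < f i} = {..<colen f j}"
proof -
  have fin: "finite {i. j < f i}"
    by (rule finite_subset[of _ "{..<n}"]) (use Par_zero[OF f] in \<open>auto, metis leI not_less_zero\<close>)
  have down: "j < f i'" if "j < f i" "i' \<le> i" for i i'
    using antimono_nat[of f i' i] Par_mono[OF f] that by (auto intro: less_le_trans)
  have "\<exists>m. {i. j < f i} = {..<m}"
  proof (cases "{i. j < f i} = {}")
    case True then show ?thesis by (auto intro: exI[of _ 0])
  next
    case False
    let ?m = "Max {i. j < f i}"
    have "i \<in> {i. j < f i} \<longleftrightarrow> i < Suc ?m" for i
      using Max_in[OF fin False] Max_ge[OF fin, of i] down[of ?m i] unfolding less_Suc_eq_le by blast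
    then have "{i. j < f i} = {..<Suc ?m}" by blast
    then show ?thesis by blast
  qed
  then obtain m where "{i. j < f i} = {..<m}" by blast
  then show ?thesis by (simp add: colen_def)
qed

lemma shape_surj:
  assumes f: "f \<in> Par n"
  shows "f \<in> shape ` young n"
proof -
  let ?k = "colen f 0"
  let ?lam = "map f [0..<?k]"
  have seg: "0 < f i \<longleftrightarrow> i < ?k" for i using Par_init_segment[OF f, of 0] by auto
  have z: "f i = 0" if "?k \<le> i" for i using seg[of i] that by simp
  have "sum_list ?lam = (\<Sum>i<?k. f i)"
    by (simp add: interv_sum_list_conv_sum_set_nat atLeast0LessThan)
  also have "\<dots> = n" using psize_eq[of ?k f] z psize_Par[OF f] by simp
  finally have 1: "sum_list ?lam = n" .
  have 2: "sorted_wrt (\<ge>) ?lam"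
    unfolding sorted_wrt_iff_nth_less
  proof (intro allI impI)
    fix i j assume "i < j" "j < length ?lam"
    then show "?lam ! j \<le> ?lam ! i" using antimono_nat[of f i j, OF Par_mono[OF f]] by simp
  qed
  have 3: "0 \<notin> set ?lam"
  proof
    assume "0 \<in> set ?lam"
    then obtain i where "i < ?k" "f i = 0" by auto
    then show False using seg[of i] by simp
  qed
  have "shape ?lam = f" by (auto simp: shape_def fun_eq_iff z)
  moreover have "?lam \<in> young n" using 1 2 3 by (simp add: young_def)
  ultimately show ?thesis by (metis imageI)
qed

lemma shape_bij: "bij_betw shape (young n) (Par n)"
  unfolding bij_betw_def using shape_inj shape_Par shape_surj by blast

lemma dimY_shape: "lam \<in> young n \<Longrightarrow> dimY lam = fdim n (shape lam)"
proof -
  assume lam: "lam \<in> young n"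
  have "cells lam = fcells (shape lam)" by (auto simp: cells_def fcells_def shape_def split: if_splits)
  then show ?thesis using lam by (simp add: dimY_def fdim_def syt_def fsyt_def young_def)
qed

lemma thoma_s_shape:
  assumes t: "thoma_like \<alpha> \<beta> \<gamma>" and lam: "lam \<in> young n"
  shows "thoma_s \<alpha> \<beta> \<gamma> lam = sch (Suc n) (h_of (thoma_psum \<alpha> \<beta> \<gamma>)) (shape lam)"
proof -
  have "thoma_s \<alpha> \<beta> \<gamma> lam = sch (length lam) (h_of (thoma_psum \<alpha> \<beta> \<gamma>)) (shape lam)"
    unfolding thoma_s_def sch_def ldet_def thoma_h_eq[OF t]
    by (intro sum.cong refl arg_cong2[where f="(*)"] prod.cong) (auto simp: shape_def)
  also have "\<dots> = sch (Suc n) (h_of (thoma_psum \<alpha> \<beta> \<gamma>)) (shape lam)"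
    by (rule sch_pad_le[symmetric, OF hseq_h_of]) (use young_length[OF lam] in \<open>auto simp: shape_def\<close>)
  finally show ?thesis .
qed

lemma row_len_shape: "row_len lam (Suc k) = shape lam k"
  by (simp add: row_len_def shape_def Suc_le_eq)

lemma col_len_shape: "col_len lam (Suc k) = colen (shape lam) k"
proof -
  have "col_len lam (Suc k) = card {i. i < length lam \<and> Suc k \<le> lam ! i}"
    unfolding col_len_def by (rule length_filter_conv_card)
  also have "{i. i < length lam \<and> Suc k \<le> lam ! i} = {i. k < shape lam i}"
    unfolding shape_def Suc_le_eq by force
  finally show ?thesis by (simp add: colen_def)
qed

lemma sum_colen:
  assumes f: "f \<in> Par n" and L: "n \<le> L"
  shows "(\<Sum>j<k. colen f j) = (\<Sum>i<L. min (f i) k)"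
proof -
  have c: "colen f j = (\<Sum>i<L. if j < f i then 1 else 0)" for j
  proof -
    have "{i. j < f i} = {i \<in> {..<L}. j < f i}"
    proof -
      have "i < L" if "j < f i" for i
      proof (rule ccontr)
        assume "\<not> i < L"
        then have "f i = 0" using Par_zero[OF f, of i] L by simp
        then show False using that by simp
      qed
      then show ?thesis by blast
    qed
    moreover have "(\<Sum>i<L. if j < f i then 1 else 0) = card {i \<in> {..<L}. j < f i}"
      by (subst sum.inter_filter[symmetric]) simp_all
    ultimately show ?thesis unfolding colen_def by simp
  qed
  have "(\<Sum>j<k. colen f j) = (\<Sum>i<L. \<Sum>j<k. if j < f i then 1 else 0)"
    unfolding c by (rule sum.swap)
  also have "\<dots> = (\<Sum>i<L. min (f i) k)"
  proof (rule sum.cong[OF refl])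
    fix i
    have "{..<k} \<inter> {j. j < f i} = {..<min (f i) k}" by auto
    then show "(\<Sum>j<k. if j < f i then 1 else 0) = min (f i) k" by (simp add: sum.If_cases)
  qed
  finally show ?thesis .
qed

section \<open>The sum of squared contents bounded below by cubes of rows and columns\<close>

lemma sum_squares_cubic: "(max 0 (real q - 1)) ^ 3 \<le> 3 * (\<Sum>c<q. (real c)\<^sup>2)"
proof (cases q)
  case (Suc p)
  have e: "6 * (\<Sum>c<Suc p. (real c)\<^sup>2) = 2 * real p ^ 3 + 3 * real p ^ 2 + real p" for p
    by (induction p) (simp_all add: algebra_simps power2_eq_square power3_eq_cube)
  have "2 * real p ^ 3 \<le> 6 * (\<Sum>c<Suc p. (real c)\<^sup>2)" unfolding e by simp
  moreover have "max 0 (real q - 1) = real p" using Suc by simp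
  ultimately show ?thesis using Suc by simp
qed simp

text \<open>The right-hand side is the tangent of the cube at a. The positive part extends the
  inequality to negative x, which occurs for rows that do not reach beyond the diagonal.\<close>

lemma cubic_tangent: "(max 0 x) ^ 3 \<ge> 3 * a\<^sup>2 * x - 2 * a ^ 3" if "a \<ge> 0" for a x :: real
proof (cases "x \<ge> 0")
  case True
  have "x ^ 3 - 3 * a\<^sup>2 * x + 2 * a ^ 3 = (x - a)\<^sup>2 * (x + 2 * a)"
    by (simp add: algebra_simps power2_eq_square power3_eq_cube)
  also have "\<dots> \<ge> 0" using True that by simp
  finally show ?thesis using True by simp
next
  case False
  have "a\<^sup>2 * x \<le> 0" using False by (simp add: mult_nonneg_nonpos)
  then have "3 * a\<^sup>2 * x \<le> 0" by (simp only: mult.assoc)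
  moreover have "0 \<le> a ^ 3" using that by simp
  moreover have "(max 0 x) ^ 3 = 0" using False by simp
  ultimately show ?thesis by linarith
qed

text \<open>Cells on or to the right of the diagonal are summed along rows, the others along
  columns. The summand c = 0 of a column belongs to its diagonal cell and contributes nothing;
  truncated subtraction empties the sums of rows and columns that do not reach the diagonal.\<close>

lemma content_sq_split:
  assumes f: "f \<in> Par n" and L: "n \<le> L"
  shows "real_of_int (ycontent_sq L f) = (\<Sum>i<L. \<Sum>c<f i - i. (real c)\<^sup>2) + (\<Sum>j<L. \<Sum>c<colen f j - j. (real c)\<^sup>2)"
proof -
  have fL: "f i \<le> L" for i using Par_le[OF f, of i] L by simp
  have colL: "i < colen f j \<longleftrightarrow> j < f i" for i j using Par_init_segment[OF f, of j] by auto
  have cL: "colen f j \<le> L" for j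
  proof (rule ccontr)
    assume "\<not> colen f j \<le> L"
    then have "j < f L" using colL[of L j] by simp
    then show False using Par_zero[OF f L] by simp
  qed
  have xL: "i < L" if "j < f i" for i j
    using cL[of j] colL[of i j] that by linarith
  have row: "(\<Sum>j<L. if i \<le> j \<and> j < f i then (real j - real i)\<^sup>2 else 0) = (\<Sum>c<f i - i. (real c)\<^sup>2)" for i
  proof -
    have "(\<Sum>j<L. if i \<le> j \<and> j < f i then (real j - real i)\<^sup>2 else 0) = (\<Sum>j\<in>{i..<f i}. (real j - real i)\<^sup>2)"
      by (intro sum.mono_neutral_cong_right) (use fL[of i] in auto)
    also have "\<dots> = (\<Sum>c<f i - i. (real c)\<^sup>2)"
      by (rule sum.reindex_bij_witness[of _ "\<lambda>c. c + i" "\<lambda>j. j - i"]) (auto simp: of_nat_diff)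
    finally show ?thesis .
  qed
  have col: "(\<Sum>i<L. if j < i \<and> j < f i then (real j - real i)\<^sup>2 else 0) = (\<Sum>c<colen f j - j. (real c)\<^sup>2)" for j
  proof -
    have "(\<Sum>i<L. if j < i \<and> j < f i then (real j - real i)\<^sup>2 else 0) = (\<Sum>i\<in>{j..<colen f j}. (real j - real i)\<^sup>2)"
      by (intro sum.mono_neutral_cong_right) (auto simp: colL xL)
    also have "\<dots> = (\<Sum>c<colen f j - j. (real c)\<^sup>2)"
      by (rule sum.reindex_bij_witness[of _ "\<lambda>c. c + j" "\<lambda>i. i - j"]) (auto simp: of_nat_diff power2_eq_square algebra_simps)
    finally show ?thesis .
  qed
  have "real_of_int (ycontent_sq L f) = (\<Sum>i<L. \<Sum>j<L. if j < f i then (real j - real i)\<^sup>2 else 0)"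
    unfolding ycontent_sq_def of_int_sum
  proof (rule sum.cong[OF refl])
    fix i
    have "(\<Sum>j<f i. real_of_int ((int j - int i)\<^sup>2)) = (\<Sum>j<f i. (real j - real i)\<^sup>2)" by simp
    also have "\<dots> = (\<Sum>j<L. if j < f i then (real j - real i)\<^sup>2 else 0)"
      by (intro sum.mono_neutral_cong_left) (use fL[of i] in auto)
    finally show "(\<Sum>j<f i. real_of_int ((int j - int i)\<^sup>2)) = (\<Sum>j<L. if j < f i then (real j - real i)\<^sup>2 else 0)" .
  qed
  also have "\<dots> = (\<Sum>i<L. \<Sum>j<L. (if i \<le> j \<and> j < f i then (real j - real i)\<^sup>2 else 0) +
      (if j < i \<and> j < f i then (real j - real i)\<^sup>2 else 0))"
    by (intro sum.cong refl) auto
  also have "\<dots> = (\<Sum>i<L. \<Sum>j<L. if i \<le> j \<and> j < f i then (real j - real i)\<^sup>2 else 0) +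
      (\<Sum>i<L. \<Sum>j<L. if j < i \<and> j < f i then (real j - real i)\<^sup>2 else 0)"
    by (simp only: sum.distrib)
  also have "(\<Sum>i<L. \<Sum>j<L. if j < i \<and> j < f i then (real j - real i)\<^sup>2 else 0) =
      (\<Sum>j<L. \<Sum>i<L. if j < i \<and> j < f i then (real j - real i)\<^sup>2 else 0)" by (rule sum.swap)
  finally show ?thesis by (simp only: row col)
qed

text \<open>A bound linear in the row and column lengths, so that expectations can be taken. The
  number k of linearised rows is independent of the size of the diagram: beyond it the tangents at 0
  cost nothing, and before it k may grow to exhaust \<open>p 3\<close>.\<close>

lemma content_sq_lower:
  fixes a b :: "nat \<Rightarrow> real"
  assumes f: "f \<in> Par n" and L: "n \<le> L" and ab: "\<And>i. 0 \<le> a i" "\<And>i. 0 \<le> b i"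
  shows "3 * real_of_int (ycontent_sq L f) \<ge>
    (\<Sum>i<k. 3 * (a i)\<^sup>2 * (real (f i) - real i - 1) - 2 * a i ^ 3) +
    (\<Sum>j<k. 3 * (b j)\<^sup>2 * (real (colen f j) - real j - 1) - 2 * b j ^ 3)"
proof -
  have c0: "colen f j - j = 0" if "L \<le> j" for j
  proof -
    have "f i \<le> j" for i using Par_le[OF f, of i] L that by linarith
    then have "{i. j < f i} = {}" by (auto simp: not_less)
    then show ?thesis by (simp add: colen_def)
  qed
  have shape: "(\<Sum>i<k. 3 * (a i)\<^sup>2 * (real (g i) - real i - 1) - 2 * a i ^ 3) \<le> 3 * (\<Sum>i<L. \<Sum>c<g i - i. (real c)\<^sup>2)"
    if g: "\<And>i. L \<le> i \<Longrightarrow> g i - i = 0" and a: "\<And>i. 0 \<le> a i" for g :: "nat \<Rightarrow> nat" and a :: "nat \<Rightarrow> real"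
  proof -
    have "3 * (a i)\<^sup>2 * (real (g i) - real i - 1) - 2 * a i ^ 3 \<le> 3 * (\<Sum>c<g i - i. (real c)\<^sup>2)" for i
    proof -
      have "3 * (a i)\<^sup>2 * (real (g i) - real i - 1) - 2 * a i ^ 3 \<le> (max 0 (real (g i) - real i - 1)) ^ 3"
        by (rule cubic_tangent[OF a])
      also have "max 0 (real (g i) - real i - 1) = max 0 (real (g i - i) - 1)"
        by (cases "i \<le> g i") (auto simp: of_nat_diff)
      also have "(max 0 (real (g i - i) - 1)) ^ 3 \<le> 3 * (\<Sum>c<g i - i. (real c)\<^sup>2)"
        by (rule sum_squares_cubic)
      finally show ?thesis .
    qed
    then have "(\<Sum>i<k. 3 * (a i)\<^sup>2 * (real (g i) - real i - 1) - 2 * a i ^ 3) \<le> (\<Sum>i<k. 3 * (\<Sum>c<g i - i. (real c)\<^sup>2))"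
      by (rule sum_mono)
    also have "\<dots> \<le> (\<Sum>i<max k L. 3 * (\<Sum>c<g i - i. (real c)\<^sup>2))"
      by (intro sum_mono2) (auto intro: sum_nonneg)
    also have "\<dots> = (\<Sum>i<L. 3 * (\<Sum>c<g i - i. (real c)\<^sup>2))"
      by (intro sum.mono_neutral_right) (use g in auto)
    finally show ?thesis by (simp add: sum_distrib_left)
  qed
  show ?thesis unfolding content_sq_split[OF f L] distrib_left
    by (intro add_mono shape ab c0) (use Par_zero[OF f] L in auto)
qed

text \<open>After summation by parts every term is non-negative, since the coefficients decrease and
  the partial sums of d have a sign; a single term is kept.\<close>

lemma abel_lower:
  fixes a d :: "nat \<Rightarrow> real"
  assumes a: "\<And>i. 0 \<le> a i" "\<And>i. a (Suc i) \<le> a i" and D: "\<And>k. 0 \<le> (\<Sum>i<k. d i)" and k: "k < M"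
  shows "(a k - a (Suc k)) * (\<Sum>i<Suc k. d i) \<le> (\<Sum>i<Suc M. a i * d i)"
proof -
  have e: "(\<Sum>i<Suc M. a i * d i) = (\<Sum>k<M. (a k - a (Suc k)) * (\<Sum>i<Suc k. d i)) + a M * (\<Sum>i<Suc M. d i)"
  proof (induction M)
    case (Suc M)
    show ?case
      unfolding sum.lessThan_Suc[of "\<lambda>i. a i * d i" "Suc M"] Suc.IH sum.lessThan_Suc[of d "Suc M"]
        sum.lessThan_Suc[of "\<lambda>k. (a k - a (Suc k)) * (\<Sum>i<Suc k. d i)" M]
      by (simp add: left_diff_distrib distrib_left del: sum.lessThan_Suc)
  qed (simp add: left_diff_distrib)
  have "(a k - a (Suc k)) * (\<Sum>i<Suc k. d i) \<le> (\<Sum>k<M. (a k - a (Suc k)) * (\<Sum>i<Suc k. d i))"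
  proof (rule member_le_sum[where f="\<lambda>k. (a k - a (Suc k)) * (\<Sum>i<Suc k. d i)"])
    show "0 \<le> (a x - a (Suc x)) * (\<Sum>i<Suc x. d i)" for x
      by (rule mult_nonneg_nonneg) (simp add: a(2), rule D)
  qed (use k in auto)
  moreover have "0 \<le> a M * (\<Sum>i<Suc M. d i)" using a D by (intro mult_nonneg_nonneg)
  ultimately show ?thesis unfolding e by linarith
qed

section \<open>Coupling with letter counts\<close>

definition chainsp :: "bool list \<Rightarrow> nat \<Rightarrow> ((nat \<Rightarrow> nat) \<times> (nat \<Rightarrow> nat) list) set" where
  "chainsp ks n = Sigma (Par n) (schains ks)"

text \<open>The joint law of a diagram and a chain of strips in it. By \<open>sch_build\<close>,
  summing over the chains recovers the weight of the diagram for the specialisation with all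
  letters.\<close>

definition cweight :: "real list \<Rightarrow> (int \<Rightarrow> real) \<Rightarrow> nat \<Rightarrow> (nat \<Rightarrow> nat) \<times> (nat \<Rightarrow> nat) list \<Rightarrow> real" where
  "cweight xs h n = (\<lambda>(f, c). real (fdim n f) *
     ((\<Prod>i<length xs. (xs ! i) ^ (counts f c ! i)) * sch (Suc n) h (last (f # c))))"

lemma cweight_marginal:
  assumes "hseq h" "length ks = length xs"
  shows "(\<Sum>\<omega>\<in>chainsp ks n. cweight xs h n \<omega> * G (fst \<omega>)) =
    (\<Sum>f\<in>Par n. real (fdim n f) * sch (Suc n) (build ks xs h) f * G f)"
proof -
  have "(\<Sum>\<omega>\<in>chainsp ks n. cweight xs h n \<omega> * G (fst \<omega>)) =
      (\<Sum>f\<in>Par n. \<Sum>c\<in>schains ks f. cweight xs h n (f, c) * G f)"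
    unfolding chainsp_def by (subst sum.Sigma) (auto simp: finite_Par finite_schains intro!: sum.cong)
  also have "\<dots> = (\<Sum>f\<in>Par n. real (fdim n f) * sch (Suc n) (build ks xs h) f * G f)"
    by (intro sum.cong refl)
      (simp add: cweight_def sch_build[OF assms] sum_distrib_left sum_distrib_right mult.assoc)
  finally show ?thesis .
qed

text \<open>Multiplying letter i by t i in \<open>build\<close> inserts exactly the monomial in the
  counts, so the generating function is a total mass and \<open>dim_sum_sch\<close> evaluates it.
  Complex t are allowed in order to reach characteristic functions.\<close>

lemma cweight_genfun:
  fixes t :: "nat \<Rightarrow> complex"
  assumes h: "hseq h" and len: "length ks = length xs"
  shows "(\<Sum>\<omega>\<in>chainsp ks n. of_real (cweight xs h n \<omega>) * (\<Prod>i<length xs. t i ^ (counts (fst \<omega>) (snd \<omega>) ! i))) =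
    ((\<Sum>i<length xs. of_real (xs ! i) * t i) + of_real (h 1)) ^ n"
proof -
  let ?H = "\<lambda>k. complex_of_real (h k)"
  define ys where "ys = map (\<lambda>i. complex_of_real (xs ! i) * t i) [0..<length xs]"
  have H: "hseq ?H" using h by (simp add: hseq_def)
  have lenY: "length ks = length ys" using len by (simp add: ys_def)
  have sH: "sch L ?H g = of_real (sch L h g)" for L g
    by (simp add: sch_def ldet_def)
  have "(\<Sum>\<omega>\<in>chainsp ks n. of_real (cweight xs h n \<omega>) * (\<Prod>i<length xs. t i ^ (counts (fst \<omega>) (snd \<omega>) ! i))) =
      (\<Sum>f\<in>Par n. \<Sum>c\<in>schains ks f. of_real (cweight xs h n (f, c)) * (\<Prod>i<length xs. t i ^ (counts f c ! i)))"
    unfolding chainsp_def by (subst sum.Sigma) (auto simp: finite_Par finite_schains intro!: sum.cong)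
  also have "\<dots> = (\<Sum>f\<in>Par n. of_nat (fdim n f) * sch (Suc n) (build ks ys ?H) f)"
  proof (rule sum.cong[OF refl])
    fix f assume f: "f \<in> Par n"
    have "of_nat (fdim n f) * sch (Suc n) (build ks ys ?H) f =
       (\<Sum>c\<in>schains ks f. of_nat (fdim n f) * ((\<Prod>i<length ys. (ys ! i) ^ (counts f c ! i)) * sch (Suc n) ?H (last (f # c))))"
      unfolding sch_build[OF H lenY f order_refl] by (rule sum_distrib_left)
    also have "\<dots> = (\<Sum>c\<in>schains ks f. of_real (cweight xs h n (f, c)) * (\<Prod>i<length xs. t i ^ (counts f c ! i)))"
      unfolding sH by (intro sum.cong refl) (simp add: cweight_def ys_def power_mult_distrib prod.distrib)
    finally show "(\<Sum>c\<in>schains ks f. of_real (cweight xs h n (f, c)) * (\<Prod>i<length xs. t i ^ (counts f c ! i))) =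
       of_nat (fdim n f) * sch (Suc n) (build ks ys ?H) f" by simp
  qed
  also have "\<dots> = dim_sum n (sch (Suc n) (build ks ys ?H))" by (simp add: dim_sum_def)
  also have "\<dots> = build ks ys ?H 1 ^ n" by (rule dim_sum_sch[OF hseq_build[OF H] order_refl])
  also have "build ks ys ?H 1 = (\<Sum>i<length xs. of_real (xs ! i) * t i) + of_real (h 1)"
    unfolding build_1[OF H lenY]
    by (simp add: ys_def interv_sum_list_conv_sum_set_nat atLeast0LessThan)
  finally show ?thesis .
qed

lemma chainsp_counts_length: "\<omega> \<in> chainsp ks n \<Longrightarrow> length (counts (fst \<omega>) (snd \<omega>)) = length ks"
  by (auto simp: chainsp_def counts_length schains_length)

lemma cweight_genfun_const:
  fixes t :: real
  assumes h: "hseq h" and len: "length ks = length xs"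
  shows "(\<Sum>\<omega>\<in>chainsp ks n. cweight xs h n \<omega> * t ^ (sum_list (counts (fst \<omega>) (snd \<omega>)))) = (t * sum_list xs + h 1) ^ n"
proof -
  have p: "(\<Prod>i<length xs. (complex_of_real t) ^ (counts (fst \<omega>) (snd \<omega>) ! i)) =
      of_real (t ^ (sum_list (counts (fst \<omega>) (snd \<omega>))))" if "\<omega> \<in> chainsp ks n" for \<omega>
    using chainsp_counts_length[OF that] len by (simp add: sum_list_sum_nth atLeast0LessThan power_sum)
  have "of_real (\<Sum>\<omega>\<in>chainsp ks n. cweight xs h n \<omega> * t ^ (sum_list (counts (fst \<omega>) (snd \<omega>)))) =
      (\<Sum>\<omega>\<in>chainsp ks n. complex_of_real (cweight xs h n \<omega>) * (\<Prod>i<length xs. (complex_of_real t) ^ (counts (fst \<omega>) (snd \<omega>) ! i)))"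
    unfolding of_real_sum of_real_mult by (intro sum.cong refl arg_cong2[where f="(*)"] p[symmetric])
  also have "\<dots> = ((\<Sum>i<length xs. of_real (xs ! i) * of_real t) + of_real (h 1)) ^ n"
    by (rule cweight_genfun[OF h len])
  also have "\<dots> = of_real ((t * sum_list xs + h 1) ^ n)"
    by (simp add: sum_list_sum_nth atLeast0LessThan sum_distrib_left mult.commute)
  finally show ?thesis by (simp only: of_real_eq_iff)
qed

text \<open>The generating function with all variables equal to t is differentiated at t =
  1.\<close>

lemma cweight_mean:
  assumes h: "hseq h" and len: "length ks = length xs" and one: "sum_list xs + h 1 = 1"
  shows "(\<Sum>\<omega>\<in>chainsp ks n. cweight xs h n \<omega> * real (sum_list (counts (fst \<omega>) (snd \<omega>)))) = real n * sum_list xs"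
proof -
  let ?N = "\<lambda>\<omega>. sum_list (counts (fst \<omega>) (snd \<omega>))"
  have "((\<lambda>t. \<Sum>\<omega>\<in>chainsp ks n. cweight xs h n \<omega> * t ^ ?N \<omega>) has_real_derivative
      (\<Sum>\<omega>\<in>chainsp ks n. cweight xs h n \<omega> * (real (?N \<omega>) * 1 ^ (?N \<omega> - 1)))) (at 1)"
    by (intro derivative_eq_intros DERIV_sum DERIV_cmult refl | simp)+
  then have 1: "((\<lambda>t. (t * sum_list xs + h 1) ^ n) has_real_derivative
      (\<Sum>\<omega>\<in>chainsp ks n. cweight xs h n \<omega> * real (?N \<omega>))) (at 1)"
    unfolding cweight_genfun_const[OF h len] by simp
  have "((\<lambda>t. (t * sum_list xs + h 1) ^ n) has_real_derivative (real n * (1 * sum_list xs + h 1) ^ (n - 1) * sum_list xs)) (at 1)"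
    by (auto intro!: derivative_eq_intros)
  from DERIV_unique[OF 1 this] show ?thesis using one by simp
qed

lemma cweight_nonneg:
  assumes "\<omega> \<in> chainsp ks n" "\<And>i. i < length xs \<Longrightarrow> 0 \<le> xs ! i"
    "\<And>m g. g \<in> Par m \<Longrightarrow> m \<le> n \<Longrightarrow> 0 \<le> sch (Suc n) h g"
  shows "0 \<le> cweight xs h n \<omega>"
proof -
  obtain f c where w: "\<omega> = (f, c)" "f \<in> Par n" "c \<in> schains ks f" using assms(1) by (auto simp: chainsp_def)
  obtain m where "m \<le> n" "last (f # c) \<in> Par m" using schains_last[OF w(3,2)] by blast
  then show ?thesis using assms(2,3) unfolding w(1) cweight_def
    by (auto intro!: mult_nonneg_nonneg prod_nonneg simp del: last.simps)
qed

lemma sum_list_map_upt: "sum_list (map a [0..<k]) = (\<Sum>i<k. a i :: 'a::comm_monoid_add)"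
  by (simp add: interv_sum_list_conv_sum_set_nat atLeast0LessThan)

text \<open>The power sums split into those of the first letters and those of the tails; \<gamma>
  stays with the tails.\<close>

lemma thoma_split:
  assumes t: "thoma_like \<alpha> \<beta> \<gamma>"
  shows "h_of (thoma_psum \<alpha> \<beta> \<gamma>) = build (replicate k True @ replicate l False) (map \<alpha> [0..<k] @ map \<beta> [0..<l])
     (h_of (thoma_psum (\<lambda>i. \<alpha> (i + k)) (\<lambda>i. \<beta> (i + l)) \<gamma>))"
proof -
  let ?ks = "replicate k True @ replicate l False" and ?xs = "map \<alpha> [0..<k] @ map \<beta> [0..<l]"
  let ?p = "thoma_psum (\<lambda>i. \<alpha> (i + k)) (\<lambda>i. \<beta> (i + l)) \<gamma>"
  have len: "length ?ks = length ?xs" by simp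
  have z: "(\<Sum>(b, x)\<leftarrow>zip ?ks ?xs. letter_power b x j) = (\<Sum>i<k. \<alpha> i ^ j) - (\<Sum>i<l. (- \<beta> i) ^ j)" for j
    using zip_replicate_sum[where xs="map \<alpha> [0..<k]" and b=True and j=j]
      zip_replicate_sum[where xs="map \<beta> [0..<l]" and b=False and j=j]
    by (simp add: o_def sum_list_map_upt letter_power_def sum_negf)
  have "thoma_psum \<alpha> \<beta> \<gamma> j = ?p j + ((\<Sum>i<k. \<alpha> i ^ j) - (\<Sum>i<l. (- \<beta> i) ^ j))" if j: "j \<ge> 1" for j
  proof -
    have "summable (\<lambda>i. \<alpha> i ^ j)" using t j by (intro summable_power_nonneg) (auto simp: thoma_like_def)
    moreover have "summable (\<lambda>i. (- \<beta> i) ^ j)"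
    proof (rule summable_norm_cancel)
      have "norm ((- \<beta> i) ^ j) = \<beta> i ^ j" for i
        using t by (simp add: norm_power thoma_like_def)
      then show "summable (\<lambda>i. norm ((- \<beta> i) ^ j))"
        using t j summable_power_nonneg(1)[of \<beta> j] by (auto simp: thoma_like_def)
    qed
    ultimately show ?thesis unfolding thoma_psum_def
      using suminf_split_initial_segment[of "\<lambda>i. \<alpha> i ^ j" k] suminf_split_initial_segment[of "\<lambda>i. (- \<beta> i) ^ j" l]
      by simp
  qed
  then have "h_of (thoma_psum \<alpha> \<beta> \<gamma>) = h_of (\<lambda>j. ?p j + ((\<Sum>i<k. \<alpha> i ^ j) - (\<Sum>i<l. (- \<beta> i) ^ j)))"
    by (rule h_of_cong)
  then show ?thesis unfolding h_of_build[OF len] z .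
qed

lemma thoma_like_shift:
  "thoma_like \<alpha> \<beta> \<gamma> \<Longrightarrow> thoma_like (\<lambda>i. \<alpha> (i + k)) (\<lambda>i. \<beta> (i + l)) \<gamma>"
  by (auto simp: thoma_like_def)

text \<open>Row letters precede column letters, so the first k counts belong to rows and the
  remaining l to columns. The column inequality uses that the boxes in the first j columns can be
  counted row by row (\<open>sum_colen\<close>).\<close>

lemma counts_rows:
  assumes "\<omega> \<in> chainsp (replicate k True @ replicate l False) n"
  shows "j \<le> k \<Longrightarrow> (\<Sum>i<j. counts (fst \<omega>) (snd \<omega>) ! i) \<le> (\<Sum>i<j. fst \<omega> i)"
    and "j \<le> l \<Longrightarrow> (\<Sum>i<j. counts (fst \<omega>) (snd \<omega>) ! (k + i)) \<le> (\<Sum>i<j. colen (fst \<omega>) i)"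
proof -
  let ?ks = "replicate k True @ replicate l False" and ?c = "counts (fst \<omega>) (snd \<omega>)"
  have w: "fst \<omega> \<in> Par n" "snd \<omega> \<in> schains ?ks (fst \<omega>)" using assms by (auto simp: chainsp_def)
  have len: "length ?c = k + l" using chainsp_counts_length[OF assms] by simp
  obtain u v where uv: "?c = u @ v" "length u = k" "length v = l"
    using len by (metis append_take_drop_id length_drop length_take min_absorb2 le_add1 add_diff_cancel_left')
  have zT: "map snd (filter fst (zip (replicate (length u) True) u)) = u" for u :: "nat list"
    by (induction u) auto
  have zF: "map snd (filter fst (zip (replicate (length u) False) u)) = []" for u :: "nat list"
    by (induction u) auto
  have zT': "map snd (filter (\<lambda>p. \<not> fst p) (zip (replicate (length u) True) u)) = []" for u :: "nat list"
    by (induction u) auto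
  have zF': "map snd (filter (\<lambda>p. \<not> fst p) (zip (replicate (length u) False) u)) = u" for u :: "nat list"
    by (induction u) auto
  have r: "row_counts ?ks ?c = u"
    unfolding row_counts_def uv(1) using zT[of u] zF[of v] uv(2,3) by simp
  have c: "col_counts ?ks ?c = v"
    unfolding col_counts_def uv(1) using zT'[of u] zF'[of v] uv(2,3) by simp
  have st: "sum_list (take j u) = (\<Sum>i<j. u ! i)" if "j \<le> length u" for u :: "nat list"
    using that by (simp add: sum_list_sum_nth atLeast0LessThan min_absorb2)
  show "(\<Sum>i<j. ?c ! i) \<le> (\<Sum>i<j. fst \<omega> i)" if "j \<le> k"
  proof -
    have "(\<Sum>i<j. ?c ! i) = sum_list (take j u)"
      using that uv st[of u] by (simp add: nth_append)
    then show ?thesis using chain_rows[OF w(2,1), of j] r by simp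
  qed
  show "(\<Sum>i<j. ?c ! (k + i)) \<le> (\<Sum>i<j. colen (fst \<omega>) i)" if "j \<le> l"
  proof -
    have "(\<Sum>i<j. ?c ! (k + i)) = sum_list (take j v)"
      using that uv st[of v] by (simp add: nth_append)
    then show ?thesis using chain_cols[OF w(2,1) order_refl, of j] c sum_colen[OF w(1) order_refl, of j] by simp
  qed
qed

section \<open>The random diagram and its coupling with letter counts\<close>

locale thoma =
  fixes \<alpha> \<beta> :: "nat \<Rightarrow> real" and \<gamma> :: real
  assumes params: "thoma_params \<alpha> \<beta> \<gamma>"
begin

lemma like: "thoma_like \<alpha> \<beta> \<gamma>"
  using params by (auto simp: thoma_params_def thoma_like_def)

lemma anti: "\<alpha> (Suc i) \<le> \<alpha> i" "\<beta> (Suc i) \<le> \<beta> i" "0 \<le> \<alpha> i" "0 \<le> \<beta> i" "0 \<le> \<gamma>" "summable \<alpha>" "summable \<beta>"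
  and total: "suminf \<alpha> + suminf \<beta> + \<gamma> = 1"
  using params by (auto simp: thoma_params_def)

abbreviation "h \<equiv> h_of (thoma_psum \<alpha> \<beta> \<gamma>)"

definition pmass :: "nat \<Rightarrow> (nat \<Rightarrow> nat) \<Rightarrow> real" where
  "pmass n f = real (fdim n f) * sch (Suc n) h f"

definition expect :: "nat \<Rightarrow> ((nat \<Rightarrow> nat) \<Rightarrow> real) \<Rightarrow> real" where
  "expect n G = (\<Sum>f\<in>Par n. pmass n f * G f)"

lemma h1: "h 1 = 1"
proof -
  have "h 1 = thoma_psum \<alpha> \<beta> \<gamma> 1" using newton_1[OF newton_h_of hseq_h_of] by metis
  also have "\<dots> = 1" using total anti(6,7) by (simp add: thoma_psum_def suminf_minus)
  finally show ?thesis .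
qed

lemma pmass_nonneg: "f \<in> Par n \<Longrightarrow> 0 \<le> pmass n f"
  unfolding pmass_def by (intro mult_nonneg_nonneg sch_thoma_nonneg[OF like]) auto

lemma pmass_sum: "(\<Sum>f\<in>Par n. pmass n f) = 1"
  using dim_sum_sch[OF hseq_h_of order_refl, of n "thoma_psum \<alpha> \<beta> \<gamma>"] h1 by (simp add: dim_sum_def pmass_def)

lemma expect_sum: "expect n (\<lambda>f. \<Sum>i\<in>A. G i f) = (\<Sum>i\<in>A. expect n (G i))"
  unfolding expect_def by (subst sum.swap) (simp add: sum_distrib_left)

lemma expect_mono: "(\<And>f. f \<in> Par n \<Longrightarrow> G f \<le> G' f) \<Longrightarrow> expect n G \<le> expect n G'"
  unfolding expect_def by (intro sum_mono mult_left_mono pmass_nonneg)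

lemma expect_const: "expect n (\<lambda>_. c) = c"
  unfolding expect_def sum_distrib_right[symmetric] pmass_sum by simp

lemma expect_add: "expect n (\<lambda>f. G f + G' f) = expect n G + expect n G'"
  and expect_diff: "expect n (\<lambda>f. G f - G' f) = expect n G - expect n G'"
  and expect_scale: "expect n (\<lambda>f. c * G f) = c * expect n G"
  by (simp_all add: expect_def distrib_left sum.distrib right_diff_distrib sum_subtractf sum_distrib_left mult.left_commute)

context
  fixes K L :: nat
begin

definition "kinds = replicate K True @ replicate L False"
definition "letters = map \<alpha> [0..<K] @ map \<beta> [0..<L]"
definition "hrest = h_of (thoma_psum (\<lambda>i. \<alpha> (i + K)) (\<lambda>i. \<beta> (i + L)) \<gamma>)"

abbreviation "W \<equiv> cweight letters hrest"
abbreviation "\<Omega> \<equiv> chainsp kinds"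

lemma coupling_basic:
  "length kinds = length letters" "hseq hrest" "length letters = K + L"
  "sum_list letters = (\<Sum>i<K. \<alpha> i) + (\<Sum>j<L. \<beta> j)"
  by (simp_all add: kinds_def letters_def hrest_def hseq_h_of sum_list_map_upt)

lemma coupling_build: "build kinds letters hrest = h"
  unfolding kinds_def letters_def hrest_def by (rule thoma_split[OF like, symmetric])

lemma letters_nonneg: "i < length letters \<Longrightarrow> 0 \<le> letters ! i"
  using anti by (auto simp: letters_def nth_append)

lemma hrest_1: "sum_list letters + hrest 1 = 1" "0 \<le> hrest 1"
proof -
  show "sum_list letters + hrest 1 = 1"
    using build_1[OF coupling_basic(2,1)] coupling_build h1 by simp
  \<comment> \<open>The Schur value of the one-box diagram is \<open>hrest 1\<close>, which makes
    this a probability: that of belonging to no selected letter.\<close>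
  have "(\<lambda>i. if i = (0::nat) then 1 else 0::nat) \<in> Par 1" by (auto simp: Par_def)
  from sch_thoma_nonneg[OF thoma_like_shift[OF like] this order_refl, of K L]
  have "0 \<le> sch (Suc 1) hrest (\<lambda>i. if i = (0::nat) then 1 else 0::nat)" by (simp add: hrest_def)
  also have "sch (Suc 1) hrest (\<lambda>i. if i = (0::nat) then 1 else 0::nat) = sch (Suc 0) hrest (\<lambda>i. if i = (0::nat) then 1 else 0::nat)"
    unfolding One_nat_def by (rule sch_pad[OF coupling_basic(2)]) simp
  also have "\<dots> = hrest 1"
  proof -
    have "{p. p permutes {..<Suc 0}} = {id}" by (auto simp: lessThan_Suc)
    then show ?thesis by (simp add: sch_def ldet_def)
  qed
  finally show "0 \<le> hrest 1" .
qed

lemma W_nonneg: "\<omega> \<in> \<Omega> n \<Longrightarrow> 0 \<le> W n \<omega>"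
  by (rule cweight_nonneg[OF _ letters_nonneg])
    (auto simp: hrest_def intro: sch_thoma_nonneg[OF thoma_like_shift[OF like]])

lemma W_marginal: "(\<Sum>\<omega>\<in>\<Omega> n. W n \<omega> * G (fst \<omega>)) = expect n G"
  unfolding cweight_marginal[OF coupling_basic(2,1)] coupling_build expect_def pmass_def ..

lemma W_sum: "(\<Sum>\<omega>\<in>\<Omega> n. W n \<omega>) = 1"
  using W_marginal[of n "\<lambda>_. 1"] expect_const[of n 1] by simp

lemma W_mean: "(\<Sum>\<omega>\<in>\<Omega> n. W n \<omega> * real (sum_list (counts (fst \<omega>) (snd \<omega>)))) = real n * sum_list letters"
  by (rule cweight_mean[OF coupling_basic(2,1) hrest_1(1)])

end

text \<open>The coupling is used here with k row letters and no column letters, so that all counts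
  together are dominated by the first k rows.\<close>

lemma rows_lower: "real n * (\<Sum>i<k. \<alpha> i) \<le> expect n (\<lambda>f. \<Sum>i<k. real (f i))"
proof -
  have "real n * (\<Sum>i<k. \<alpha> i) = (\<Sum>\<omega>\<in>\<Omega> k 0 n. W k 0 n \<omega> * real (sum_list (counts (fst \<omega>) (snd \<omega>))))"
    unfolding W_mean coupling_basic by simp
  also have "\<dots> \<le> (\<Sum>\<omega>\<in>\<Omega> k 0 n. W k 0 n \<omega> * (\<Sum>i<k. real (fst \<omega> i)))"
  proof (intro sum_mono mult_left_mono W_nonneg)
    fix \<omega> assume w: "\<omega> \<in> \<Omega> k 0 n"
    have "sum_list (counts (fst \<omega>) (snd \<omega>)) = (\<Sum>i<k. counts (fst \<omega>) (snd \<omega>) ! i)"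
      using chainsp_counts_length[OF w] by (simp add: sum_list_sum_nth atLeast0LessThan coupling_basic)
    also have "\<dots> \<le> (\<Sum>i<k. fst \<omega> i)"
      using counts_rows(1)[of \<omega> k 0 n k] w by (simp add: kinds_def)
    finally show "real (sum_list (counts (fst \<omega>) (snd \<omega>))) \<le> (\<Sum>i<k. real (fst \<omega> i))"
      by (simp add: of_nat_sum[symmetric] del: of_nat_sum)
  qed
  also have "\<dots> = expect n (\<lambda>f. \<Sum>i<k. real (f i))" by (rule W_marginal)
  finally show ?thesis .
qed

lemma cols_lower: "real n * (\<Sum>j<k. \<beta> j) \<le> expect n (\<lambda>f. \<Sum>j<k. real (colen f j))"
proof -
  have "real n * (\<Sum>j<k. \<beta> j) = (\<Sum>\<omega>\<in>\<Omega> 0 k n. W 0 k n \<omega> * real (sum_list (counts (fst \<omega>) (snd \<omega>))))"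
    unfolding W_mean coupling_basic by simp
  also have "\<dots> \<le> (\<Sum>\<omega>\<in>\<Omega> 0 k n. W 0 k n \<omega> * (\<Sum>j<k. real (colen (fst \<omega>) j)))"
  proof (intro sum_mono mult_left_mono W_nonneg)
    fix \<omega> assume w: "\<omega> \<in> \<Omega> 0 k n"
    have "sum_list (counts (fst \<omega>) (snd \<omega>)) = (\<Sum>i<k. counts (fst \<omega>) (snd \<omega>) ! i)"
      using chainsp_counts_length[OF w] by (simp add: sum_list_sum_nth atLeast0LessThan coupling_basic)
    also have "\<dots> \<le> (\<Sum>i<k. colen (fst \<omega>) i)"
      using counts_rows(2)[of \<omega> 0 k n k] w by (simp add: kinds_def)
    finally show "real (sum_list (counts (fst \<omega>) (snd \<omega>))) \<le> (\<Sum>i<k. real (colen (fst \<omega>) i))"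
      by (simp add: of_nat_sum[symmetric] del: of_nat_sum)
  qed
  also have "\<dots> = expect n (\<lambda>f. \<Sum>j<k. real (colen f j))" by (rule W_marginal)
  finally show ?thesis .
qed

end

section \<open>Deviation of the expected row and column lengths\<close>

text \<open>By monotonicity a i * (i + 1) is at most a 0 + ... + a i, hence at most 1. This
  controls, uniformly in the number of rows, the loss from measuring row i beyond the diagonal
  instead of from the left border.\<close>

lemma weighted_index_sum:
  fixes a :: "nat \<Rightarrow> real"
  assumes a: "\<And>i. 0 \<le> a i" "\<And>i. a (Suc i) \<le> a i" "summable a" "suminf a \<le> 1"
  shows "(\<Sum>i<M. (a i)\<^sup>2 * (real i + 1)) \<le> suminf a"
proof -
  have dec: "a i \<le> a k" if "k \<le> i" for i k
    using that by (induction rule: dec_induct) (auto intro: order_trans a(2))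
  have "a i * (real i + 1) \<le> 1" for i
  proof -
    have "a i * (real i + 1) = (\<Sum>k<Suc i. a i)" by (simp add: algebra_simps)
    also have "\<dots> \<le> (\<Sum>k<Suc i. a k)" by (intro sum_mono dec) simp
    also have "\<dots> \<le> suminf a" by (rule sum_le_suminf[OF a(3)]) (auto simp: a(1))
    finally show ?thesis using a(4) by simp
  qed
  then have "a i * (a i * (real i + 1)) \<le> a i * 1" for i by (rule mult_left_mono) (rule a(1))
  then have "(a i)\<^sup>2 * (real i + 1) \<le> a i" for i by (simp add: power2_eq_square mult.assoc)
  then have "(\<Sum>i<M. (a i)\<^sup>2 * (real i + 1)) \<le> (\<Sum>i<M. a i)" by (rule sum_mono)
  also have "\<dots> \<le> suminf a" by (rule sum_le_suminf[OF a(3)]) (auto simp: a(1))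
  finally show ?thesis .
qed

context thoma
begin

lemma expect_content_sq: "expect n (\<lambda>f. real_of_int (ycontent_sq (Suc n) f)) =
    real n * (real n - 1) / 2 + real n * (real n - 1) * (real n - 2) / 3 * thoma_psum \<alpha> \<beta> \<gamma> 3"
  using dim_sum_ycontent_sq[OF hseq_h_of h1 newton_h_of order_refl, of n]
  by (simp add: dim_sum_def expect_def pmass_def mult.commute mult.left_commute)

lemma cubes_summable: "summable (\<lambda>i. \<alpha> i ^ 3)" "summable (\<lambda>i. \<beta> i ^ 3)"
  using anti by (auto intro: summable_power_nonneg)

lemma thoma_psum_3: "thoma_psum \<alpha> \<beta> \<gamma> 3 = (\<Sum>i. \<alpha> i ^ 3) + (\<Sum>i. \<beta> i ^ 3)"
  using cubes_summable by (simp add: thoma_psum_def suminf_minus)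

definition row_dev :: "nat \<Rightarrow> nat \<Rightarrow> real" where
  "row_dev n i = expect n (\<lambda>f. real (f i)) - real n * \<alpha> i"

definition col_dev :: "nat \<Rightarrow> nat \<Rightarrow> real" where
  "col_dev n j = expect n (\<lambda>f. real (colen f j)) - real n * \<beta> j"

lemma row_dev_sum: "(\<Sum>i<k. row_dev n i) = expect n (\<lambda>f. \<Sum>i<k. real (f i)) - real n * (\<Sum>i<k. \<alpha> i)"
  by (simp add: row_dev_def sum_subtractf expect_sum sum_distrib_left)

lemma col_dev_sum: "(\<Sum>j<k. col_dev n j) = expect n (\<lambda>f. \<Sum>j<k. real (colen f j)) - real n * (\<Sum>j<k. \<beta> j)"
  by (simp add: col_dev_def sum_subtractf expect_sum sum_distrib_left)

text \<open>The expected form of \<open>content_sq_lower\<close> with tangents at n * \<alpha> i and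
  n * \<beta> j: deviations, main cubic term, and the cost of the shifts by i + 1.\<close>

lemma cubic_expect_lower:
  "3 * expect n (\<lambda>f. real_of_int (ycontent_sq (Suc n) f)) \<ge>
     3 * (real n)\<^sup>2 * ((\<Sum>i<M. (\<alpha> i)\<^sup>2 * row_dev n i) + (\<Sum>j<M. (\<beta> j)\<^sup>2 * col_dev n j))
     + real n ^ 3 * ((\<Sum>i<M. \<alpha> i ^ 3) + (\<Sum>j<M. \<beta> j ^ 3))
     - 3 * (real n)\<^sup>2 * ((\<Sum>i<M. (\<alpha> i)\<^sup>2 * (real i + 1)) + (\<Sum>j<M. (\<beta> j)\<^sup>2 * (real j + 1)))"
proof -
  let ?a = "\<lambda>i. real n * \<alpha> i" and ?b = "\<lambda>j. real n * \<beta> j"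
  let ?R = "\<lambda>f. \<Sum>i<M. 3 * (?a i)\<^sup>2 * (real (f i) - real i - 1) - 2 * ?a i ^ 3"
  let ?C = "\<lambda>f. \<Sum>j<M. 3 * (?b j)\<^sup>2 * (real (colen f j) - real j - 1) - 2 * ?b j ^ 3"
  have lin: "expect n (\<lambda>f. \<Sum>i<M. 3 * (real n * c i)\<^sup>2 * (g f i - real i - 1) - 2 * (real n * c i) ^ 3) =
      3 * (real n)\<^sup>2 * (\<Sum>i<M. (c i)\<^sup>2 * (expect n (\<lambda>f. g f i) - real n * c i)) + real n ^ 3 * (\<Sum>i<M. c i ^ 3)
      - 3 * (real n)\<^sup>2 * (\<Sum>i<M. (c i)\<^sup>2 * (real i + 1))" for c :: "nat \<Rightarrow> real" and g
  proof -
    have "expect n (\<lambda>f. 3 * (real n * c i)\<^sup>2 * (g f i - real i - 1) - 2 * (real n * c i) ^ 3) =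
       3 * (real n)\<^sup>2 * ((c i)\<^sup>2 * (expect n (\<lambda>f. g f i) - real n * c i)) + real n ^ 3 * c i ^ 3
       - 3 * (real n)\<^sup>2 * ((c i)\<^sup>2 * (real i + 1))" for i
    proof -
      have "expect n (\<lambda>f. 3 * (real n * c i)\<^sup>2 * (g f i - real i - 1) - 2 * (real n * c i) ^ 3) =
          3 * (real n * c i)\<^sup>2 * (expect n (\<lambda>f. g f i) - real i - 1) - 2 * (real n * c i) ^ 3"
        by (simp only: expect_diff expect_scale expect_const)
      then show ?thesis by (simp add: algebra_simps power2_eq_square power3_eq_cube)
    qed
    then show ?thesis unfolding expect_sum sum_distrib_left sum.distrib[symmetric] sum_subtractf[symmetric]
      by (intro sum.cong refl)
  qed
  have "expect n (\<lambda>f. ?R f + ?C f) \<le> expect n (\<lambda>f. 3 * real_of_int (ycontent_sq (Suc n) f))"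
    by (rule expect_mono, rule content_sq_lower[OF _ le_SucI[OF order_refl]]) (use anti in auto)
  then show ?thesis
    unfolding expect_add expect_scale lin[of \<alpha> "\<lambda>f i. real (f i)"] lin[of \<beta> "\<lambda>f j. real (colen f j)"]
    by (simp add: row_dev_def col_dev_def algebra_simps)
qed

lemma total_le: "suminf \<alpha> \<le> 1" "suminf \<beta> \<le> 1" "suminf \<alpha> + suminf \<beta> \<le> 1"
  using total anti suminf_nonneg[OF anti(6)] suminf_nonneg[OF anti(7)] by auto

lemma weighted_dev_bound:
  assumes n: "n \<ge> 1"
  shows "\<forall>\<^sub>F M in sequentially. (\<Sum>i<M. (\<alpha> i)\<^sup>2 * row_dev n i) + (\<Sum>j<M. (\<beta> j)\<^sup>2 * col_dev n j) \<le> 2"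
proof -
  let ?p = "thoma_psum \<alpha> \<beta> \<gamma> 3"
  \<comment> \<open>Here n is fixed and M grows until the cubes of the omitted letters sum to less
    than 1 / n, so that the mismatch of the cubic terms is at most n^2.\<close>
  have "(\<lambda>M. real n * (?p - ((\<Sum>i<M. \<alpha> i ^ 3) + (\<Sum>j<M. \<beta> j ^ 3)))) \<longlonglongrightarrow> real n * (?p - ?p)"
    unfolding thoma_psum_3 by (intro tendsto_intros summable_LIMSEQ cubes_summable)
  then have "\<forall>\<^sub>F M in sequentially. real n * (?p - ((\<Sum>i<M. \<alpha> i ^ 3) + (\<Sum>j<M. \<beta> j ^ 3))) < 1"
    by (rule order_tendstoD) simp
  then show ?thesis
  proof eventually_elim
    case (elim M)
    let ?x = "real n"
    let ?AB = "(\<Sum>i<M. (\<alpha> i)\<^sup>2 * row_dev n i) + (\<Sum>j<M. (\<beta> j)\<^sup>2 * col_dev n j)"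
    let ?S = "(\<Sum>i<M. \<alpha> i ^ 3) + (\<Sum>j<M. \<beta> j ^ 3)"
    let ?I = "(\<Sum>i<M. (\<alpha> i)\<^sup>2 * (real i + 1)) + (\<Sum>j<M. (\<beta> j)\<^sup>2 * (real j + 1))"
    have x1: "?x \<ge> 1" using n by simp
    have p0: "0 \<le> ?p" unfolding thoma_psum_3 using anti by (intro add_nonneg_nonneg suminf_nonneg cubes_summable) auto
    have I: "?I \<le> 1"
      using weighted_index_sum[OF anti(3,1,6) total_le(1), of M] weighted_index_sum[OF anti(4,2,7) total_le(2), of M]
        total_le(3) by linarith
    have "3 * ?x\<^sup>2 * ?AB + ?x ^ 3 * ?S - 3 * ?x\<^sup>2 * ?I \<le> 3 * (?x * (?x - 1) / 2 + ?x * (?x - 1) * (?x - 2) / 3 * ?p)"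
      using cubic_expect_lower[of n M] unfolding expect_content_sq .
    also have "\<dots> \<le> 3 / 2 * ?x\<^sup>2 + ?x ^ 3 * ?p"
    proof -
      have "?x * (?x - 1) * (?x - 2) \<le> ?x ^ 3"
      proof -
        have "?x ^ 3 - ?x * (?x - 1) * (?x - 2) = ?x * (3 * ?x - 2)"
          by (simp add: algebra_simps power3_eq_cube)
        also have "\<dots> \<ge> 0" using x1 by simp
        finally show ?thesis by simp
      qed
      then have "?x * (?x - 1) * (?x - 2) * ?p \<le> ?x ^ 3 * ?p" using p0 by (rule mult_right_mono)
      moreover have "3 * (?x * (?x - 1) / 2 + ?x * (?x - 1) * (?x - 2) / 3 * ?p) =
          3 / 2 * (?x * (?x - 1)) + ?x * (?x - 1) * (?x - 2) * ?p" by (simp add: distrib_left)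
      moreover have "3 / 2 * (?x * (?x - 1)) \<le> 3 / 2 * ?x\<^sup>2" by (simp add: power2_eq_square algebra_simps)
      ultimately show ?thesis by linarith
    qed
    finally have "3 * ?x\<^sup>2 * ?AB \<le> 3 / 2 * ?x\<^sup>2 + ?x\<^sup>2 * (?x * (?p - ?S)) + 3 * ?x\<^sup>2 * ?I"
      by (simp add: algebra_simps power2_eq_square power3_eq_cube)
    \<comment> \<open>The coefficients add up to 3/2 + 1 + 3 = 11/2, which is below 6 = 3 * 2; this
      is the origin of the bound 2.\<close>
    also have "\<dots> \<le> 3 / 2 * ?x\<^sup>2 + ?x\<^sup>2 * 1 + 3 * ?x\<^sup>2 * 1"
      using elim I by (intro add_mono mult_left_mono) auto
    also have "\<dots> \<le> 3 * ?x\<^sup>2 * 2" by simp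
    finally show ?case using x1 by (subst (asm) mult_le_cancel_left_pos) auto
  qed
qed

lemma dev_nonneg: "0 \<le> (\<Sum>i<k. row_dev n i)" "0 \<le> (\<Sum>j<k. col_dev n j)"
  unfolding row_dev_sum col_dev_sum using rows_lower cols_lower by auto

lemma squares_anti: "(\<alpha> (Suc i))\<^sup>2 \<le> (\<alpha> i)\<^sup>2" "(\<beta> (Suc i))\<^sup>2 \<le> (\<beta> i)\<^sup>2"
  using anti by (auto intro!: power_mono)

text \<open>The weighted row sum and the weighted column sum are both non-negative, so their joint
  bound 2 holds for each of them. The auxiliary M has disappeared, and the bound is uniform in
  n.\<close>

lemma dev_bound:
  assumes n: "n \<ge> 1"
  shows "((\<alpha> k)\<^sup>2 - (\<alpha> (Suc k))\<^sup>2) * (\<Sum>i<Suc k. row_dev n i) \<le> 2"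
    and "((\<beta> k)\<^sup>2 - (\<beta> (Suc k))\<^sup>2) * (\<Sum>i<Suc k. col_dev n i) \<le> 2"
proof -
  have "\<forall>\<^sub>F M in sequentially. M \<ge> Suc (Suc k) \<and> (\<Sum>i<M. (\<alpha> i)\<^sup>2 * row_dev n i) + (\<Sum>j<M. (\<beta> j)\<^sup>2 * col_dev n j) \<le> 2"
    by (intro eventually_conj eventually_ge_at_top weighted_dev_bound n)
  then obtain M' where M': "M' \<ge> Suc (Suc k)" "(\<Sum>i<M'. (\<alpha> i)\<^sup>2 * row_dev n i) + (\<Sum>j<M'. (\<beta> j)\<^sup>2 * col_dev n j) \<le> 2"
    using eventually_happens'[OF sequentially_bot] by blast
  then obtain M where M: "M' = Suc M" "k < M" by (cases M') auto
  have r: "((\<alpha> k)\<^sup>2 - (\<alpha> (Suc k))\<^sup>2) * (\<Sum>i<Suc k. row_dev n i) \<le> (\<Sum>i<Suc M. (\<alpha> i)\<^sup>2 * row_dev n i)"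
    if "k < M" for k
    by (rule abel_lower[where a="\<lambda>i. (\<alpha> i)\<^sup>2" and d="row_dev n", OF _ squares_anti(1) dev_nonneg(1) that]) simp
  have c: "((\<beta> k)\<^sup>2 - (\<beta> (Suc k))\<^sup>2) * (\<Sum>i<Suc k. col_dev n i) \<le> (\<Sum>i<Suc M. (\<beta> i)\<^sup>2 * col_dev n i)"
    if "k < M" for k
    by (rule abel_lower[where a="\<lambda>i. (\<beta> i)\<^sup>2" and d="col_dev n", OF _ squares_anti(2) dev_nonneg(2) that]) simp
  have r0: "0 \<le> (\<Sum>i<Suc M. (\<alpha> i)\<^sup>2 * row_dev n i)"
  proof -
    have "0 \<le> ((\<alpha> 0)\<^sup>2 - (\<alpha> (Suc 0))\<^sup>2) * (\<Sum>i<Suc 0. row_dev n i)"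
      using squares_anti(1)[of 0] dev_nonneg(1)[where k="Suc 0"] by (intro mult_nonneg_nonneg) auto
    then show ?thesis using r[of 0] M by linarith
  qed
  have c0: "0 \<le> (\<Sum>i<Suc M. (\<beta> i)\<^sup>2 * col_dev n i)"
  proof -
    have "0 \<le> ((\<beta> 0)\<^sup>2 - (\<beta> (Suc 0))\<^sup>2) * (\<Sum>i<Suc 0. col_dev n i)"
      using squares_anti(2)[of 0] dev_nonneg(2)[where k="Suc 0"] by (intro mult_nonneg_nonneg) auto
    then show ?thesis using c[of 0] M by linarith
  qed
  show "((\<alpha> k)\<^sup>2 - (\<alpha> (Suc k))\<^sup>2) * (\<Sum>i<Suc k. row_dev n i) \<le> 2"
    using r[OF M(2)] c0 M'(2) unfolding M(1) by linarith
  show "((\<beta> k)\<^sup>2 - (\<beta> (Suc k))\<^sup>2) * (\<Sum>i<Suc k. col_dev n i) \<le> 2"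
    using c[OF M(2)] r0 M'(2) unfolding M(1) by linarith
qed

end

section \<open>Weak convergence from trigonometric test functions\<close>

text \<open>The free phase \<phi> makes sines and constants members, and the product formula for
  cosines makes the class an algebra. Convergence of its expectations is convergence of
  characteristic functions in real form.\<close>

inductive_set trig :: "nat \<Rightarrow> ((nat \<Rightarrow> real) \<Rightarrow> real) set" for m where
  trig_cos: "(\<lambda>x. a * cos ((\<Sum>i<m. \<theta> i * x i) + \<phi>)) \<in> trig m"
| trig_add: "f \<in> trig m \<Longrightarrow> g \<in> trig m \<Longrightarrow> (\<lambda>x. f x + g x) \<in> trig m"

lemma trig_mult_cos:
  assumes "g \<in> trig m"
  shows "(\<lambda>x. (a * cos ((\<Sum>i<m. \<theta> i * x i) + \<phi>)) * g x) \<in> trig m"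
  using assms
proof induction
  case (trig_cos b \<eta> \<psi>)
  have "(\<lambda>x. (a * cos ((\<Sum>i<m. \<theta> i * x i) + \<phi>)) * (b * cos ((\<Sum>i<m. \<eta> i * x i) + \<psi>))) =
      (\<lambda>x. (a * b / 2) * cos ((\<Sum>i<m. (\<theta> i - \<eta> i) * x i) + (\<phi> - \<psi>)) +
           (a * b / 2) * cos ((\<Sum>i<m. (\<theta> i + \<eta> i) * x i) + (\<phi> + \<psi>)))"
  proof
    fix x :: "nat \<Rightarrow> real"
    let ?A = "(\<Sum>i<m. \<theta> i * x i) + \<phi>" and ?B = "(\<Sum>i<m. \<eta> i * x i) + \<psi>"
    have 1: "(\<Sum>i<m. (\<theta> i - \<eta> i) * x i) + (\<phi> - \<psi>) = ?A - ?B"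
      by (simp add: left_diff_distrib sum_subtractf)
    have 2: "(\<Sum>i<m. (\<theta> i + \<eta> i) * x i) + (\<phi> + \<psi>) = ?A + ?B"
      by (simp add: distrib_right sum.distrib)
    show "(a * cos ?A) * (b * cos ?B) = (a * b / 2) * cos ((\<Sum>i<m. (\<theta> i - \<eta> i) * x i) + (\<phi> - \<psi>)) +
           (a * b / 2) * cos ((\<Sum>i<m. (\<theta> i + \<eta> i) * x i) + (\<phi> + \<psi>))"
      unfolding 1 2 cos_diff cos_add by (simp add: field_simps)
  qed
  then show ?case by (simp only: trig.trig_add[OF trig.trig_cos trig.trig_cos])
next
  case (trig_add f g)
  then show ?case by (simp add: distrib_left trig.trig_add)
qed

lemma trig_mult: "f \<in> trig m \<Longrightarrow> g \<in> trig m \<Longrightarrow> (\<lambda>x. f x * g x) \<in> trig m"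
proof (induction rule: trig.induct)
  case (trig_cos a \<theta> \<phi>)
  then show ?case by (rule trig_mult_cos)
next
  case (trig_add f1 f2)
  then show ?case by (simp add: distrib_right trig.trig_add)
qed

lemma trig_const: "(\<lambda>_. c) \<in> trig m"
  using trig_cos[of c "\<lambda>_. 0" m 0] by simp

lemma trig_sin:
  assumes "i < m"
  shows "(\<lambda>x. sin (\<omega> * x i)) \<in> trig m"
proof -
  have "(\<Sum>k<m. (if k = i then - \<omega> else 0) * x k) = - \<omega> * x i" for x :: "nat \<Rightarrow> real"
    using assms by (simp add: if_distrib[of "\<lambda>z. z * _"] cong: if_cong)
  then have "(\<lambda>x. sin (\<omega> * x i)) = (\<lambda>x. 1 * cos ((\<Sum>k<m. (if k = i then - \<omega> else 0) * x k) + pi / 2))"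
    by (simp only: sin_cos_eq) (simp add: algebra_simps)
  then show ?thesis using trig_cos[of 1 "\<lambda>k. if k = i then - \<omega> else 0" m "pi / 2"] by (simp only:)
qed

lemma trig_continuous: "f \<in> trig m \<Longrightarrow> continuous_on UNIV f"
  by (induction rule: trig.induct) (auto intro!: continuous_intros)

lemma trig_bounded: "f \<in> trig m \<Longrightarrow> \<exists>B. \<forall>x. \<bar>f x\<bar> \<le> B"
proof (induction rule: trig.induct)
  case (trig_cos a \<theta> \<phi>)
  have "\<bar>a * cos z\<bar> \<le> \<bar>a\<bar>" for z unfolding abs_mult using abs_cos_le_one[of z]
    by (simp add: mult_left_le)
  then show ?case by blast
next
  case (trig_add f g)
  then obtain B C where "\<forall>x. \<bar>f x\<bar> \<le> B" "\<forall>x. \<bar>g x\<bar> \<le> C" by blast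
  then have "\<bar>f x + g x\<bar> \<le> B + C" for x by (meson abs_triangle_ineq add_mono order_trans)
  then show ?case by blast
qed

text \<open>Vectors of length m are functions with zero coordinates from m on, so this cube is a
  product of compact sets in the function space.\<close>

definition cube :: "nat \<Rightarrow> (nat \<Rightarrow> real) set" where
  "cube m = {y. \<forall>i. y i \<in> (if i < m then {-1..1} else {0})}"

lemma cubeD: "y \<in> cube m \<Longrightarrow> i < m \<Longrightarrow> y i \<in> {-1..1}" and cubeD0: "y \<in> cube m \<Longrightarrow> \<not> i < m \<Longrightarrow> y i = 0"
proof -
  assume "y \<in> cube m"
  then have "y i \<in> (if i < m then {-1..1} else {0})" unfolding cube_def by blast
  then show "i < m \<Longrightarrow> y i \<in> {-1..1}" "\<not> i < m \<Longrightarrow> y i = 0" by simp_all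
qed

lemma compact_cube: "compact (cube m)"
proof -
  have "cube m = PiE UNIV (\<lambda>i. if i < m then {-1..1} else {0})"
    by (auto simp: cube_def PiE_def Pi_def)
  moreover have "compactin (product_topology (\<lambda>_. euclidean) UNIV) (PiE UNIV (\<lambda>i. if i < m then {-1..1::real} else {0}))"
    unfolding compactin_PiE by auto
  ultimately show ?thesis by (simp add: euclidean_product_topology)
qed

text \<open>On the cube of half-width \<open>pi / (2 * \<omega>)\<close> the function agrees with \<open>F (\<lambda>i. sin (\<omega> * x i))\<close>; a
  Stone--Weierstrass approximation of \<open>F\<close> therefore turns into a trigonometric polynomial that is
  uniformly close to a bounded function everywhere.\<close>

lemma trig_approx:
  fixes f :: "(nat \<Rightarrow> real) \<Rightarrow> real"
  assumes f: "continuous_on UNIV f" "\<And>x. \<bar>f x\<bar> \<le> B" and R: "R > 0" and e: "e > 0"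
  shows "\<exists>g\<in>trig m. \<forall>x. (\<forall>i\<ge>m. x i = 0) \<longrightarrow> \<bar>f x - g x\<bar> \<le> e + 2 * B / R * (\<Sum>k<m. \<bar>x k\<bar>)"
proof -
  define \<omega> where "\<omega> = pi / (2 * R)"
  have \<omega>: "\<omega> > 0" using R by (simp add: \<omega>_def)
  define s where "s = (\<lambda>(x :: nat \<Rightarrow> real) i. if i < m then sin (\<omega> * x i) else 0)"
  define F where "F = (\<lambda>y. f (\<lambda>i. if i < m then arcsin (y i) / \<omega> else 0))"
  define Rs where "Rs = {g. continuous_on (cube m) g \<and> (\<lambda>x. g (s x)) \<in> trig m}"
  have s_cube: "s x \<in> cube m" for x by (auto simp: s_def cube_def)
  have arc: "continuous_on (cube m) (\<lambda>y. arcsin (y i))" if "i < m" for i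
  proof (rule continuous_on_compose2[OF continuous_on_arcsin'])
    show "continuous_on (cube m) (\<lambda>y. y i)"
      by (rule continuous_on_subset[OF continuous_on_product_coordinates]) simp
    show "(\<lambda>y. y i) ` cube m \<subseteq> {-1..1}" using cubeD[OF _ that] by (rule image_subsetI)
  qed
  have contF: "continuous_on (cube m) F"
    unfolding F_def
  proof (rule continuous_on_compose2[OF f(1)])
    show "continuous_on (cube m) (\<lambda>y i. if i < m then arcsin (y i) / \<omega> else 0)"
    proof (rule continuous_on_coordinatewise_then_product)
      fix i show "continuous_on (cube m) (\<lambda>y. if i < m then arcsin (y i) / \<omega> else 0)"
        using arc[of i] \<omega> by (cases "i < m") (auto intro!: continuous_intros)
    qed
  qed simp
  interpret function_ring_on Rs "cube m"
  proof
    show "compact (cube m)" by (rule compact_cube)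
    show "continuous_on (cube m) g" if "g \<in> Rs" for g using that by (simp add: Rs_def)
    show "(\<lambda>x. g x + g' x) \<in> Rs" if "g \<in> Rs" "g' \<in> Rs" for g g'
      using that by (auto simp: Rs_def intro!: continuous_intros trig_add)
    show "(\<lambda>x. g x * g' x) \<in> Rs" if "g \<in> Rs" "g' \<in> Rs" for g g'
      using that by (auto simp: Rs_def intro!: continuous_intros trig_mult)
    show "(\<lambda>_. c) \<in> Rs" for c by (auto simp: Rs_def trig_const)
    show "\<exists>g\<in>Rs. g x \<noteq> g y" if xy: "x \<in> cube m" "y \<in> cube m" "x \<noteq> y" for x y
    proof -
      obtain i where i: "x i \<noteq> y i" using xy(3) by blast
      then have im: "i < m" using cubeD0[OF xy(1), of i] cubeD0[OF xy(2), of i] by (cases "i < m") simp_all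
      have "continuous_on (cube m) (\<lambda>y. y i)"
        by (rule continuous_on_subset[OF continuous_on_product_coordinates]) simp
      moreover have "(\<lambda>x. s x i) \<in> trig m" using trig_sin[OF im, of \<omega>] im by (simp add: s_def)
      ultimately have "(\<lambda>y. y i) \<in> Rs" by (simp add: Rs_def)
      then show ?thesis using i by (intro bexI[of _ "\<lambda>y. y i"])
    qed
  qed
  obtain g where g: "g \<in> Rs" "\<And>y. y \<in> cube m \<Longrightarrow> \<bar>F y - g y\<bar> < e"
    using Stone_Weierstrass_basic[OF contF e] by blast
  have B0: "0 \<le> B" using f(2)[of undefined] by linarith
  have "\<bar>f x - g (s x)\<bar> \<le> e + 2 * B / R * (\<Sum>k<m. \<bar>x k\<bar>)" if x: "\<forall>i\<ge>m. x i = 0" for x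
  proof -
    have "\<bar>f x - F (s x)\<bar> \<le> 2 * B / R * (\<Sum>k<m. \<bar>x k\<bar>)"
    proof (cases "\<forall>i<m. \<bar>x i\<bar> \<le> R")
      case True
      have "arcsin (sin (\<omega> * x i)) / \<omega> = x i" if "i < m" for i
      proof -
        have "\<bar>\<omega> * x i\<bar> \<le> \<omega> * R" unfolding abs_mult using True that \<omega> by simp
        also have "\<dots> = pi / 2" using R by (simp add: \<omega>_def)
        finally have "arcsin (sin (\<omega> * x i)) = \<omega> * x i" by (intro arcsin_sin) (auto simp: abs_le_iff)
        then show ?thesis using \<omega> by simp
      qed
      then have "(\<lambda>i. if i < m then arcsin (s x i) / \<omega> else 0) = x"
        using x by (auto simp: s_def fun_eq_iff)
      then have "F (s x) = f x" by (simp add: F_def)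
      then show ?thesis using B0 R by (simp add: sum_nonneg)
    next
      case False
      \<comment> \<open>Outside the box the crude bound 2 * B is absorbed by the linear term,
        because the sum of the |x k| already exceeds R.\<close>
      then obtain i where i: "i < m" "R < \<bar>x i\<bar>" by (auto simp: not_le)
      have "\<bar>x i\<bar> \<le> (\<Sum>k<m. \<bar>x k\<bar>)" by (rule member_le_sum) (use i in auto)
      then have "R \<le> (\<Sum>k<m. \<bar>x k\<bar>)" using i by simp
      then have "2 * B / R * R \<le> 2 * B / R * (\<Sum>k<m. \<bar>x k\<bar>)"
        using B0 R by (intro mult_left_mono) auto
      moreover have "\<bar>f x - F (s x)\<bar> \<le> 2 * B"
        using f(2)[of x] f(2)[of "\<lambda>i. if i < m then arcsin (s x i) / \<omega> else 0"] unfolding F_def by linarith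
      ultimately show ?thesis using R by simp
    qed
    moreover have "\<bar>F (s x) - g (s x)\<bar> < e" by (rule g(2)[OF s_cube])
    ultimately show ?thesis by linarith
  qed
  moreover have "(\<lambda>x. g (s x)) \<in> trig m" using g(1) by (simp add: Rs_def)
  ultimately show ?thesis by (intro bexI[of _ "\<lambda>x. g (s x)"]) auto
qed

text \<open>The error in \<open>trig_approx\<close> is affine in the absolute values of the
  coordinates. Bounded first absolute moments, along the sequence and in the limit, therefore serve
  as tightness.\<close>

theorem weak_convergence_trig:
  fixes Y :: "nat \<Rightarrow> 'w set" and P :: "nat \<Rightarrow> 'w \<Rightarrow> real" and X :: "nat \<Rightarrow> 'w \<Rightarrow> nat \<Rightarrow> real"
  assumes nonneg: "\<And>n w. w \<in> Y n \<Longrightarrow> 0 \<le> P n w"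
    and one: "\<And>n. (\<Sum>w\<in>Y n. P n w) = 1"
    and supp: "\<And>n w k. m \<le> k \<Longrightarrow> X n w k = 0"
    and tight: "\<And>n k. k < m \<Longrightarrow> (\<Sum>w\<in>Y n. P n w * \<bar>X n w k\<bar>) \<le> C"
    and N: "prob_space N" "sets N = sets borel" "AE x in N. \<forall>i\<ge>m. x i = 0"
    and intN: "\<And>k. k < m \<Longrightarrow> integrable N (\<lambda>x. x k)"
    and conv: "\<And>\<theta> \<phi>. (\<lambda>n. \<Sum>w\<in>Y n. P n w * cos ((\<Sum>i<m. \<theta> i * X n w i) + \<phi>))
        \<longlonglongrightarrow> (\<integral>x. cos ((\<Sum>i<m. \<theta> i * x i) + \<phi>) \<partial>N)"
    and f: "continuous_on UNIV f" "bounded (range f)"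
  shows "(\<lambda>n. \<Sum>w\<in>Y n. P n w * f (X n w)) \<longlonglongrightarrow> (\<integral>x. f x \<partial>N)"
proof -
  interpret prob_space N by (rule N(1))
  have mb: "g \<in> borel_measurable N" if "continuous_on UNIV g" for g :: "(nat \<Rightarrow> real) \<Rightarrow> real"
    using borel_measurable_continuous_onI[OF that] N(2) by (simp cong: measurable_cong_sets)
  have ib: "integrable N g" if "continuous_on UNIV g" "\<And>x. \<bar>g x\<bar> \<le> b" for g :: "(nat \<Rightarrow> real) \<Rightarrow> real" and b :: real
    by (rule integrable_const_bound[of _ b]) (use that mb in auto)
  have trig_conv: "(\<lambda>n. \<Sum>w\<in>Y n. P n w * g (X n w)) \<longlonglongrightarrow> (\<integral>x. g x \<partial>N)" if "g \<in> trig m" for g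
    using that
  proof (induction rule: trig.induct)
    case (trig_cos a \<theta> \<phi>)
    have "(\<lambda>n. a * (\<Sum>w\<in>Y n. P n w * cos ((\<Sum>i<m. \<theta> i * X n w i) + \<phi>)))
        \<longlonglongrightarrow> a * (\<integral>x. cos ((\<Sum>i<m. \<theta> i * x i) + \<phi>) \<partial>N)"
      by (intro tendsto_mult tendsto_const conv)
    then show ?case by (simp add: sum_distrib_left mult.left_commute)
  next
    case (trig_add g g')
    obtain b b' where b: "\<And>x. \<bar>g x\<bar> \<le> b" "\<And>x. \<bar>g' x\<bar> \<le> b'"
      using trig_bounded trig_add.hyps by meson
    have "(\<integral>x. g x + g' x \<partial>N) = (\<integral>x. g x \<partial>N) + (\<integral>x. g' x \<partial>N)"
      using ib[OF trig_continuous[OF trig_add.hyps(1)] b(1)] ib[OF trig_continuous[OF trig_add.hyps(2)] b(2)]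
      by (rule Bochner_Integration.integral_add)
    then show ?case using tendsto_add[OF trig_add.IH] by (simp add: distrib_left sum.distrib)
  qed
  obtain B where "\<And>x. norm (f x) \<le> B" using f(2) by (auto simp: bounded_iff)
  then have B: "\<And>x. \<bar>f x\<bar> \<le> B" by simp
  have B0: "0 \<le> B" using B[of undefined] by linarith
  define S where "S = (\<Sum>k<m. \<integral>x. \<bar>x k\<bar> \<partial>N)"
  \<comment> \<open>D dominates the total first absolute moment of every member of the sequence and
    of N; the added 1 keeps it positive.\<close>
  define D where "D = real m * \<bar>C\<bar> + S + 1"
  have S0: "0 \<le> S" unfolding S_def by (intro sum_nonneg integral_nonneg_AE) auto
  have D0: "D > 0" using S0 by (simp add: D_def add_nonneg_pos)
  show ?thesis
  proof (rule LIMSEQ_I)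
    fix r :: real assume r: "r > 0"
    \<comment> \<open>Replacing f by g costs at most 2 * e along the sequence and 2 * e in the
      limit; the convergence for g costs less than e.\<close>
    define e where "e = r / 5"
    have e: "e > 0" using r by (simp add: e_def)
    \<comment> \<open>Chosen so that the linear error term is at most e; 2 * B + 1 instead of 2 * B
      keeps R positive when B = 0.\<close>
    define R where "R = (2 * B + 1) * D / e"
    have R: "R > 0" using B0 D0 e by (simp add: R_def)
    have BRD: "2 * B / R * D \<le> e"
    proof -
      have "R * e = (2 * B + 1) * D" using e by (simp add: R_def)
      moreover have "2 * B * D \<le> (2 * B + 1) * D" using D0 by (intro mult_right_mono) auto
      ultimately have "2 * B * D \<le> e * R" by (simp add: mult.commute)
      then show ?thesis using R by (simp add: divide_le_eq)
    qed
    obtain g where g: "g \<in> trig m" and gx: "\<And>x. \<forall>i\<ge>m. x i = 0 \<Longrightarrow> \<bar>f x - g x\<bar> \<le> e + 2 * B / R * (\<Sum>k<m. \<bar>x k\<bar>)"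
      using trig_approx[OF f(1) B R e, of m] by blast
    obtain b where b: "\<And>x. \<bar>g x\<bar> \<le> b" using trig_bounded[OF g] by blast
    have if_: "integrable N f" by (rule ib[OF f(1) B])
    have ig: "integrable N g" by (rule ib[OF trig_continuous[OF g] b])
    have 1: "\<bar>(\<Sum>w\<in>Y n. P n w * f (X n w)) - (\<Sum>w\<in>Y n. P n w * g (X n w))\<bar> \<le> 2 * e" for n
    proof -
      have "\<bar>(\<Sum>w\<in>Y n. P n w * f (X n w)) - (\<Sum>w\<in>Y n. P n w * g (X n w))\<bar> =
          \<bar>\<Sum>w\<in>Y n. P n w * (f (X n w) - g (X n w))\<bar>"
        by (simp add: right_diff_distrib sum_subtractf)
      also have "\<dots> \<le> (\<Sum>w\<in>Y n. P n w * (e + 2 * B / R * (\<Sum>k<m. \<bar>X n w k\<bar>)))"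
      proof (rule order_trans[OF sum_abs sum_mono])
        fix w assume w: "w \<in> Y n"
        have "\<bar>P n w * (f (X n w) - g (X n w))\<bar> = P n w * \<bar>f (X n w) - g (X n w)\<bar>"
          using nonneg[OF w] by (simp add: abs_mult)
        also have "\<dots> \<le> P n w * (e + 2 * B / R * (\<Sum>k<m. \<bar>X n w k\<bar>))"
          by (intro mult_left_mono nonneg w gx) (simp add: supp)
        finally show "\<bar>P n w * (f (X n w) - g (X n w))\<bar> \<le> P n w * (e + 2 * B / R * (\<Sum>k<m. \<bar>X n w k\<bar>))" .
      qed
      also have "\<dots> = e * (\<Sum>w\<in>Y n. P n w) + 2 * B / R * (\<Sum>k<m. \<Sum>w\<in>Y n. P n w * \<bar>X n w k\<bar>)"
        by (subst sum.swap) (simp add: sum_distrib_left sum_distrib_right distrib_left sum.distrib mult.commute mult.left_commute)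
      also have "\<dots> \<le> e * 1 + 2 * B / R * D"
      proof -
        have "(\<Sum>k<m. \<Sum>w\<in>Y n. P n w * \<bar>X n w k\<bar>) \<le> (\<Sum>k<m. \<bar>C\<bar>)"
          by (intro sum_mono order_trans[OF tight]) auto
        also have "\<dots> \<le> D" using S0 by (simp add: D_def)
        finally show ?thesis unfolding one using B0 R e by (intro add_mono mult_left_mono) auto
      qed
      also have "\<dots> \<le> 2 * e" using BRD by simp
      finally show ?thesis .
    qed
    have 2: "\<bar>(\<integral>x. f x \<partial>N) - (\<integral>x. g x \<partial>N)\<bar> \<le> 2 * e"
    proof -
      have ia: "integrable N (\<lambda>x. \<bar>x k\<bar>)" if "k < m" for k using intN[OF that] by (rule integrable_abs)
      have ii: "integrable N (\<lambda>x. e + 2 * B / R * (\<Sum>k<m. \<bar>x k\<bar>))"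
        using ia by (intro Bochner_Integration.integrable_add integrable_mult_right Bochner_Integration.integrable_sum) auto
      have "\<bar>(\<integral>x. f x \<partial>N) - (\<integral>x. g x \<partial>N)\<bar> = \<bar>\<integral>x. f x - g x \<partial>N\<bar>"
        using if_ ig by (simp add: Bochner_Integration.integral_diff)
      also have "\<dots> \<le> (\<integral>x. \<bar>f x - g x\<bar> \<partial>N)" by (rule integral_abs_bound)
      also have "\<dots> \<le> (\<integral>x. e + 2 * B / R * (\<Sum>k<m. \<bar>x k\<bar>) \<partial>N)"
      proof (rule integral_mono_AE)
        show "integrable N (\<lambda>x. \<bar>f x - g x\<bar>)" using if_ ig by (intro integrable_abs Bochner_Integration.integrable_diff)
        show "AE x in N. \<bar>f x - g x\<bar> \<le> e + 2 * B / R * (\<Sum>k<m. \<bar>x k\<bar>)"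
          using N(3) by eventually_elim (rule gx)
      qed (rule ii)
      also have "\<dots> = e + 2 * B / R * S"
      proof -
        have sm: "integrable N (\<lambda>x. \<Sum>k<m. \<bar>x k\<bar>)" using ia by (intro Bochner_Integration.integrable_sum) auto
        have "(\<integral>x. e + 2 * B / R * (\<Sum>k<m. \<bar>x k\<bar>) \<partial>N) =
            (\<integral>x. e \<partial>N) + (\<integral>x. 2 * B / R * (\<Sum>k<m. \<bar>x k\<bar>) \<partial>N)"
          by (rule Bochner_Integration.integral_add) (intro integrable_const integrable_mult_right sm)+
        also have "(\<integral>x. 2 * B / R * (\<Sum>k<m. \<bar>x k\<bar>) \<partial>N) = 2 * B / R * (\<integral>x. (\<Sum>k<m. \<bar>x k\<bar>) \<partial>N)"
          by (rule integral_mult_right_zero)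
        also have "(\<integral>x. (\<Sum>k<m. \<bar>x k\<bar>) \<partial>N) = S"
          unfolding S_def by (rule Bochner_Integration.integral_sum) (use ia in auto)
        finally show ?thesis by (simp add: prob_space)
      qed
      also have "\<dots> \<le> e + 2 * B / R * D"
        using B0 R S0 by (intro add_left_mono mult_left_mono) (auto simp: D_def)
      also have "\<dots> \<le> 2 * e" using BRD by simp
      finally show ?thesis .
    qed
    obtain n0 where n0: "\<And>n. n \<ge> n0 \<Longrightarrow> norm ((\<Sum>w\<in>Y n. P n w * g (X n w)) - (\<integral>x. g x \<partial>N)) < e"
      using LIMSEQ_D[OF trig_conv[OF g] e] by blast
    show "\<exists>n0. \<forall>n\<ge>n0. norm ((\<Sum>w\<in>Y n. P n w * f (X n w)) - (\<integral>x. f x \<partial>N)) < r"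
    proof (intro exI[of _ n0] allI impI)
      fix n assume "n0 \<le> n"
      then have "\<bar>(\<Sum>w\<in>Y n. P n w * g (X n w)) - (\<integral>x. g x \<partial>N)\<bar> < e" using n0 by simp
      then show "norm ((\<Sum>w\<in>Y n. P n w * f (X n w)) - (\<integral>x. f x \<partial>N)) < r"
        using 1[of n] 2 unfolding real_norm_def e_def by linarith
    qed
  qed
qed

section \<open>The Gaussian vector\<close>

abbreviation "gauss_prod m \<equiv> PiM {..m::nat} (\<lambda>_. std_normal_distribution)"

lemma prob_std_normal: "prob_space std_normal_distribution"
  using real_dist_normal_dist by (simp add: real_distribution_def)

lemma prob_gauss_prod: "prob_space (gauss_prod m)"
  by (rule prob_space_PiM) (rule prob_std_normal)

lemma gauss_prod_component: "i \<le> m \<Longrightarrow> distr (gauss_prod m) borel (\<lambda>\<xi>. \<xi> i) = std_normal_distribution"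
proof -
  assume "i \<le> m"
  then have "distr (gauss_prod m) std_normal_distribution (\<lambda>\<xi>. \<xi> i) = std_normal_distribution"
    by (intro distr_PiM_component[of "{..m}" "\<lambda>_. std_normal_distribution" i]) (auto intro: prob_std_normal)
  moreover have "distr (gauss_prod m) std_normal_distribution (\<lambda>\<xi>. \<xi> i) = distr (gauss_prod m) borel (\<lambda>\<xi>. \<xi> i)"
    by (rule distr_cong) auto
  ultimately show ?thesis by simp
qed

lemma gauss_prod_measurable [measurable]: "i \<le> m \<Longrightarrow> (\<lambda>\<xi>. \<xi> i) \<in> borel_measurable (gauss_prod m)"
  using measurable_component_singleton[of i "{..m}" "\<lambda>_. std_normal_distribution"]
  by (simp cong: measurable_cong_sets)

lemma gauss_prod_indep: "prob_space.indep_vars (gauss_prod m) (\<lambda>_. borel) (\<lambda>i \<xi>. \<xi> i) {..m}"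
proof -
  interpret prob_space "gauss_prod m" by (rule prob_gauss_prod)
  have "distr (gauss_prod m) (PiM {..m} (\<lambda>_. borel)) (\<lambda>\<xi>. \<lambda>i\<in>{..m}. \<xi> i) = distr (gauss_prod m) (gauss_prod m) (\<lambda>\<xi>. \<xi>)"
    by (rule distr_cong) (auto simp: space_PiM PiE_restrict intro!: sets_PiM_cong)
  also have "\<dots> = gauss_prod m" by (rule distr_id)
  also have "\<dots> = PiM {..m} (\<lambda>i. distr (gauss_prod m) borel (\<lambda>\<xi>. \<xi> i))"
    by (rule PiM_cong) (auto simp: gauss_prod_component)
  finally have E: "distr (gauss_prod m) (PiM {..m} (\<lambda>_. borel)) (\<lambda>\<xi>. \<lambda>i\<in>{..m}. \<xi> i)
    = PiM {..m} (\<lambda>i. distr (gauss_prod m) borel (\<lambda>\<xi>. \<xi> i))" .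
  show ?thesis
    by (subst indep_vars_iff_distr_eq_PiM') (use E in auto)
qed

lemma std_normal_scale:
  assumes "\<sigma> > 0"
  shows "distr std_normal_distribution lborel (\<lambda>y. \<sigma> * y) = density lborel (normal_density 0 \<sigma>)"
proof -
  interpret prob_space std_normal_distribution by (rule prob_std_normal)
  have "distributed std_normal_distribution lborel (\<lambda>y. y) std_normal_density"
    unfolding distributed_def by (auto simp: distr_id2)
  from normal_density_affine[OF this, of \<sigma> 0] assms
  have "distributed std_normal_distribution lborel (\<lambda>y. \<sigma> * y) (normal_density 0 \<sigma>)" by simp
  then show ?thesis by (simp add: distributed_distr_eq_density)
qed

text \<open>The law is written as the image of one standard normal variable, so that variance 0 is
  covered as well.\<close>

lemma gauss_prod_linear:
  "distr (gauss_prod m) lborel (\<lambda>\<xi>. \<Sum>j\<le>m. a j * \<xi> j) =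
    distr std_normal_distribution lborel (\<lambda>y. sqrt (\<Sum>j\<le>m. (a j)\<^sup>2) * y)"
proof -
  interpret prob_space "gauss_prod m" by (rule prob_gauss_prod)
  interpret S: prob_space std_normal_distribution by (rule prob_std_normal)
  \<comment> \<open>Zero coefficients are discarded because sums of independent normals are
    available for positive standard deviations only; if none is left, both sides are the point mass
    at 0.\<close>
  let ?I = "{j\<in>{..m}. a j \<noteq> 0}"
  have s1: "(\<Sum>j\<le>m. a j * \<xi> j) = (\<Sum>j\<in>?I. a j * \<xi> j)" for \<xi>
    by (rule sum.mono_neutral_right) auto
  have s2: "(\<Sum>j\<le>m. (a j)\<^sup>2) = (\<Sum>j\<in>?I. \<bar>a j\<bar>\<^sup>2)"
    by (rule sum.mono_neutral_cong_right) auto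
  show ?thesis
  proof (cases "?I = {}")
    case True
    then show ?thesis unfolding s1 s2 by (simp add: distr_const S.distr_const)
  next
    case False
    have comp: "distributed (gauss_prod m) lborel (\<lambda>\<xi>. \<xi> j) std_normal_density" if "j \<le> m" for j
    proof -
      have "distr (gauss_prod m) lborel (\<lambda>\<xi>. \<xi> j) = distr (gauss_prod m) borel (\<lambda>\<xi>. \<xi> j)"
        by (rule distr_cong) auto
      then show ?thesis using gauss_prod_component[OF that] gauss_prod_measurable[OF that]
        unfolding distributed_def by auto
    qed
    have "distributed (gauss_prod m) lborel (\<lambda>\<xi>. \<Sum>j\<in>?I. a j * \<xi> j)
        (normal_density (\<Sum>j\<in>?I. 0) (sqrt (\<Sum>j\<in>?I. \<bar>a j\<bar>\<^sup>2)))"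
    proof (rule sum_indep_normal)
      show "indep_vars (\<lambda>i. borel) (\<lambda>j \<xi>. a j * \<xi> j) ?I"
      proof (rule indep_vars_compose2[where X="\<lambda>i \<xi>. \<xi> i" and M'="\<lambda>_. borel"])
        show "indep_vars (\<lambda>_. borel) (\<lambda>i \<xi>. \<xi> i) ?I"
          by (rule indep_vars_subset[OF gauss_prod_indep]) auto
      qed auto
      show "distributed (gauss_prod m) lborel (\<lambda>\<xi>. a j * \<xi> j) (normal_density 0 \<bar>a j\<bar>)" if "j \<in> ?I" for j
        using normal_density_affine[OF comp[of j], of "a j" 0] that by simp
    qed (use False in auto)
    then have "distr (gauss_prod m) lborel (\<lambda>\<xi>. \<Sum>j\<in>?I. a j * \<xi> j) =
        density lborel (normal_density 0 (sqrt (\<Sum>j\<in>?I. \<bar>a j\<bar>\<^sup>2)))"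
      by (simp add: distributed_distr_eq_density)
    moreover have "0 < (\<Sum>j\<in>?I. \<bar>a j\<bar>\<^sup>2)" using False by (intro sum_pos) auto
    ultimately show ?thesis unfolding s1 s2 using std_normal_scale by simp
  qed
qed

lemma std_normal_facts:
  "integrable std_normal_distribution (\<lambda>y. \<sigma> * y)" "(\<integral>y. \<sigma> * y \<partial>std_normal_distribution) = 0"
  "integrable std_normal_distribution (\<lambda>y. (\<sigma> * y)\<^sup>2)" "(\<integral>y. (\<sigma> * y)\<^sup>2 \<partial>std_normal_distribution) = \<sigma>\<^sup>2"
  "(\<integral>y. cos (\<sigma> * y + \<phi>) \<partial>std_normal_distribution) = cos \<phi> * exp (- \<sigma>\<^sup>2 / 2)"
proof -
  interpret prob_space std_normal_distribution by (rule prob_std_normal)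
  show "integrable std_normal_distribution (\<lambda>y. \<sigma> * y)"
    using integrable_std_normal_distribution_moment[of 1] by simp
  show "(\<integral>y. \<sigma> * y \<partial>std_normal_distribution) = 0"
    using integral_std_normal_distribution_moment_odd[of 1] by simp
  show "integrable std_normal_distribution (\<lambda>y. (\<sigma> * y)\<^sup>2)"
    using integrable_std_normal_distribution_moment[of 2] by (simp add: power_mult_distrib)
  show "(\<integral>y. (\<sigma> * y)\<^sup>2 \<partial>std_normal_distribution) = \<sigma>\<^sup>2"
    using std_normal_distribution_even_moments(1)[of 1] by (simp add: power_mult_distrib)
  have i: "integrable std_normal_distribution (\<lambda>y. iexp (\<sigma> * y))"
    by (rule integrable_const_bound[of _ 1]) auto
  have "(\<integral>y. cos (\<sigma> * y + \<phi>) \<partial>std_normal_distribution) = (\<integral>y. Re (cis \<phi> * iexp (\<sigma> * y)) \<partial>std_normal_distribution)"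
  proof (intro Bochner_Integration.integral_cong refl)
    fix y :: real
    have "cis \<phi> * iexp (\<sigma> * y) = cis (\<phi> + \<sigma> * y)" by (simp only: cis_conv_exp[symmetric] cis_mult)
    then show "cos (\<sigma> * y + \<phi>) = Re (cis \<phi> * iexp (\<sigma> * y))" by (simp only: cis.simps add.commute)
  qed
  also have "\<dots> = Re (\<integral>y. cis \<phi> * iexp (\<sigma> * y) \<partial>std_normal_distribution)"
    by (rule integral_Re) (intro integrable_mult_right i)
  also have "(\<integral>y. cis \<phi> * iexp (\<sigma> * y) \<partial>std_normal_distribution) = cis \<phi> * char std_normal_distribution \<sigma>"
    by (simp add: char_def)
  also have "Re \<dots> = cos \<phi> * exp (- \<sigma>\<^sup>2 / 2)"
    by (simp add: char_std_normal_distribution)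
  finally show "(\<integral>y. cos (\<sigma> * y + \<phi>) \<partial>std_normal_distribution) = cos \<phi> * exp (- \<sigma>\<^sup>2 / 2)" .
qed

text \<open>The variance of a variable that takes the value t i with probability q i and 0 with the
  remaining probability, i.e. of one multinomial trial.\<close>

definition mnvar :: "nat \<Rightarrow> (nat \<Rightarrow> real) \<Rightarrow> (nat \<Rightarrow> real) \<Rightarrow> real" where
  "mnvar m q t = (\<Sum>i<m. q i * (t i)\<^sup>2) - (\<Sum>i<m. q i * t i)\<^sup>2"

text \<open>The required covariance is diag(q) minus the product of q with itself. It is singular
  when the q i add up to 1, so the vector is constructed as a linear image of independent standard
  normals instead of by a density.\<close>

lemma gaussian_exists:
  assumes q0: "\<And>i. i < m \<Longrightarrow> 0 \<le> q i" and q1: "(\<Sum>i<m. q i) \<le> 1"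
  shows "\<exists>N. gaussian_law m N \<and>
    (\<forall>k<m. integrable N (\<lambda>x. x k) \<and> (\<integral>x. x k \<partial>N) = 0) \<and>
    (\<forall>k<m. \<forall>l<m. integrable N (\<lambda>x. x k * x l) \<and> (\<integral>x. x k * x l \<partial>N) = (if k = l then q k else 0) - q k * q l) \<and>
    (\<forall>t \<phi>. (\<integral>x. cos ((\<Sum>i<m. t i * x i) + \<phi>) \<partial>N) = cos \<phi> * exp (- mnvar m q t / 2))"
proof -
  define r where "r = q(m := 1 - (\<Sum>i<m. q i))"
  have r0: "0 \<le> r i" if "i \<le> m" for i using that q0 q1 by (auto simp: r_def)
  have rq: "(\<Sum>i<m. r i * g i) = (\<Sum>i<m. q i * g i)" for g by (intro sum.cong) (auto simp: r_def)
  have r1: "(\<Sum>i\<le>m. r i) = 1"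
    using rq[of "\<lambda>_. 1"] by (simp add: lessThan_Suc_atMost[symmetric] r_def)
  define Z where "Z = (\<lambda>\<xi>. \<Sum>j\<le>m. sqrt (r j) * \<xi> j :: real)"
  \<comment> \<open>With the remaining probability added as r m, the vector of the sqrt (r j) has
    length 1. The noise is projected to its orthogonal complement, and coordinate k is then
    multiplied by sqrt (r k).\<close>
  define \<Phi> where "\<Phi> = (\<lambda>\<xi> k. if k < m then sqrt (r k) * \<xi> k - r k * Z \<xi> else 0)"
  define N where "N = distr (gauss_prod m) borel \<Phi>"
  have Zm: "Z \<in> borel_measurable (gauss_prod m)" unfolding Z_def by measurable
  have \<Phi>m: "\<Phi> \<in> borel_measurable (gauss_prod m)"
  proof (rule measurable_coordinatewise_then_product)
    fix k show "(\<lambda>\<xi>. \<Phi> \<xi> k) \<in> borel_measurable (gauss_prod m)"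
      using Zm by (cases "k < m") (auto simp: \<Phi>_def)
  qed
  interpret G: prob_space "gauss_prod m" by (rule prob_gauss_prod)
  have N: "prob_space N" unfolding N_def by (rule G.prob_space_distr[OF \<Phi>m])
  interpret N: prob_space N by (rule N)
  have cm [measurable]: "(\<lambda>x. x k) \<in> borel_measurable (borel :: (nat \<Rightarrow> real) measure)" for k
    by (rule measurable_product_coordinates)
  have lm: "(\<lambda>x. \<Sum>i<m. t i * x i) \<in> borel_measurable (borel :: (nat \<Rightarrow> real) measure)" for t
    by (intro borel_measurable_sum borel_measurable_times borel_measurable_const cm)
  have lmN: "(\<lambda>x. \<Sum>i<m. t i * x i) \<in> borel_measurable N" for t
    using lm[of t] by (simp add: N_def)
  have law: "distr N lborel (\<lambda>x. \<Sum>i<m. t i * x i) = distr std_normal_distribution lborel (\<lambda>y. sqrt (mnvar m q t) * y)" for t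
  proof -
    define s where "s = (\<lambda>j. if j < m then t j else 0)"
    define b where "b = (\<Sum>i<m. q i * t i)"
    have "(\<Sum>i<m. t i * \<Phi> \<xi> i) = (\<Sum>j\<le>m. (sqrt (r j) * (s j - b)) * \<xi> j)" for \<xi>
    proof -
      have "(\<Sum>i<m. t i * \<Phi> \<xi> i) = (\<Sum>i<m. t i * sqrt (r i) * \<xi> i) - (\<Sum>i<m. r i * t i) * Z \<xi>"
        by (simp add: \<Phi>_def sum_subtractf right_diff_distrib sum_distrib_left algebra_simps)
      also have "(\<Sum>i<m. t i * sqrt (r i) * \<xi> i) = (\<Sum>j\<le>m. s j * sqrt (r j) * \<xi> j)"
        by (simp add: lessThan_Suc_atMost[symmetric] s_def)
      finally show ?thesis unfolding rq b_def[symmetric] Z_def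
        by (simp add: sum_distrib_left sum_subtractf[symmetric] algebra_simps)
    qed
    then have "distr N lborel (\<lambda>x. \<Sum>i<m. t i * x i) = distr (gauss_prod m) lborel (\<lambda>\<xi>. \<Sum>j\<le>m. (sqrt (r j) * (s j - b)) * \<xi> j)"
      unfolding N_def using lm[of t] by (subst distr_distr[OF _ \<Phi>m]) (auto simp: o_def)
    also have "\<dots> = distr std_normal_distribution lborel (\<lambda>y. sqrt (\<Sum>j\<le>m. (sqrt (r j) * (s j - b))\<^sup>2) * y)"
      by (rule gauss_prod_linear)
    also have "(\<Sum>j\<le>m. (sqrt (r j) * (s j - b))\<^sup>2) = mnvar m q t"
    proof -
      have "(\<Sum>j\<le>m. (sqrt (r j) * (s j - b))\<^sup>2) = (\<Sum>j\<le>m. r j * (s j)\<^sup>2 - 2 * b * (r j * s j) + b\<^sup>2 * r j)"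
        by (intro sum.cong refl) (simp add: power_mult_distrib r0 power2_diff algebra_simps)
      also have "\<dots> = (\<Sum>j\<le>m. r j * (s j)\<^sup>2) - 2 * b * (\<Sum>j\<le>m. r j * s j) + b\<^sup>2 * (\<Sum>j\<le>m. r j)"
        by (simp add: sum.distrib sum_subtractf sum_distrib_left)
      also have "(\<Sum>j\<le>m. r j * (s j)\<^sup>2) = (\<Sum>i<m. q i * (t i)\<^sup>2)"
        using rq[of "\<lambda>i. (t i)\<^sup>2"] by (simp add: lessThan_Suc_atMost[symmetric] s_def)
      also have "(\<Sum>j\<le>m. r j * s j) = b"
        using rq[of t] by (simp add: lessThan_Suc_atMost[symmetric] s_def b_def)
      finally show ?thesis by (simp add: r1 mnvar_def b_def power2_eq_square)
    qed
    finally show ?thesis .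
  qed
  have mv0: "0 \<le> mnvar m q t" for t
  proof -
    have "(\<Sum>i<m. q i * t i)\<^sup>2 = (\<Sum>i<m. sqrt (q i) * (sqrt (q i) * t i))\<^sup>2"
      by (intro arg_cong[of _ _ "\<lambda>z. z\<^sup>2"] sum.cong refl) (simp add: mult.assoc[symmetric] q0)
    also have "\<dots> \<le> (\<Sum>i<m. (sqrt (q i))\<^sup>2) * (\<Sum>i<m. (sqrt (q i) * t i)\<^sup>2)"
      by (rule Cauchy_Schwarz_ineq_sum)
    also have "\<dots> = (\<Sum>i<m. q i) * (\<Sum>i<m. q i * (t i)\<^sup>2)"
      by (intro arg_cong2[where f="(*)"] sum.cong refl) (simp_all add: q0 power_mult_distrib)
    also have "\<dots> \<le> 1 * (\<Sum>i<m. q i * (t i)\<^sup>2)"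
      using q0 q1 by (intro mult_right_mono sum_nonneg) auto
    finally show ?thesis by (simp add: mnvar_def)
  qed
  have lmL: "(\<lambda>x. \<Sum>i<m. t i * x i) \<in> measurable N lborel" for t using lmN[of t] by simp
  have tr: "(\<integral>x. g (\<Sum>i<m. t i * x i) \<partial>N) = (\<integral>y. g (sqrt (mnvar m q t) * y) \<partial>std_normal_distribution)"
    if g: "g \<in> borel_measurable borel" for t and g :: "real \<Rightarrow> real"
  proof -
    have "(\<integral>x. g (\<Sum>i<m. t i * x i) \<partial>N) = (\<integral>u. g u \<partial>distr N lborel (\<lambda>x. \<Sum>i<m. t i * x i))"
      by (rule integral_distr[symmetric, OF lmL]) (use g in simp)
    also have "\<dots> = (\<integral>y. g (sqrt (mnvar m q t) * y) \<partial>std_normal_distribution)"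
      unfolding law by (rule integral_distr) (use g in auto)
    finally show ?thesis .
  qed
  have ti: "integrable N (\<lambda>x. g (\<Sum>i<m. t i * x i))"
    if g: "g \<in> borel_measurable borel" "integrable std_normal_distribution (\<lambda>y. g (sqrt (mnvar m q t) * y))"
    for t and g :: "real \<Rightarrow> real"
  proof -
    have "integrable (distr N lborel (\<lambda>x. \<Sum>i<m. t i * x i)) g"
      unfolding law by (subst integrable_distr_eq) (use g in auto)
    then show ?thesis by (subst (asm) integrable_distr_eq[OF lmL]) (use g in auto)
  qed
  have lin1: "(\<Sum>i<m. (if i = k then c else 0) * x i) = c * x k" if "k < m" for k c and x :: "nat \<Rightarrow> real"
    using that by (simp add: if_distrib[of "\<lambda>z. z * _"] cong: if_cong)
  have sq: "integrable N (\<lambda>x. (\<Sum>i<m. t i * x i)\<^sup>2)" "(\<integral>x. (\<Sum>i<m. t i * x i)\<^sup>2 \<partial>N) = mnvar m q t" for t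
  proof -
    show "integrable N (\<lambda>x. (\<Sum>i<m. t i * x i)\<^sup>2)"
      by (rule ti[of "\<lambda>u. u\<^sup>2"]) (auto intro: std_normal_facts)
    show "(\<integral>x. (\<Sum>i<m. t i * x i)\<^sup>2 \<partial>N) = mnvar m q t"
      by (subst tr[of "\<lambda>u. u\<^sup>2"]) (auto simp: std_normal_facts(4) mv0)
  qed
  have c1: "integrable N (\<lambda>x. x k) \<and> (\<integral>x. x k \<partial>N) = 0" if k: "k < m" for k
    using ti[of "\<lambda>u. u" "\<lambda>i. if i = k then 1 else 0"] tr[of "\<lambda>u. u" "\<lambda>i. if i = k then 1 else 0"]
      std_normal_facts(1,2) unfolding lin1[OF k] by simp
  have mvk: "mnvar m q (\<lambda>i. (if i = k then 1 else 0) + (if i = l then 1 else 0)) =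
      q k + q l + 2 * (if k = l then q k else 0) - (q k + q l)\<^sup>2" if kl: "k < m" "l < m" for k l
  proof -
    have e1: "(\<Sum>i<m. q i * ((if i = k then 1 else 0) + (if i = l then 1 else 0))) = q k + q l"
      using kl by (simp add: distrib_left sum.distrib if_distrib[of "\<lambda>z. _ * z"] cong: if_cong)
    have "(\<Sum>i<m. q i * ((if i = k then 1 else 0) + (if i = l then 1 else 0))\<^sup>2) =
        (\<Sum>i<m. (if i = k then q k else 0) + (if i = l then q l else 0) + (if i = k then 2 * (if k = l then q k else 0) else 0))"
      by (intro sum.cong refl) (auto simp: power2_eq_square)
    also have "\<dots> = q k + q l + 2 * (if k = l then q k else 0)"
      using kl by (simp add: sum.distrib)
    finally show ?thesis unfolding mnvar_def e1 by simp
  qed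
  have mv1: "mnvar m q (\<lambda>i. if i = k then 1 else 0) = q k - (q k)\<^sup>2" if k: "k < m" for k
    using k by (simp add: mnvar_def if_distrib[of "\<lambda>z. _ * z"] if_distrib[of "\<lambda>z. z ^ 2"] cong: if_cong)
  have c2: "integrable N (\<lambda>x. x k * x l) \<and> (\<integral>x. x k * x l \<partial>N) = (if k = l then q k else 0) - q k * q l"
    if kl: "k < m" "l < m" for k l
  proof -
    have s1: "integrable N (\<lambda>x. (x j)\<^sup>2)" "(\<integral>x. (x j)\<^sup>2 \<partial>N) = q j - (q j)\<^sup>2" if "j < m" for j
      using sq[of "\<lambda>i. if i = j then 1 else 0"] unfolding lin1[OF that] mv1[OF that] by simp_all
    have l2: "(\<Sum>i<m. ((if i = k then 1 else 0) + (if i = l then 1 else 0)) * x i) = x k + x l" for x :: "nat \<Rightarrow> real"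
      unfolding distrib_right sum.distrib lin1[OF kl(1)] lin1[OF kl(2)] by simp
    have s2: "integrable N (\<lambda>x. (x k + x l)\<^sup>2)"
      "(\<integral>x. (x k + x l)\<^sup>2 \<partial>N) = q k + q l + 2 * (if k = l then q k else 0) - (q k + q l)\<^sup>2"
      using sq[of "\<lambda>i. (if i = k then 1 else 0) + (if i = l then 1 else 0)"] unfolding l2 mvk[OF kl] by simp_all
    \<comment> \<open>Mixed moments come from second moments of linear forms by
      polarisation.\<close>
    have e: "x k * x l = ((x k + x l)\<^sup>2 - (x k)\<^sup>2 - (x l)\<^sup>2) / 2" for x :: "nat \<Rightarrow> real"
      by (simp add: power2_eq_square algebra_simps)
    have "integrable N (\<lambda>x. x k * x l)" unfolding e using s1 s2(1) kl by auto
    moreover have "(\<integral>x. x k * x l \<partial>N) = ((q k + q l + 2 * (if k = l then q k else 0) - (q k + q l)\<^sup>2)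
        - (q k - (q k)\<^sup>2) - (q l - (q l)\<^sup>2)) / 2"
      unfolding e using s1 s2 kl by simp
    ultimately show ?thesis by (simp add: power2_eq_square algebra_simps)
  qed
  have c3: "(\<integral>x. cos ((\<Sum>i<m. t i * x i) + \<phi>) \<partial>N) = cos \<phi> * exp (- mnvar m q t / 2)" for t \<phi>
    by (subst tr[of "\<lambda>u. cos (u + \<phi>)"]) (auto simp: std_normal_facts(5) mv0)
  have "gaussian_law m N"
    unfolding gaussian_law_def
  proof (intro conjI allI N)
    show "sets N = sets borel" by (simp add: N_def)
    show "AE x in N. \<forall>i\<ge>m. x i = 0"
    proof -
      have "{x. \<forall>i\<ge>m. x i = (0::real)} \<in> sets borel"
      proof -
        have "{x. \<forall>i\<ge>m. x i = (0::real)} = (\<Inter>i\<in>{m..}. (\<lambda>x. x i) -` {0} \<inter> space borel)" by auto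
        moreover have "\<dots> \<in> sets borel"
          using measurable_sets[OF cm, of "{0}" ] by (intro sets.countable_INT') auto
        ultimately show ?thesis by simp
      qed
      then show ?thesis unfolding N_def by (subst AE_distr_iff[OF \<Phi>m]) (auto simp: \<Phi>_def)
    qed
    show "real_normal_law (distr N lborel (\<lambda>x. \<Sum>i<m. t i * x i))" for t
    proof (cases "mnvar m q t = 0")
      case True
      interpret S: prob_space std_normal_distribution by (rule prob_std_normal)
      have "(\<lambda>y. sqrt (mnvar m q t) * y) = (\<lambda>_. 0)" using True by simp
      then have "distr std_normal_distribution lborel (\<lambda>y. sqrt (mnvar m q t) * y) = return lborel 0"
        using S.distr_const[of "0::real" lborel] by simp
      then show ?thesis unfolding law real_normal_law_def by (intro disjI2 exI[of _ 0])
    next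
      case False
      then have "sqrt (mnvar m q t) > 0" using mv0[of t] by simp
      then show ?thesis unfolding law real_normal_law_def using std_normal_scale by blast
    qed
  qed
  then show ?thesis using c1 c2 c3 by blast
qed

section \<open>Multinomial fluctuations\<close>

lemma quadratic_char_approx: "cmod (iexp x - (1 + \<i> * x - x\<^sup>2 / 2)) \<le> \<bar>x\<bar> ^ 3"
proof -
  have "(\<Sum>k\<le>2. (\<i> * complex_of_real x) ^ k / fact k) = 1 + \<i> * x - x\<^sup>2 / 2"
    by (simp add: numeral_2_eq_2 power2_eq_square algebra_simps)
  then have "cmod (iexp x - (1 + \<i> * x - x\<^sup>2 / 2)) \<le> \<bar>x\<bar> ^ Suc 2 / fact (Suc 2)"
    using iexp_approx1[of x 2] by simp
  also have "\<dots> \<le> \<bar>x\<bar> ^ 3" by (simp add: fact_numeral)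
  finally show ?thesis .
qed

text \<open>The characteristic function u of one centred trial is compared with 1 - V / (2 n) at
  order n^(-3/2). For numbers in the unit disc the n-th powers differ by at most n times as much, so
  the error tends to 0.\<close>

lemma discrete_clt:
  fixes v p :: "nat \<Rightarrow> real"
  assumes p: "\<And>i. i \<le> m \<Longrightarrow> 0 \<le> p i" "(\<Sum>i\<le>m. p i) = 1" and mean: "(\<Sum>i\<le>m. p i * v i) = 0"
  shows "(\<lambda>n. (\<Sum>i\<le>m. p i * iexp (v i / sqrt (real n))) ^ n) \<longlonglongrightarrow>
    complex_of_real (exp (- (\<Sum>i\<le>m. p i * (v i)\<^sup>2) / 2))"
proof -
  define V where "V = (\<Sum>i\<le>m. p i * (v i)\<^sup>2)"
  define C where "C = (\<Sum>i\<le>m. p i * \<bar>v i\<bar> ^ 3)"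
  define u where "u = (\<lambda>n. \<Sum>i\<le>m. p i * iexp (v i / sqrt (real n)))"
  have V0: "0 \<le> V" unfolding V_def using p by (intro sum_nonneg mult_nonneg_nonneg) auto
  have un: "norm (u n) \<le> 1" for n
  proof -
    have "norm (u n) \<le> (\<Sum>i\<le>m. norm (p i * iexp (v i / sqrt (real n))))" unfolding u_def by (rule norm_sum)
    also have "\<dots> = (\<Sum>i\<le>m. p i)" by (intro sum.cong refl) (use p in \<open>auto simp: norm_mult\<close>)
    finally show ?thesis using p by simp
  qed
  have approx: "norm (u n - complex_of_real (1 + - V / 2 / real n)) \<le> C / (real n * sqrt (real n))" if n: "n \<ge> 1" for n
  proof -
    let ?s = "sqrt (real n)"
    have s: "?s > 0" "?s\<^sup>2 = real n" using n by auto
    have "complex_of_real (1 + - V / 2 / real n) = (\<Sum>i\<le>m. p i * (1 + \<i> * (v i / ?s) - (v i / ?s)\<^sup>2 / 2))"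
    proof -
      have "(\<Sum>i\<le>m. p i * (1 + \<i> * (v i / ?s) - (v i / ?s)\<^sup>2 / 2)) =
         of_real (\<Sum>i\<le>m. p i) + \<i> / ?s * of_real (\<Sum>i\<le>m. p i * v i) - of_real (\<Sum>i\<le>m. p i * (v i)\<^sup>2) / (2 * ?s\<^sup>2)"
        by (simp add: sum.distrib sum_subtractf sum_distrib_left sum_divide_distrib algebra_simps power_divide)
      then show ?thesis using s unfolding p(2) mean V_def[symmetric] by simp
    qed
    then have "u n - complex_of_real (1 + - V / 2 / real n) =
        (\<Sum>i\<le>m. p i * (iexp (v i / ?s) - (1 + \<i> * (v i / ?s) - (v i / ?s)\<^sup>2 / 2)))"
      by (simp only: u_def sum_subtractf[symmetric] right_diff_distrib)
    also have "norm \<dots> \<le> (\<Sum>i\<le>m. p i * \<bar>v i / ?s\<bar> ^ 3)"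
    proof (rule sum_norm_le)
      fix i assume "i \<in> {..m}"
      then have "0 \<le> p i" using p by simp
      then show "norm (p i * (iexp (v i / ?s) - (1 + \<i> * (v i / ?s) - (v i / ?s)\<^sup>2 / 2))) \<le> p i * \<bar>v i / ?s\<bar> ^ 3"
        unfolding norm_mult using quadratic_char_approx[of "v i / ?s"] by (simp add: mult_left_mono)
    qed
    also have "\<dots> = C / ?s ^ 3"
      unfolding C_def sum_divide_distrib using s by (intro sum.cong refl) (simp add: power_divide abs_divide)
    also have "?s ^ 3 = real n * ?s" using s by (simp add: power3_eq_cube power2_eq_square)
    finally show ?thesis .
  qed
  have w: "(\<lambda>n. complex_of_real ((1 + - V / 2 / real n) ^ n)) \<longlonglongrightarrow> complex_of_real (exp (- V / 2))"
    by (intro tendsto_of_real tendsto_exp_limit_sequentially)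
  have "(\<lambda>n. u n ^ n - complex_of_real ((1 + - V / 2 / real n) ^ n)) \<longlonglongrightarrow> 0"
  proof (rule Lim_null_comparison)
    \<comment> \<open>For n at least V the number 1 - V / (2 n) lies in the unit disc.\<close>
    obtain n0 where n0: "real n0 \<ge> V" by (meson real_arch_simple)
    show "\<forall>\<^sub>F n in sequentially. norm (u n ^ n - complex_of_real ((1 + - V / 2 / real n) ^ n)) \<le> C / sqrt (real n)"
      using eventually_ge_at_top[of "max 1 n0"]
    proof eventually_elim
      case (elim n)
      then have n: "n \<ge> 1" "real n \<ge> V" using n0 by auto
      have "V / 2 / real n \<le> 1" using n V0 by (simp add: divide_le_eq)
      moreover have "0 \<le> V / 2 / real n" using V0 by simp
      ultimately have "\<bar>1 + - V / 2 / real n\<bar> \<le> 1" by simp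
      then have wn: "norm (complex_of_real (1 + - V / 2 / real n)) \<le> 1" by (simp only: norm_of_real)
      have "norm (u n ^ n - complex_of_real (1 + - V / 2 / real n) ^ n) \<le>
          real n * norm (u n - complex_of_real (1 + - V / 2 / real n))"
        by (rule norm_power_diff[OF un wn])
      also have "\<dots> \<le> real n * (C / (real n * sqrt (real n)))"
        by (intro mult_left_mono approx n) simp
      also have "\<dots> = C / sqrt (real n)" using n by simp
      finally show ?case by simp
    qed
    show "(\<lambda>n. C / sqrt (real n)) \<longlonglongrightarrow> 0"
      by (intro real_tendsto_divide_at_top[OF tendsto_const] filterlim_compose[OF sqrt_at_top] filterlim_real_sequentially)
  qed
  from tendsto_add[OF this w] show ?thesis by (simp add: u_def V_def)
qed

text \<open>The unselected letters form a further cell m with probability \<rho> and value 0.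
  Subtracting the mean b from all values absorbs the centring factor into the n-th power.\<close>

lemma multinomial_char:
  fixes q \<theta> :: "nat \<Rightarrow> real"
  assumes q: "\<And>i. i < m \<Longrightarrow> 0 \<le> q i" and \<rho>: "0 \<le> \<rho>" "(\<Sum>i<m. q i) + \<rho> = 1"
  shows "(\<lambda>n. iexp (- sqrt (real n) * (\<Sum>i<m. q i * \<theta> i)) * ((\<Sum>i<m. q i * iexp (\<theta> i / sqrt (real n))) + \<rho>) ^ n)
    \<longlonglongrightarrow> complex_of_real (exp (- mnvar m q \<theta> / 2))"
proof -
  define b where "b = (\<Sum>i<m. q i * \<theta> i)"
  define p where "p = q(m := \<rho>)"
  define v where "v = (\<lambda>i. (if i < m then \<theta> i else 0) - b)"
  have pq: "(\<Sum>i\<le>m. p i * g i) = (\<Sum>i<m. q i * g i) + \<rho> * g m" for g :: "nat \<Rightarrow> real"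
    by (simp add: lessThan_Suc_atMost[symmetric] p_def)
  have pqc: "(\<Sum>i\<le>m. complex_of_real (p i) * g i) = (\<Sum>i<m. q i * g i) + \<rho> * g m" for g :: "nat \<Rightarrow> complex"
    by (simp add: lessThan_Suc_atMost[symmetric] p_def)
  have p1: "(\<Sum>i\<le>m. p i) = 1" using pq[of "\<lambda>_. 1"] \<rho> by simp
  have p0: "0 \<le> p i" if "i \<le> m" for i using that q \<rho> by (auto simp: p_def)
  have mean: "(\<Sum>i\<le>m. p i * v i) = 0"
  proof -
    have "(\<Sum>i\<le>m. p i * v i) = (\<Sum>i<m. q i * (\<theta> i - b)) + \<rho> * (0 - b)"
      by (simp only: pq v_def) simp
    also have "(\<Sum>i<m. q i * (\<theta> i - b)) = (\<Sum>i<m. q i * \<theta> i) - (\<Sum>i<m. q i * b)"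
      by (simp only: right_diff_distrib sum_subtractf)
    also have "(\<Sum>i<m. q i * b) = (\<Sum>i<m. q i) * b" by (rule sum_distrib_right[symmetric])
    also have "(\<Sum>i<m. q i * \<theta> i) = b" by (simp only: b_def)
    also have "(\<Sum>i<m. q i) = 1 - \<rho>" using \<rho>(2) by linarith
    finally show ?thesis by (simp only: left_diff_distrib) simp
  qed
  have var: "(\<Sum>i\<le>m. p i * (v i)\<^sup>2) = mnvar m q \<theta>"
  proof -
    have "(\<Sum>i\<le>m. p i * (v i)\<^sup>2) = (\<Sum>i<m. q i * (\<theta> i - b)\<^sup>2) + \<rho> * b\<^sup>2" by (simp add: pq v_def)
    also have "(\<Sum>i<m. q i * (\<theta> i - b)\<^sup>2) = (\<Sum>i<m. q i * (\<theta> i)\<^sup>2 - 2 * b * (q i * \<theta> i) + b\<^sup>2 * q i)"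
      by (intro sum.cong refl) (simp add: power2_diff algebra_simps)
    also have "\<dots> = (\<Sum>i<m. q i * (\<theta> i)\<^sup>2) - 2 * b * b + b\<^sup>2 * (\<Sum>i<m. q i)"
      by (simp add: sum.distrib sum_subtractf sum_distrib_left b_def)
    also have "\<dots> + \<rho> * b\<^sup>2 = (\<Sum>i<m. q i * (\<theta> i)\<^sup>2) - 2 * b * b + b\<^sup>2 * ((\<Sum>i<m. q i) + \<rho>)"
      by (simp add: algebra_simps)
    finally show ?thesis unfolding \<rho>(2) by (simp add: mnvar_def b_def[symmetric] power2_eq_square)
  qed
  have E: "(\<Sum>i\<le>m. p i * iexp (v i / sqrt (real n))) ^ n =
      iexp (- sqrt (real n) * b) * ((\<Sum>i<m. q i * iexp (\<theta> i / sqrt (real n))) + \<rho>) ^ n" if n: "n \<ge> 1" for n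
  proof -
    let ?s = "sqrt (real n)"
    have split: "iexp ((x - b) / ?s) = iexp (- b / ?s) * iexp (x / ?s)" for x
    proof -
      have "(x - b) / ?s = - b / ?s + x / ?s" by (simp add: diff_divide_distrib)
      then have "\<i> * complex_of_real ((x - b) / ?s) = \<i> * complex_of_real (- b / ?s) + \<i> * complex_of_real (x / ?s)"
        by (simp only: of_real_add distrib_left)
      then show ?thesis by (simp only: exp_add)
    qed
    have "(\<Sum>i\<le>m. p i * iexp (v i / ?s)) = (\<Sum>i<m. q i * iexp ((\<theta> i - b) / ?s)) + \<rho> * iexp ((0 - b) / ?s)"
      unfolding pqc by (simp add: v_def)
    also have "\<dots> = iexp (- b / ?s) * ((\<Sum>i<m. q i * iexp (\<theta> i / ?s)) + \<rho>)"
      unfolding split by (simp add: sum_distrib_left distrib_left mult.commute mult.left_commute)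
    finally have "(\<Sum>i\<le>m. p i * iexp (v i / ?s)) ^ n = iexp (- b / ?s) ^ n * ((\<Sum>i<m. q i * iexp (\<theta> i / ?s)) + \<rho>) ^ n"
      by (simp only: power_mult_distrib)
    also have "iexp (- b / ?s) ^ n = iexp (- ?s * b)"
    proof -
      have "real n / ?s = ?s" by (rule real_div_sqrt) simp
      then have "real n * (- b / ?s) = - ?s * b" by (metis minus_mult_left mult.commute times_divide_eq_left times_divide_eq_right mult_minus_right)
      then have "of_nat n * (\<i> * complex_of_real (- b / ?s)) = \<i> * complex_of_real (- ?s * b)"
        by (metis mult.left_commute of_real_mult of_real_of_nat_eq)
      then show ?thesis by (simp only: exp_of_nat_mult[symmetric])
    qed
    finally show ?thesis .
  qed
  have L: "(\<lambda>n. (\<Sum>i\<le>m. p i * iexp (v i / sqrt (real n))) ^ n) \<longlonglongrightarrow> complex_of_real (exp (- mnvar m q \<theta> / 2))"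
    using discrete_clt[OF p0 p1 mean] unfolding var .
  show ?thesis unfolding b_def[symmetric]
    by (rule Lim_transform_eventually[OF L eventually_sequentiallyI[of 1, OF E]])
qed

section \<open>Elementary inequalities and the law of a single letter count\<close>

lemma cos_lipschitz: "\<bar>cos a - cos b\<bar> \<le> \<bar>a - b :: real\<bar>"
proof -
  have "\<bar>cos a - cos b\<bar> = 2 * \<bar>sin ((a + b) / 2)\<bar> * \<bar>sin ((b - a) / 2)\<bar>"
    unfolding cos_diff_cos abs_mult by simp
  also have "\<dots> \<le> 2 * 1 * \<bar>(b - a) / 2\<bar>"
    by (intro mult_mono abs_sin_x_le_abs_x) auto
  finally show ?thesis by simp
qed

text \<open>For negative s the bound is multiplied by exp (- s), which is at least 1 - s; the
  product with 1 - s is 1 - s^3, at least 1.\<close>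

lemma exp_le_quadratic:
  fixes s :: real
  assumes "\<bar>s\<bar> \<le> 1"
  shows "exp s \<le> 1 + s + s\<^sup>2"
proof (cases "0 \<le> s")
  case True then show ?thesis using exp_bound[of s] assms by simp
next
  case False
  have "1 \<le> (1 + s + s\<^sup>2) * (1 - s)"
  proof -
    have "(1 + s + s\<^sup>2) * (1 - s) = 1 - s ^ 3" by (simp add: algebra_simps power2_eq_square power3_eq_cube)
    moreover have "s ^ 3 \<le> 0" using False by (simp add: power_le_zero_eq)
    ultimately show ?thesis by simp
  qed
  also have "(1 + s + s\<^sup>2) * (1 - s) \<le> (1 + s + s\<^sup>2) * exp (- s)"
  proof (rule mult_left_mono)
    show "1 - s \<le> exp (- s)" using exp_ge_add_one_self[of "- s"] by simp
    show "0 \<le> 1 + s + s\<^sup>2" using assms by (intro add_nonneg_nonneg[OF _ zero_le_power2]) linarith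
  qed
  finally have "1 * exp s \<le> (1 + s + s\<^sup>2) * exp (- s) * exp s" by (intro mult_right_mono) auto
  then show ?thesis by (simp add: mult.assoc exp_add[symmetric])
qed

lemma cweight_genfun_single:
  fixes s :: real
  assumes h: "hseq h" and len: "length ks = length xs" and one: "sum_list xs + h 1 = 1" and k: "k < length xs"
  shows "(\<Sum>\<omega>\<in>chainsp ks n. cweight xs h n \<omega> * s ^ (counts (fst \<omega>) (snd \<omega>) ! k)) = (1 + (s - 1) * (xs ! k)) ^ n"
proof -
  let ?t = "\<lambda>i. if i = k then complex_of_real s else 1"
  have p: "(\<Prod>i<length xs. ?t i ^ N i) = of_real (s ^ N k)" for N :: "nat \<Rightarrow> nat"
    using k by (subst prod.remove[of _ k]) (auto intro!: prod.neutral)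
  have "of_real (\<Sum>\<omega>\<in>chainsp ks n. cweight xs h n \<omega> * s ^ (counts (fst \<omega>) (snd \<omega>) ! k)) =
      (\<Sum>\<omega>\<in>chainsp ks n. complex_of_real (cweight xs h n \<omega>) * (\<Prod>i<length xs. ?t i ^ (counts (fst \<omega>) (snd \<omega>) ! i)))"
    unfolding p by simp
  also have "\<dots> = ((\<Sum>i<length xs. of_real (xs ! i) * ?t i) + of_real (h 1)) ^ n"
    by (rule cweight_genfun[OF h len])
  also have "(\<Sum>i<length xs. of_real (xs ! i) * ?t i) = (\<Sum>i<length xs. of_real (xs ! i) + (if i = k then of_real ((s - 1) * xs ! k) else 0))"
    by (intro sum.cong refl) (auto simp: algebra_simps)
  also have "\<dots> = of_real (sum_list xs + (s - 1) * xs ! k)"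
    using k by (simp add: sum.distrib sum_list_sum_nth atLeast0LessThan)
  also have "(of_real (sum_list xs + (s - 1) * xs ! k) + of_real (h 1)) ^ n = complex_of_real ((1 + (s - 1) * (xs ! k)) ^ n)"
  proof -
    have "sum_list xs + (s - 1) * xs ! k + h 1 = 1 + (s - 1) * xs ! k" using one by simp
    then show ?thesis by (simp only: of_real_add[symmetric] of_real_power[symmetric])
  qed
  finally show ?thesis by (simp only: of_real_eq_iff)
qed

lemma cweight_mean_single:
  assumes h: "hseq h" and len: "length ks = length xs" and one: "sum_list xs + h 1 = 1" and k: "k < length xs"
  shows "(\<Sum>\<omega>\<in>chainsp ks n. cweight xs h n \<omega> * real (counts (fst \<omega>) (snd \<omega>) ! k)) = real n * xs ! k"
proof -
  let ?N = "\<lambda>\<omega>. counts (fst \<omega>) (snd \<omega>) ! k"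
  have "((\<lambda>t. \<Sum>\<omega>\<in>chainsp ks n. cweight xs h n \<omega> * t ^ ?N \<omega>) has_real_derivative
      (\<Sum>\<omega>\<in>chainsp ks n. cweight xs h n \<omega> * (real (?N \<omega>) * 1 ^ (?N \<omega> - 1)))) (at 1)"
    by (intro derivative_eq_intros DERIV_sum DERIV_cmult refl | simp)+
  then have 1: "((\<lambda>t. (1 + (t - 1) * xs ! k) ^ n) has_real_derivative
      (\<Sum>\<omega>\<in>chainsp ks n. cweight xs h n \<omega> * real (?N \<omega>))) (at 1)"
    unfolding cweight_genfun_single[OF h len one k] by simp
  have "((\<lambda>t. (1 + (t - 1) * xs ! k) ^ n) has_real_derivative (real n * (1 + (1 - 1) * xs ! k) ^ (n - 1) * xs ! k)) (at 1)"
    by (auto intro!: derivative_eq_intros)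
  from DERIV_unique[OF 1 this] show ?thesis by simp
qed

section \<open>The central limit theorem\<close>

lemma abs_le_exp_sum: "\<bar>x\<bar> \<le> exp x + exp (- x :: real)"
proof (cases "0 \<le> x")
  case True
  then show ?thesis using exp_ge_add_one_self[of x] exp_gt_zero[of "- x"] by linarith
next
  case False
  then show ?thesis using exp_ge_add_one_self[of "- x"] exp_gt_zero[of x] by linarith
qed

text \<open>The strict inequalities include the last selected letter against the first omitted one:
  the partial sum of all K (or L) deviations is controlled by that difference of squares.\<close>

locale thoma_strict = thoma +
  fixes K L :: nat
  assumes strict_rows: "\<And>i. i < K \<Longrightarrow> \<alpha> (Suc i) < \<alpha> i"
    and strict_cols: "\<And>j. j < L \<Longrightarrow> \<beta> (Suc j) < \<beta> j"
begin

definition "m = K + L"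
definition "q = (\<lambda>i. letters K L ! i)"
definition "\<rho> = hrest K L 1"

abbreviation "\<Omega>n \<equiv> \<Omega> K L"
abbreviation "Wn \<equiv> W K L"

definition cnt :: "(nat \<Rightarrow> nat) \<times> (nat \<Rightarrow> nat) list \<Rightarrow> nat \<Rightarrow> nat" where
  "cnt \<omega> i = counts (fst \<omega>) (snd \<omega>) ! i"

lemma m_length: "length (letters K L) = m"
  using coupling_basic(3) by (simp add: m_def)

lemma q_row: "i < K \<Longrightarrow> q i = \<alpha> i" and q_col: "j < L \<Longrightarrow> q (K + j) = \<beta> j"
  by (simp_all add: q_def letters_def nth_append)

lemma q_nonneg: "i < m \<Longrightarrow> 0 \<le> q i"
  using letters_nonneg[of i K L] by (simp add: q_def m_length)

lemma q_sum: "(\<Sum>i<m. q i) + \<rho> = 1" and \<rho>_nonneg: "0 \<le> \<rho>"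
  using hrest_1[of K L] m_length by (simp_all add: q_def \<rho>_def sum_list_sum_nth atLeast0LessThan)

lemma cnt_mean:
  assumes "k < m"
  shows "(\<Sum>\<omega>\<in>\<Omega>n n. Wn n \<omega> * real (cnt \<omega> k)) = real n * q k"
  unfolding cnt_def q_def
  by (rule cweight_mean_single[OF coupling_basic(2,1) hrest_1(1)]) (use assms m_length in simp)

lemma cnt_genfun:
  assumes "k < m"
  shows "(\<Sum>\<omega>\<in>\<Omega>n n. Wn n \<omega> * s ^ cnt \<omega> k) = (1 + (s - 1) * q k) ^ n"
  unfolding cnt_def q_def
  by (rule cweight_genfun_single[OF coupling_basic(2,1) hrest_1(1)]) (use assms m_length in simp)

section \<open>Normalised letter counts: moments and limit law\<close>

definition count_dev :: "nat \<Rightarrow> (nat \<Rightarrow> nat) \<times> (nat \<Rightarrow> nat) list \<Rightarrow> nat \<Rightarrow> real" where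
  "count_dev n \<omega> k = (real (cnt \<omega> k) - real n * q k) / sqrt (real n)"

definition shape_dev :: "nat \<Rightarrow> (nat \<Rightarrow> nat) \<Rightarrow> nat \<Rightarrow> real" where
  "shape_dev n f k = (if k < K then (real (f k) - \<alpha> k * real n) / sqrt (real n)
     else if k < m then (real (colen f (k - K)) - \<beta> (k - K) * real n) / sqrt (real n) else 0)"

lemma count_dev_exp_moment:
  assumes k: "k < m" and n: "n \<ge> 1" and \<epsilon>: "\<epsilon> = 1 \<or> \<epsilon> = - (1::real)"
  shows "(\<Sum>\<omega>\<in>\<Omega>n n. Wn n \<omega> * exp (\<epsilon> * count_dev n \<omega> k)) \<le> exp 1"
proof -
  \<comment> \<open>This choice gives s^2 * n = 1. The centring cancels the linear term of the
    exponent, and the quadratic one leaves exp (q k), at most exp 1, for both signs.\<close>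
  define s where "s = \<epsilon> / sqrt (real n)"
  have s2: "s\<^sup>2 * real n = 1" using \<epsilon> n by (auto simp: s_def power_divide)
  have "sqrt (real n) \<ge> 1" using n by simp
  then have s1: "\<bar>s\<bar> \<le> 1" using \<epsilon> by (auto simp: s_def abs_divide)
  have q1: "q k \<le> 1"
  proof -
    have "q k \<le> (\<Sum>i<m. q i)" by (rule member_le_sum) (use k q_nonneg in auto)
    then show ?thesis using q_sum \<rho>_nonneg by linarith
  qed
  have e: "exp (\<epsilon> * count_dev n \<omega> k) = exp (- s * real n * q k) * exp s ^ cnt \<omega> k" for \<omega>
  proof -
    have "\<epsilon> * count_dev n \<omega> k = - s * real n * q k + real (cnt \<omega> k) * s"
      by (simp add: count_dev_def s_def diff_divide_distrib algebra_simps)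
    then show ?thesis by (simp only: exp_add exp_of_nat_mult)
  qed
  have "(\<Sum>\<omega>\<in>\<Omega>n n. Wn n \<omega> * exp (\<epsilon> * count_dev n \<omega> k)) = exp (- s * real n * q k) * (\<Sum>\<omega>\<in>\<Omega>n n. Wn n \<omega> * exp s ^ cnt \<omega> k)"
    unfolding e sum_distrib_left by (intro sum.cong refl) (simp only: mult.left_commute)
  also have "\<dots> = exp (- s * real n * q k) * (1 + (exp s - 1) * q k) ^ n"
    unfolding cnt_genfun[OF k] ..
  also have "\<dots> \<le> exp (- s * real n * q k) * exp ((s + s\<^sup>2) * q k * real n)"
  proof (rule mult_left_mono)
    have 1: "1 + (exp s - 1) * q k \<le> exp ((s + s\<^sup>2) * q k)"
    proof -
      have "(exp s - 1) * q k \<le> (s + s\<^sup>2) * q k"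
        using exp_le_quadratic[OF s1] q_nonneg[OF k] by (intro mult_right_mono) auto
      then show ?thesis using exp_ge_add_one_self[of "(s + s\<^sup>2) * q k"] by linarith
    qed
    have 0: "0 \<le> 1 + (exp s - 1) * q k"
    proof -
      have "1 + (exp s - 1) * q k = (1 - q k) + exp s * q k" by (simp add: algebra_simps)
      moreover have "0 \<le> (1 - q k) + exp s * q k" using q1 q_nonneg[OF k] by simp
      ultimately show ?thesis by (simp only:)
    qed
    have "(1 + (exp s - 1) * q k) ^ n \<le> exp ((s + s\<^sup>2) * q k) ^ n" by (rule power_mono[OF 1 0])
    also have "\<dots> = exp ((s + s\<^sup>2) * q k * real n)" by (simp only: exp_of_nat_mult[symmetric] mult.commute)
    finally show "(1 + (exp s - 1) * q k) ^ n \<le> exp ((s + s\<^sup>2) * q k * real n)" .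
  qed simp
  also have "\<dots> = exp (q k * (s\<^sup>2 * real n))" by (simp add: exp_add[symmetric] algebra_simps)
  also have "\<dots> \<le> exp 1" unfolding s2 using q1 by simp
  finally show ?thesis .
qed

lemma count_dev_tight:
  assumes k: "k < m" and n: "n \<ge> 1"
  shows "(\<Sum>\<omega>\<in>\<Omega>n n. Wn n \<omega> * \<bar>count_dev n \<omega> k\<bar>) \<le> 2 * exp 1"
proof -
  have "(\<Sum>\<omega>\<in>\<Omega>n n. Wn n \<omega> * \<bar>count_dev n \<omega> k\<bar>) \<le> (\<Sum>\<omega>\<in>\<Omega>n n. Wn n \<omega> * (exp (1 * count_dev n \<omega> k) + exp (- 1 * count_dev n \<omega> k)))"
    by (intro sum_mono mult_left_mono W_nonneg) (use abs_le_exp_sum in auto)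
  also have "\<dots> = (\<Sum>\<omega>\<in>\<Omega>n n. Wn n \<omega> * exp (1 * count_dev n \<omega> k)) + (\<Sum>\<omega>\<in>\<Omega>n n. Wn n \<omega> * exp (- 1 * count_dev n \<omega> k))"
    by (simp only: distrib_left sum.distrib)
  also have "\<dots> \<le> 2 * exp 1"
    using count_dev_exp_moment[OF k n, of 1] count_dev_exp_moment[OF k n, of "-1"] by linarith
  finally show ?thesis .
qed

lemma count_dev_char:
  "(\<lambda>n. \<Sum>\<omega>\<in>\<Omega>n n. of_real (Wn n \<omega>) * iexp (\<Sum>i<m. \<theta> i * count_dev n \<omega> i))
     \<longlonglongrightarrow> complex_of_real (exp (- mnvar m q \<theta> / 2))"
proof -
  have "(\<Sum>\<omega>\<in>\<Omega>n n. of_real (Wn n \<omega>) * iexp (\<Sum>i<m. \<theta> i * count_dev n \<omega> i)) =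
     iexp (- sqrt (real n) * (\<Sum>i<m. q i * \<theta> i)) * ((\<Sum>i<m. q i * iexp (\<theta> i / sqrt (real n))) + \<rho>) ^ n" for n
  proof -
    let ?s = "sqrt (real n)"
    have e: "iexp (\<Sum>i<m. \<theta> i * count_dev n \<omega> i) = iexp (- ?s * (\<Sum>i<m. q i * \<theta> i)) * (\<Prod>i<m. iexp (\<theta> i / ?s) ^ cnt \<omega> i)" for \<omega>
    proof -
      have x: "count_dev n \<omega> i = real (cnt \<omega> i) * (1 / ?s) - ?s * q i" for i
      proof -
        have "real n / ?s = ?s" by (rule real_div_sqrt) simp
        then have "real n * q i / ?s = ?s * q i" by (metis times_divide_eq_left)
        then show ?thesis unfolding count_dev_def diff_divide_distrib by simp
      qed
      have "(\<Sum>i<m. \<theta> i * count_dev n \<omega> i) = - ?s * (\<Sum>i<m. q i * \<theta> i) + (\<Sum>i<m. real (cnt \<omega> i) * (\<theta> i / ?s))"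
        unfolding x sum_distrib_left sum.distrib[symmetric] by (intro sum.cong refl) (simp add: algebra_simps)
      then have "iexp (\<Sum>i<m. \<theta> i * count_dev n \<omega> i) = iexp (- ?s * (\<Sum>i<m. q i * \<theta> i)) * iexp (\<Sum>i<m. real (cnt \<omega> i) * (\<theta> i / ?s))"
        by (simp only: of_real_add distrib_left exp_add)
      also have "iexp (\<Sum>i<m. real (cnt \<omega> i) * (\<theta> i / ?s)) = (\<Prod>i<m. iexp (real (cnt \<omega> i) * (\<theta> i / ?s)))"
        by (simp only: of_real_sum sum_distrib_left exp_sum[OF finite_lessThan])
      also have "\<dots> = (\<Prod>i<m. iexp (\<theta> i / ?s) ^ cnt \<omega> i)"
        by (intro prod.cong refl) (simp only: exp_of_nat_mult[symmetric] of_real_mult of_real_of_nat_eq mult.left_commute)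
      finally show ?thesis .
    qed
    have "(\<Sum>\<omega>\<in>\<Omega>n n. of_real (Wn n \<omega>) * iexp (\<Sum>i<m. \<theta> i * count_dev n \<omega> i)) =
        iexp (- ?s * (\<Sum>i<m. q i * \<theta> i)) * (\<Sum>\<omega>\<in>\<Omega>n n. of_real (Wn n \<omega>) * (\<Prod>i<m. iexp (\<theta> i / ?s) ^ cnt \<omega> i))"
      unfolding e sum_distrib_left by (intro sum.cong refl) (simp only: mult.left_commute)
    also have "(\<Sum>\<omega>\<in>\<Omega>n n. of_real (Wn n \<omega>) * (\<Prod>i<m. iexp (\<theta> i / ?s) ^ cnt \<omega> i)) =
        ((\<Sum>i<m. q i * iexp (\<theta> i / ?s)) + \<rho>) ^ n"
      using cweight_genfun[OF coupling_basic(2,1)[of K L], of n "\<lambda>i. iexp (\<theta> i / ?s)"]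
      unfolding m_length cnt_def q_def \<rho>_def .
    finally show ?thesis .
  qed
  then show ?thesis using multinomial_char[OF q_nonneg \<rho>_nonneg q_sum, where \<theta>=\<theta>] by simp
qed

lemma count_dev_cos:
  "(\<lambda>n. \<Sum>\<omega>\<in>\<Omega>n n. Wn n \<omega> * cos ((\<Sum>i<m. \<theta> i * count_dev n \<omega> i) + \<phi>)) \<longlonglongrightarrow> cos \<phi> * exp (- mnvar m q \<theta> / 2)"
proof -
  have "(\<lambda>n. Re (cis \<phi> * (\<Sum>\<omega>\<in>\<Omega>n n. of_real (Wn n \<omega>) * iexp (\<Sum>i<m. \<theta> i * count_dev n \<omega> i))))
     \<longlonglongrightarrow> Re (cis \<phi> * complex_of_real (exp (- mnvar m q \<theta> / 2)))"
    by (intro tendsto_Re tendsto_mult tendsto_const count_dev_char)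
  moreover have "Re (cis \<phi> * (\<Sum>\<omega>\<in>\<Omega>n n. of_real (Wn n \<omega>) * iexp (\<Sum>i<m. \<theta> i * count_dev n \<omega> i))) =
      (\<Sum>\<omega>\<in>\<Omega>n n. Wn n \<omega> * cos ((\<Sum>i<m. \<theta> i * count_dev n \<omega> i) + \<phi>))" for n
    unfolding sum_distrib_left Re_sum
  proof (intro sum.cong refl)
    fix \<omega>
    let ?y = "\<Sum>i<m. \<theta> i * count_dev n \<omega> i"
    have "cis \<phi> * cis ?y = cis (?y + \<phi>)" by (simp only: cis_mult add.commute)
    then have "cis \<phi> * (of_real (Wn n \<omega>) * iexp ?y) = of_real (Wn n \<omega>) * cis (?y + \<phi>)"
      by (subst mult.left_commute) (simp only: cis_conv_exp)
    then show "Re (cis \<phi> * (of_real (Wn n \<omega>) * iexp ?y)) = Wn n \<omega> * cos (?y + \<phi>)" by (simp only:) simp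
  qed
  moreover have "Re (cis \<phi> * complex_of_real (exp (- mnvar m q \<theta> / 2))) = cos \<phi> * exp (- mnvar m q \<theta> / 2)"
    by simp
  ultimately show ?thesis by (simp only:)
qed

section \<open>Comparison of rows and columns with the letter counts\<close>

definition "Crow = (\<Sum>j<K. 2 / ((\<alpha> j)\<^sup>2 - (\<alpha> (Suc j))\<^sup>2))"
definition "Ccol = (\<Sum>j<L. 2 / ((\<beta> j)\<^sup>2 - (\<beta> (Suc j))\<^sup>2))"

lemma strict_squares:
  "j < K \<Longrightarrow> 0 < (\<alpha> j)\<^sup>2 - (\<alpha> (Suc j))\<^sup>2" "j < L \<Longrightarrow> 0 < (\<beta> j)\<^sup>2 - (\<beta> (Suc j))\<^sup>2"
  using strict_rows[of j] strict_cols[of j] anti by (auto intro!: power_strict_mono)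

lemma Crow_nonneg: "0 \<le> Crow" and Ccol_nonneg: "0 \<le> Ccol"
  unfolding Crow_def Ccol_def
  by (intro sum_nonneg divide_nonneg_nonneg less_imp_le[OF strict_squares(1)] less_imp_le[OF strict_squares(2)]; simp)+

text \<open>Strictness makes the coefficient in \<open>dev_bound\<close> positive, so it can be
  divided out. Summing the reciprocals gives one constant for all j.\<close>

lemma row_dev_le:
  assumes "j \<le> K" "n \<ge> 1"
  shows "(\<Sum>i<j. row_dev n i) \<le> Crow"
proof (cases j)
  case (Suc k)
  then have k: "k < K" using assms by simp
  have "(\<Sum>i<j. row_dev n i) \<le> 2 / ((\<alpha> k)\<^sup>2 - (\<alpha> (Suc k))\<^sup>2)"
    using dev_bound(1)[OF assms(2), of k] strict_squares(1)[OF k] unfolding Suc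
    by (simp only: pos_le_divide_eq mult.commute)
  also have "\<dots> \<le> Crow" unfolding Crow_def
    by (rule member_le_sum[where f="\<lambda>j. 2 / ((\<alpha> j)\<^sup>2 - (\<alpha> (Suc j))\<^sup>2)"])
      (use k strict_squares(1) in \<open>auto intro!: divide_nonneg_nonneg less_imp_le\<close>)
  finally show ?thesis .
qed (use Crow_nonneg in simp)

lemma col_dev_le:
  assumes "j \<le> L" "n \<ge> 1"
  shows "(\<Sum>i<j. col_dev n i) \<le> Ccol"
proof (cases j)
  case (Suc k)
  then have k: "k < L" using assms by simp
  have "(\<Sum>i<j. col_dev n i) \<le> 2 / ((\<beta> k)\<^sup>2 - (\<beta> (Suc k))\<^sup>2)"
    using dev_bound(2)[OF assms(2), of k] strict_squares(2)[OF k] unfolding Suc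
    by (simp only: pos_le_divide_eq mult.commute)
  also have "\<dots> \<le> Ccol" unfolding Ccol_def
    by (rule member_le_sum[where f="\<lambda>j. 2 / ((\<beta> j)\<^sup>2 - (\<beta> (Suc j))\<^sup>2)"])
      (use k strict_squares(2) in \<open>auto intro!: divide_nonneg_nonneg less_imp_le\<close>)
  finally show ?thesis .
qed (use Ccol_nonneg in simp)

text \<open>The gaps of partial sums are non-negative pointwise by the coupling, and their means are
  the deviations already bounded, since n * q is the mean of a count.\<close>

lemma partial_gap:
  assumes n: "n \<ge> 1"
  shows "j \<le> K \<Longrightarrow> \<omega> \<in> \<Omega>n n \<Longrightarrow> 0 \<le> (\<Sum>i<j. real (fst \<omega> i) - real (cnt \<omega> i))"
    and "j \<le> K \<Longrightarrow> (\<Sum>\<omega>\<in>\<Omega>n n. Wn n \<omega> * (\<Sum>i<j. real (fst \<omega> i) - real (cnt \<omega> i))) \<le> Crow"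
    and "j \<le> L \<Longrightarrow> \<omega> \<in> \<Omega>n n \<Longrightarrow> 0 \<le> (\<Sum>i<j. real (colen (fst \<omega>) i) - real (cnt \<omega> (K + i)))"
    and "j \<le> L \<Longrightarrow> (\<Sum>\<omega>\<in>\<Omega>n n. Wn n \<omega> * (\<Sum>i<j. real (colen (fst \<omega>) i) - real (cnt \<omega> (K + i)))) \<le> Ccol"
proof -
  show "0 \<le> (\<Sum>i<j. real (fst \<omega> i) - real (cnt \<omega> i))" if "j \<le> K" "\<omega> \<in> \<Omega>n n"
    using counts_rows(1)[OF that(2)[unfolded kinds_def] that(1)]
    by (simp add: sum_subtractf cnt_def of_nat_sum[symmetric] del: of_nat_sum)
  show "0 \<le> (\<Sum>i<j. real (colen (fst \<omega>) i) - real (cnt \<omega> (K + i)))" if "j \<le> L" "\<omega> \<in> \<Omega>n n"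
    using counts_rows(2)[OF that(2)[unfolded kinds_def] that(1)]
    by (simp add: sum_subtractf cnt_def of_nat_sum[symmetric] del: of_nat_sum)
  have swap: "(\<Sum>\<omega>\<in>\<Omega>n n. Wn n \<omega> * (\<Sum>i<j. g (fst \<omega>) i - real (cnt \<omega> (c + i)))) =
      (\<Sum>i<j. expect n (\<lambda>f. g f i)) - (\<Sum>i<j. real n * q (c + i))" if "c + j \<le> m" for g :: "(nat \<Rightarrow> nat) \<Rightarrow> nat \<Rightarrow> real" and c j
  proof -
    have "(\<Sum>\<omega>\<in>\<Omega>n n. Wn n \<omega> * (\<Sum>i<j. g (fst \<omega>) i - real (cnt \<omega> (c + i)))) =
        (\<Sum>i<j. (\<Sum>\<omega>\<in>\<Omega>n n. Wn n \<omega> * g (fst \<omega>) i) - (\<Sum>\<omega>\<in>\<Omega>n n. Wn n \<omega> * real (cnt \<omega> (c + i))))"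
      unfolding sum_subtractf[symmetric] sum_distrib_left by (subst sum.swap) (simp only: right_diff_distrib)
    also have "\<dots> = (\<Sum>i<j. expect n (\<lambda>f. g f i) - real n * q (c + i))"
    proof (intro sum.cong refl arg_cong2[where f="(-)"])
      fix i assume "i \<in> {..<j}"
      then show "(\<Sum>\<omega>\<in>\<Omega>n n. Wn n \<omega> * real (cnt \<omega> (c + i))) = real n * q (c + i)"
        using that by (intro cnt_mean) simp
      show "(\<Sum>\<omega>\<in>\<Omega>n n. Wn n \<omega> * g (fst \<omega>) i) = expect n (\<lambda>f. g f i)" by (rule W_marginal)
    qed
    finally show ?thesis by (simp only: sum_subtractf)
  qed
  show "(\<Sum>\<omega>\<in>\<Omega>n n. Wn n \<omega> * (\<Sum>i<j. real (fst \<omega> i) - real (cnt \<omega> i))) \<le> Crow" if "j \<le> K"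
  proof -
    have "(\<Sum>\<omega>\<in>\<Omega>n n. Wn n \<omega> * (\<Sum>i<j. real (fst \<omega> i) - real (cnt \<omega> (0 + i)))) =
        (\<Sum>i<j. expect n (\<lambda>f. real (f i))) - (\<Sum>i<j. real n * q (0 + i))"
      by (rule swap[where g="\<lambda>f i. real (f i)"]) (use that in \<open>simp add: m_def\<close>)
    also have "(\<Sum>i<j. real n * q (0 + i)) = (\<Sum>i<j. real n * \<alpha> i)"
      using that by (intro sum.cong refl) (simp add: q_row)
    also have "(\<Sum>i<j. expect n (\<lambda>f. real (f i))) - (\<Sum>i<j. real n * \<alpha> i) = (\<Sum>i<j. row_dev n i)"
      by (simp only: row_dev_def sum_subtractf)
    also have "\<dots> \<le> Crow" by (rule row_dev_le[OF that n])
    finally show ?thesis by simp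
  qed
  show "(\<Sum>\<omega>\<in>\<Omega>n n. Wn n \<omega> * (\<Sum>i<j. real (colen (fst \<omega>) i) - real (cnt \<omega> (K + i)))) \<le> Ccol" if "j \<le> L"
  proof -
    have "(\<Sum>\<omega>\<in>\<Omega>n n. Wn n \<omega> * (\<Sum>i<j. real (colen (fst \<omega>) i) - real (cnt \<omega> (K + i)))) =
        (\<Sum>i<j. expect n (\<lambda>f. real (colen f i))) - (\<Sum>i<j. real n * q (K + i))"
      by (rule swap[where g="\<lambda>f i. real (colen f i)"]) (use that in \<open>simp add: m_def\<close>)
    also have "(\<Sum>i<j. real n * q (K + i)) = (\<Sum>i<j. real n * \<beta> i)"
      using that by (intro sum.cong refl) (simp add: q_col)
    also have "(\<Sum>i<j. expect n (\<lambda>f. real (colen f i))) - (\<Sum>i<j. real n * \<beta> i) = (\<Sum>i<j. col_dev n i)"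
      by (simp only: col_dev_def sum_subtractf)
    also have "\<dots> \<le> Ccol" by (rule col_dev_le[OF that n])
    finally show ?thesis .
  qed
qed

text \<open>A single row may be shorter than its count, so d k itself has no sign; it is a
  difference of two non-negative partial sums.\<close>

lemma abs_increment_le:
  fixes d :: "nat \<Rightarrow> real"
  assumes "0 \<le> (\<Sum>i<k. d i)" "0 \<le> (\<Sum>i<Suc k. d i)"
  shows "\<bar>d k\<bar> \<le> (\<Sum>i<Suc k. d i) + (\<Sum>i<k. d i)"
  using assms by (simp add: abs_le_iff)

text \<open>The factor 2 stands for the two partial sums that bound one increment; adding both
  constants covers rows and columns alike.\<close>

definition "Cgap = 2 * (Crow + Ccol)"

lemma gap_bound:
  assumes n: "n \<ge> 1" and k: "k < m"
  shows "(\<Sum>\<omega>\<in>\<Omega>n n. Wn n \<omega> * \<bar>shape_dev n (fst \<omega>) k - count_dev n \<omega> k\<bar>) \<le> Cgap / sqrt (real n)"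
proof -
  have main: "(\<Sum>\<omega>\<in>\<Omega>n n. Wn n \<omega> * \<bar>d \<omega> k'\<bar>) \<le> 2 * C"
    if d: "\<And>j \<omega>. j \<le> J \<Longrightarrow> \<omega> \<in> \<Omega>n n \<Longrightarrow> 0 \<le> (\<Sum>i<j. d \<omega> i)"
      "\<And>j. j \<le> J \<Longrightarrow> (\<Sum>\<omega>\<in>\<Omega>n n. Wn n \<omega> * (\<Sum>i<j. d \<omega> i)) \<le> C" and k': "k' < J"
    for d :: "(nat \<Rightarrow> nat) \<times> (nat \<Rightarrow> nat) list \<Rightarrow> nat \<Rightarrow> real" and J C k'
  proof -
    have "(\<Sum>\<omega>\<in>\<Omega>n n. Wn n \<omega> * \<bar>d \<omega> k'\<bar>) \<le> (\<Sum>\<omega>\<in>\<Omega>n n. Wn n \<omega> * ((\<Sum>i<Suc k'. d \<omega> i) + (\<Sum>i<k'. d \<omega> i)))"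
      by (intro sum_mono mult_left_mono abs_increment_le W_nonneg d(1)) (use k' in auto)
    also have "\<dots> = (\<Sum>\<omega>\<in>\<Omega>n n. Wn n \<omega> * (\<Sum>i<Suc k'. d \<omega> i)) + (\<Sum>\<omega>\<in>\<Omega>n n. Wn n \<omega> * (\<Sum>i<k'. d \<omega> i))"
      by (simp only: distrib_left sum.distrib)
    also have "\<dots> \<le> 2 * C" using d(2)[of "Suc k'"] d(2)[of k'] k' by linarith
    finally show ?thesis .
  qed
  have scale: "(\<Sum>\<omega>\<in>\<Omega>n n. Wn n \<omega> * \<bar>shape_dev n (fst \<omega>) k - count_dev n \<omega> k\<bar>) =
      (\<Sum>\<omega>\<in>\<Omega>n n. Wn n \<omega> * \<bar>D \<omega>\<bar>) / sqrt (real n)"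
    if "\<And>\<omega>. shape_dev n (fst \<omega>) k - count_dev n \<omega> k = D \<omega> / sqrt (real n)" for D
    unfolding that sum_divide_distrib by (intro sum.cong refl) (simp add: abs_divide)
  show ?thesis
  proof (cases "k < K")
    case True
    have "(\<Sum>\<omega>\<in>\<Omega>n n. Wn n \<omega> * \<bar>real (fst \<omega> k) - real (cnt \<omega> k)\<bar>) \<le> 2 * Crow"
      by (rule main[where d="\<lambda>\<omega> i. real (fst \<omega> i) - real (cnt \<omega> i)" and J=K]) (use partial_gap[OF n] True in auto)
    also have "\<dots> \<le> Cgap" using Ccol_nonneg by (simp add: Cgap_def)
    finally have le: "(\<Sum>\<omega>\<in>\<Omega>n n. Wn n \<omega> * \<bar>real (fst \<omega> k) - real (cnt \<omega> k)\<bar>) / sqrt (real n) \<le> Cgap / sqrt (real n)"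
      by (rule divide_right_mono) simp
    have e: "shape_dev n (fst \<omega>) k - count_dev n \<omega> k = (real (fst \<omega> k) - real (cnt \<omega> k)) / sqrt (real n)" for \<omega>
      using True by (simp add: shape_dev_def count_dev_def q_row diff_divide_distrib mult.commute)
    show ?thesis unfolding scale[where D="\<lambda>\<omega>. real (fst \<omega> k) - real (cnt \<omega> k)", OF e] by (rule le)
  next
    case False
    define j where "j = k - K"
    have j: "j < L" "k = K + j" using False k by (auto simp: j_def m_def)
    have "(\<Sum>\<omega>\<in>\<Omega>n n. Wn n \<omega> * \<bar>real (colen (fst \<omega>) j) - real (cnt \<omega> (K + j))\<bar>) \<le> 2 * Ccol"
      by (rule main[where d="\<lambda>\<omega> i. real (colen (fst \<omega>) i) - real (cnt \<omega> (K + i))" and J=L]) (use partial_gap[OF n] j in auto)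
    also have "\<dots> \<le> Cgap" using Crow_nonneg by (simp add: Cgap_def)
    finally have le: "(\<Sum>\<omega>\<in>\<Omega>n n. Wn n \<omega> * \<bar>real (colen (fst \<omega>) j) - real (cnt \<omega> (K + j))\<bar>) / sqrt (real n) \<le> Cgap / sqrt (real n)"
      by (rule divide_right_mono) simp
    have e: "shape_dev n (fst \<omega>) k - count_dev n \<omega> k = (real (colen (fst \<omega>) j) - real (cnt \<omega> (K + j))) / sqrt (real n)" for \<omega>
      using j k by (simp add: shape_dev_def count_dev_def q_col diff_divide_distrib mult.commute)
    show ?thesis unfolding scale[where D="\<lambda>\<omega>. real (colen (fst \<omega>) j) - real (cnt \<omega> (K + j))", OF e] by (rule le)
  qed
qed

lemma shape_dev_tight:
  assumes k: "k < m"
  shows "(\<Sum>\<omega>\<in>\<Omega>n n. Wn n \<omega> * \<bar>shape_dev n (fst \<omega>) k\<bar>) \<le> Cgap + 2 * exp 1"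
proof (cases "n \<ge> 1")
  case True
  have Cg: "0 \<le> Cgap" using Crow_nonneg Ccol_nonneg by (simp add: Cgap_def)
  have "(\<Sum>\<omega>\<in>\<Omega>n n. Wn n \<omega> * \<bar>shape_dev n (fst \<omega>) k\<bar>) \<le>
      (\<Sum>\<omega>\<in>\<Omega>n n. Wn n \<omega> * (\<bar>shape_dev n (fst \<omega>) k - count_dev n \<omega> k\<bar> + \<bar>count_dev n \<omega> k\<bar>))"
    by (intro sum_mono mult_left_mono W_nonneg) auto
  also have "\<dots> = (\<Sum>\<omega>\<in>\<Omega>n n. Wn n \<omega> * \<bar>shape_dev n (fst \<omega>) k - count_dev n \<omega> k\<bar>) + (\<Sum>\<omega>\<in>\<Omega>n n. Wn n \<omega> * \<bar>count_dev n \<omega> k\<bar>)"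
    by (simp only: distrib_left sum.distrib)
  also have "\<dots> \<le> Cgap / sqrt (real n) + 2 * exp 1"
    by (intro add_mono gap_bound count_dev_tight True k)
  also have "Cgap / sqrt (real n) \<le> Cgap / 1"
    by (rule divide_left_mono) (use True Cg in auto)
  finally show ?thesis by simp
next
  case False
  \<comment> \<open>For n = 0 the division by sqrt 0 yields 0.\<close>
  then have "shape_dev n f k = 0" for f by (simp add: shape_dev_def)
  moreover have "0 \<le> Cgap" using Crow_nonneg Ccol_nonneg by (simp add: Cgap_def)
  ultimately show ?thesis by simp
qed

text \<open>Cosine is Lipschitz, so a mean absolute gap of order 1 / sqrt n does not affect the
  limit.\<close>

lemma shape_dev_cos:
  "(\<lambda>n. \<Sum>\<omega>\<in>\<Omega>n n. Wn n \<omega> * cos ((\<Sum>i<m. \<theta> i * shape_dev n (fst \<omega>) i) + \<phi>)) \<longlonglongrightarrow> cos \<phi> * exp (- mnvar m q \<theta> / 2)"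
proof -
  let ?F = "\<lambda>n. \<Sum>\<omega>\<in>\<Omega>n n. Wn n \<omega> * cos ((\<Sum>i<m. \<theta> i * shape_dev n (fst \<omega>) i) + \<phi>)"
  let ?N = "\<lambda>n. \<Sum>\<omega>\<in>\<Omega>n n. Wn n \<omega> * cos ((\<Sum>i<m. \<theta> i * count_dev n \<omega> i) + \<phi>)"
  define T where "T = (\<Sum>i<m. \<bar>\<theta> i\<bar>) * Cgap"
  have "(\<lambda>n. ?F n - ?N n) \<longlonglongrightarrow> 0"
  proof (rule Lim_null_comparison)
    show "\<forall>\<^sub>F n in sequentially. norm (?F n - ?N n) \<le> T / sqrt (real n)"
      using eventually_ge_at_top[of 1]
    proof eventually_elim
      case (elim n)
      have "norm (?F n - ?N n) \<le> (\<Sum>\<omega>\<in>\<Omega>n n. Wn n \<omega> * (\<Sum>i<m. \<bar>\<theta> i\<bar> * \<bar>shape_dev n (fst \<omega>) i - count_dev n \<omega> i\<bar>))"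
        unfolding sum_subtractf[symmetric] right_diff_distrib[symmetric]
      proof (rule sum_norm_le)
        fix \<omega> assume w: "\<omega> \<in> \<Omega>n n"
        let ?a = "(\<Sum>i<m. \<theta> i * shape_dev n (fst \<omega>) i) + \<phi>" and ?b = "(\<Sum>i<m. \<theta> i * count_dev n \<omega> i) + \<phi>"
        have "\<bar>?a - ?b\<bar> = \<bar>\<Sum>i<m. \<theta> i * (shape_dev n (fst \<omega>) i - count_dev n \<omega> i)\<bar>"
          by (simp add: right_diff_distrib sum_subtractf)
        also have "\<dots> \<le> (\<Sum>i<m. \<bar>\<theta> i\<bar> * \<bar>shape_dev n (fst \<omega>) i - count_dev n \<omega> i\<bar>)"
          using sum_abs[of "\<lambda>i. \<theta> i * (shape_dev n (fst \<omega>) i - count_dev n \<omega> i)" "{..<m}"] by (simp only: abs_mult)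
        finally have ab: "\<bar>cos ?a - cos ?b\<bar> \<le> (\<Sum>i<m. \<bar>\<theta> i\<bar> * \<bar>shape_dev n (fst \<omega>) i - count_dev n \<omega> i\<bar>)"
          using cos_lipschitz[of ?a ?b] by linarith
        have "norm (Wn n \<omega> * (cos ?a - cos ?b)) = Wn n \<omega> * \<bar>cos ?a - cos ?b\<bar>"
          using W_nonneg[OF w] by (simp add: abs_mult)
        also have "\<dots> \<le> Wn n \<omega> * (\<Sum>i<m. \<bar>\<theta> i\<bar> * \<bar>shape_dev n (fst \<omega>) i - count_dev n \<omega> i\<bar>)"
          by (rule mult_left_mono[OF ab W_nonneg[OF w]])
        finally show "norm (Wn n \<omega> * (cos ?a - cos ?b)) \<le> Wn n \<omega> * (\<Sum>i<m. \<bar>\<theta> i\<bar> * \<bar>shape_dev n (fst \<omega>) i - count_dev n \<omega> i\<bar>)" .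
      qed
      also have "\<dots> = (\<Sum>i<m. \<bar>\<theta> i\<bar> * (\<Sum>\<omega>\<in>\<Omega>n n. Wn n \<omega> * \<bar>shape_dev n (fst \<omega>) i - count_dev n \<omega> i\<bar>))"
        unfolding sum_distrib_left by (subst sum.swap) (simp only: mult.left_commute)
      also have "\<dots> \<le> (\<Sum>i<m. \<bar>\<theta> i\<bar> * (Cgap / sqrt (real n)))"
        by (intro sum_mono mult_left_mono gap_bound elim) auto
      also have "\<dots> = T / sqrt (real n)" by (simp add: T_def sum_distrib_right sum_divide_distrib)
      finally show ?case .
    qed
    show "(\<lambda>n. T / sqrt (real n)) \<longlonglongrightarrow> 0"
      by (intro real_tendsto_divide_at_top[OF tendsto_const] filterlim_compose[OF sqrt_at_top] filterlim_real_sequentially)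
  qed
  from tendsto_add[OF this count_dev_cos[of \<theta> \<phi>]] show ?thesis by simp
qed

section \<open>Transfer to Young diagrams and conclusion\<close>

lemma expect_young: "expect n G = (\<Sum>lam\<in>young n. thoma_M \<alpha> \<beta> \<gamma> lam * G (shape lam))"
proof -
  have "expect n G = (\<Sum>lam\<in>young n. pmass n (shape lam) * G (shape lam))"
    unfolding expect_def by (rule sum.reindex_bij_betw[symmetric, OF shape_bij])
  then show ?thesis
    by (simp add: pmass_def thoma_M_def dimY_shape thoma_s_shape[OF like])
qed

text \<open>Convergence is proved on the space of chains, where the letter counts live. The test
  function depends on the diagram only, so passing to the marginal removes the coupling.\<close>

lemma convergence:
  assumes N: "prob_space N" "sets N = sets borel" "AE x in N. \<forall>i\<ge>m. x i = 0"
    and intN: "\<And>k. k < m \<Longrightarrow> integrable N (\<lambda>x. x k)"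
    and cosN: "\<And>\<theta> \<phi>. (\<integral>x. cos ((\<Sum>i<m. \<theta> i * x i) + \<phi>) \<partial>N) = cos \<phi> * exp (- mnvar m q \<theta> / 2)"
  shows "conv_in_law young (\<lambda>n. thoma_M \<alpha> \<beta> \<gamma>) (\<lambda>n lam. shape_dev n (shape lam)) N"
  unfolding conv_in_law_def
proof (intro allI impI, elim conjE)
  fix f :: "(nat \<Rightarrow> real) \<Rightarrow> real" assume f: "continuous_on UNIV f" "bounded (range f)"
  have "(\<lambda>n. \<Sum>\<omega>\<in>\<Omega>n n. Wn n \<omega> * f (shape_dev n (fst \<omega>))) \<longlonglongrightarrow> (\<integral>x. f x \<partial>N)"
  proof (rule weak_convergence_trig[where m=m and X="\<lambda>n \<omega>. shape_dev n (fst \<omega>)"])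
    show "shape_dev n (fst \<omega>) k = 0" if "m \<le> k" for n \<omega> k using that by (simp add: shape_dev_def m_def)
  qed (use W_nonneg W_sum shape_dev_tight shape_dev_cos f N intN cosN in auto)
  moreover have "(\<Sum>\<omega>\<in>\<Omega>n n. Wn n \<omega> * f (shape_dev n (fst \<omega>))) = (\<Sum>lam\<in>young n. thoma_M \<alpha> \<beta> \<gamma> lam * f (shape_dev n (shape lam)))" for n
    using W_marginal[where G="\<lambda>g. f (shape_dev n g)"] expect_young[where G="\<lambda>g. f (shape_dev n g)"] by metis
  ultimately show "(\<lambda>n. \<Sum>lam\<in>young n. thoma_M \<alpha> \<beta> \<gamma> lam * f (shape_dev n (shape lam))) \<longlonglongrightarrow> (\<integral>x. f x \<partial>N)"
    by (simp only:)
qed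

end

theorem theorem1:
  fixes \<alpha> \<beta> :: "nat \<Rightarrow> real" and \<gamma> :: real and K L :: nat
  assumes thoma: "thoma_params \<alpha> \<beta> \<gamma>"
    and strict_a: "\<forall>i. \<alpha> i \<noteq> 0 \<longrightarrow> \<alpha> i > \<alpha> (Suc i)"
    and strict_b: "\<forall>j. \<beta> j \<noteq> 0 \<longrightarrow> \<beta> j > \<beta> (Suc j)"
    and K: "K > 0" and L: "L > 0"
    and aK: "\<forall>i. Suc i < K \<longrightarrow> \<alpha> i > \<alpha> (Suc i)" and aK0: "\<alpha> (K - 1) > 0"
    and bL: "\<forall>j. Suc j < L \<longrightarrow> \<beta> j > \<beta> (Suc j)" and bL0: "\<beta> (L - 1) > 0"
  shows "\<exists>N. gaussian_law (K + L) N \<and>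
     (\<forall>k<K + L. integrable N (\<lambda>x. x k) \<and> (\<integral>x. x k \<partial>N) = 0) \<and>
     (\<forall>k<K + L. \<forall>l<K + L. integrable N (\<lambda>x. x k * x l)) \<and>
     (\<forall>i<K. (\<integral>x. (x i)^2 \<partial>N) = \<alpha> i - (\<alpha> i)^2) \<and>
     (\<forall>j<L. (\<integral>x. (x (K + j))^2 \<partial>N) = \<beta> j - (\<beta> j)^2) \<and>
     (\<forall>i<K. \<forall>i'<K. i \<noteq> i' \<longrightarrow> (\<integral>x. x i * x i' \<partial>N) = - \<alpha> i * \<alpha> i') \<and>
     (\<forall>j<L. \<forall>j'<L. j \<noteq> j' \<longrightarrow> (\<integral>x. x (K + j) * x (K + j') \<partial>N) = - \<beta> j * \<beta> j') \<and>
     (\<forall>i<K. \<forall>j<L. (\<integral>x. x i * x (K + j) \<partial>N) = - \<alpha> i * \<beta> j) \<and>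
     conv_in_law young (\<lambda>n. thoma_M \<alpha> \<beta> \<gamma>)
       (\<lambda>n lam k.
          if k < K then (real (row_len lam (Suc k)) - \<alpha> k * real n) / sqrt (real n)
          else if k < K + L then (real (col_len lam (Suc (k - K))) - \<beta> (k - K) * real n) / sqrt (real n)
          else 0)
       N"
proof -
  have anti: "\<alpha> (Suc i) \<le> \<alpha> i" "\<beta> (Suc i) \<le> \<beta> i" for i using thoma by (auto simp: thoma_params_def)
  interpret thoma_strict \<alpha> \<beta> \<gamma> K L
  proof
    show "thoma_params \<alpha> \<beta> \<gamma>" by (rule thoma)
    \<comment> \<open>For i = K - 1 the next parameter may be 0. As \<alpha> i is at least \<alpha>
      (K - 1) > 0, \<open>strict_a\<close> covers all i < K.\<close>
    show "\<alpha> (Suc i) < \<alpha> i" if "i < K" for i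
    proof -
      have "\<alpha> (K - 1) \<le> \<alpha> i"
        by (rule lift_Suc_antimono_le[of \<alpha>]) (use anti that in auto)
      then show ?thesis using strict_a aK0 by (auto dest: spec[of _ i])
    qed
    show "\<beta> (Suc j) < \<beta> j" if "j < L" for j
    proof -
      have "\<beta> (L - 1) \<le> \<beta> j"
        by (rule lift_Suc_antimono_le[of \<beta>]) (use anti that in auto)
      then show ?thesis using strict_b bL0 by (auto dest: spec[of _ j])
    qed
  qed
  have "(\<Sum>i<m. q i) \<le> 1" using q_sum \<rho>_nonneg by linarith
  from gaussian_exists[OF q_nonneg this] obtain N where N: "gaussian_law m N"
    "\<And>k. k < m \<Longrightarrow> integrable N (\<lambda>x. x k) \<and> (\<integral>x. x k \<partial>N) = 0"
    "\<And>k l. k < m \<Longrightarrow> l < m \<Longrightarrow> integrable N (\<lambda>x. x k * x l) \<and> (\<integral>x. x k * x l \<partial>N) = (if k = l then q k else 0) - q k * q l"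
    "\<And>t \<phi>. (\<integral>x. cos ((\<Sum>i<m. t i * x i) + \<phi>) \<partial>N) = cos \<phi> * exp (- mnvar m q t / 2)"
    by blast
  have X: "(\<lambda>n lam k. if k < K then (real (row_len lam (Suc k)) - \<alpha> k * real n) / sqrt (real n)
          else if k < K + L then (real (col_len lam (Suc (k - K))) - \<beta> (k - K) * real n) / sqrt (real n)
          else 0) = (\<lambda>n lam. shape_dev n (shape lam))"
    by (simp add: fun_eq_iff shape_dev_def m_def row_len_shape col_len_shape)
  have conv: "conv_in_law young (\<lambda>n. thoma_M \<alpha> \<beta> \<gamma>) (\<lambda>n lam. shape_dev n (shape lam)) N"
    using N(1) by (intro convergence) (auto simp: gaussian_law_def N(2,4))
  have row: "i < m" if "i < K" for i using that by (simp add: m_def)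
  have col: "K + j < m" if "j < L" for j using that by (simp add: m_def)
  show ?thesis
    unfolding X
  proof (intro exI[of _ N] conjI allI impI)
    show "gaussian_law (K + L) N" using N(1) by (simp add: m_def)
    show "integrable N (\<lambda>x. x k)" "(\<integral>x. x k \<partial>N) = 0" if "k < K + L" for k
      using N(2)[of k] that by (simp_all add: m_def)
    show "integrable N (\<lambda>x. x k * x l)" if "k < K + L" "l < K + L" for k l
      using N(3)[of k l] that by (simp add: m_def)
    show "(\<integral>x. (x i)^2 \<partial>N) = \<alpha> i - (\<alpha> i)^2" if "i < K" for i
      using N(3)[OF row[OF that] row[OF that]] by (simp add: power2_eq_square q_row[OF that])
    show "(\<integral>x. (x (K + j))^2 \<partial>N) = \<beta> j - (\<beta> j)^2" if "j < L" for j
      using N(3)[OF col[OF that] col[OF that]] by (simp add: power2_eq_square q_col[OF that])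
    show "(\<integral>x. x i * x i' \<partial>N) = - \<alpha> i * \<alpha> i'" if "i < K" "i' < K" "i \<noteq> i'" for i i'
      using N(3)[OF row[OF that(1)] row[OF that(2)]] that by (simp add: q_row)
    show "(\<integral>x. x (K + j) * x (K + j') \<partial>N) = - \<beta> j * \<beta> j'" if "j < L" "j' < L" "j \<noteq> j'" for j j'
      using N(3)[OF col[OF that(1)] col[OF that(2)]] that by (simp add: q_col)
    show "(\<integral>x. x i * x (K + j) \<partial>N) = - \<alpha> i * \<beta> j" if "i < K" "j < L" for i j
      using N(3)[OF row[OF that(1)] col[OF that(2)]] that by (simp add: q_row q_col)
    show "conv_in_law young (\<lambda>n. thoma_M \<alpha> \<beta> \<gamma>) (\<lambda>n lam. shape_dev n (shape lam)) N" by (rule conv)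
  qed
qed

end
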